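(* Let $K_{d+1}=[a,b]\times\prod_{j=1}^d[a_j,b_j]\subset(0,2)\times\mathbb{R}^d$. Let $(T_n)_{n\ge1}$, $(V_n)_{n\ge1}$ and $(g_n)_{n\ge1}$ be independent sequences such that: (1) $(g_n)_{n\ge1}$ is a sequence of independent complex-valued symmetric sub-Gaussian random variables with parameter $1$; (2) $T_n$ is the $n$th arrival time of a Poisson process with intensity $1$; (3) $(V_n)_{n\ge1}$ is a sequence of i.i.d. complex-valued random fields defined on $K_{d+1}$; (4) for any $(\alpha,u)\in K_{d+1}$, $V_n(\alpha,u)\in L^\alpha$. For $x=(\alpha,u)\in K_{d+1}$ put $$S_N(x)=\sum_{n=1}^N T_n^{-1/\alpha}V_n(\alpha,u)g_n,\qquad S(x)=\sum_{n=1}^{+\infty}T_n^{-1/\alpha}V_n(\alpha,u)g_n .$$ Let $\rho$ be a quasi-metric on $\mathbb{R}^{d+1}$ for which there exist $0<\underline{H}\le\overline{H}\le1$ and $c_{2,1},c_{2,2}\in(0,\infty)$ with $c_{2,1}\|x-y\|^{\overline{H}}\le\rho(x,y)\le c_{2,2}\|x-y\|^{\underline{H}}$ for all $x,y\in\mathbb{R}^{d+1}$ with $\|x-y\|\le1$. Assume that for some $x_0\in K_{d+1}$ there exist $r\in(0,+\infty)$, $\beta\in(0,1]$, $\eta\in\mathbb{R}$ and $p\in(b/2,+\infty)$ such that $\mathbb{E}(|V_1(x_0)|^{2p})<+\infty$ and $$\mathbb{E}\Bigg(\Bigg[\sup_{\substack{x,y\in K_{d+1}\\0<\|x-y\|\le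 r}}\frac{|V_1(x)-V_1(y)|}{\rho(x,y)^{\beta}|\log\rho(x,y)|^{\eta}}\Bigg]^{2p}\Bigg)<\infty.$$ 1. Then, almost surely $(S_N)_{N\in\mathbb{N}}$ converges uniformly on $K_{d+1}$ and its limit $S$ belongs almost surely to $\mathcal{H}_\rho(K_{d+1},\beta,\max(\eta,0)+1/2)$. 2. Moreover, when $p'>0$ is such that $1/p'\in(0,1/b-1/\min(2p,2))$, almost surely $$\sup_{N\in\mathbb{N}}N^{1/p'}\sup_{x\in K_{d+1}}|S(x)-S_N(x)|<+\infty.$$
   Context: $\|\cdot\|$ is the Euclidean norm. A complex-valued random variable $Z$ is sub-Gaussian with parameter $s\in[0,+\infty)$ if $\mathbb{E}(e^{\Re(\overline z Z)})\le e^{s^2|z|^2/2}$ for all $z\in\mathbb{C}$. $Z$ is symmetric if $Z$ and $-Z$ have the same law. Under (1)–(4), for each fixed $x$ the series defining $S(x)$ converges almost surely. A quasi-metric on $\mathbb{R}^{d+1}$ is a continuous function $\rho:\mathbb{R}^{d+1}\times\mathbb{R}^{d+1}\to[0,+\infty)$ such that $\rho(x,y)=0$ iff $x=y$, $\rho(x,y)=\rho(y,x)$, and for some constant $\kappa\ge1$, $\rho(x,z)\le\kappa(\rho(x,y)+\rho(y,z))$ for all $x,y,z$. For $\beta\in(0,1]$ and $\eta\in\mathbb{R}$, a (complex-valued) function $f$ on a set $K$ belongs to $\mathcal{H}_\rho(K,\beta,\eta)$ if there exists $C\in(0,+\infty)$ such that $|f(x)-f(y)|\le C\rho(x,y)^\beta[\log(1+\rho(x,y)^{-1})]^\eta$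 for all $x,y\in K$ (the right-hand side being $0$ when $x=y$). *)

theory Defs
  imports "HOL-Probability.Probability"
begin

text \<open>
  Sequences indexed by the positive integers are functions on \<^typ>\<open>nat\<close> whose value at 0 is
  irrelevant.
\<close>

definition iid_sequence :: "'w measure \<Rightarrow> 'a measure \<Rightarrow> (nat \<Rightarrow> 'w \<Rightarrow> 'a) \<Rightarrow> bool" where
  "iid_sequence M N X \<longleftrightarrow>
     prob_space.indep_vars M (\<lambda>_. N) X {1..} \<and> (\<forall>n\<ge>1. distr M N (X n) = distr M N (X 1))"

text \<open>The events generated by the whole sequence \<open>X 1, X 2, \<dots>\<close> of \<open>N\<close>-valued random elements.\<close>

definition seq_events :: "'w measure \<Rightarrow> 'a measure \<Rightarrow> (nat \<Rightarrow> 'w \<Rightarrow> 'a) \<Rightarrow> 'w set set" where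
  "seq_events M N X =
     sets (vimage_algebra (space M) (\<lambda>\<omega>. \<lambda>n\<in>{1..}. X n \<omega>) (\<Pi>\<^sub>M n\<in>{1..}. N))"

text \<open>
  The nonnegative integral is used because the expectation has to be finite: the Bochner integral
  of a non-integrable function is 0.
\<close>

definition sub_gaussian :: "'w measure \<Rightarrow> real \<Rightarrow> ('w \<Rightarrow> complex) \<Rightarrow> bool" where
  "sub_gaussian M s Z \<longleftrightarrow> 0 \<le> s \<and> Z \<in> borel_measurable M \<and>
     (\<forall>z. (\<integral>\<^sup>+ \<omega>. ennreal (exp (Re (cnj z * Z \<omega>))) \<partial>M) \<le> ennreal (exp (s\<^sup>2 * (cmod z)\<^sup>2 / 2)))"

definition symmetric_rv :: "'w measure \<Rightarrow> ('w \<Rightarrow> complex) \<Rightarrow> bool" where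
  "symmetric_rv M Z \<longleftrightarrow> Z \<in> borel_measurable M \<and> distr M borel Z = distr M borel (\<lambda>\<omega>. - Z \<omega>)"

text \<open>
  The Poisson process is given as a counting process indexed by the times \<open>t \<ge> 0\<close>. The fourth
  condition says that paths are right-continuous, \<^typ>\<open>nat\<close> being discrete.
\<close>

definition poisson_process :: "'w measure \<Rightarrow> real \<Rightarrow> (real \<Rightarrow> 'w \<Rightarrow> nat) \<Rightarrow> bool" where
  "poisson_process M l N \<longleftrightarrow> 0 < l \<and>
     (\<forall>t\<ge>0. N t \<in> measurable M (count_space UNIV)) \<and>
     (\<forall>\<omega>\<in>space M. N 0 \<omega> = 0 \<and> mono_on {0..} (\<lambda>t. N t \<omega>)) \<and>
     (\<forall>\<omega>\<in>space M. \<forall>t\<ge>0. \<forall>\<^sub>F s in at_right t. N s \<omega> = N t \<omega>) \<and>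
     (\<forall>t. 0 \<le> t 0 \<and> mono t \<longrightarrow>
        prob_space.indep_vars M (\<lambda>_. count_space UNIV)
          (\<lambda>k \<omega>. N (t (Suc k)) \<omega> - N (t k) \<omega>) UNIV) \<and>
     (\<forall>s t. 0 \<le> s \<and> s < t \<longrightarrow>
        distr M (count_space UNIV) (\<lambda>\<omega>. N t \<omega> - N s \<omega>) = measure_pmf (poisson_pmf (l * (t - s))))"

definition poisson_arrival_times :: "'w measure \<Rightarrow> real \<Rightarrow> (nat \<Rightarrow> 'w \<Rightarrow> real) \<Rightarrow> bool" where
  "poisson_arrival_times M l T \<longleftrightarrow>
     (\<exists>N. poisson_process M l N \<and> (\<forall>n\<ge>1. AE \<omega> in M. T n \<omega> = Inf {t. 0 \<le> t \<and> n \<le> N t \<omega>}))"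

definition quasi_metric :: "('e::metric_space \<Rightarrow> 'e \<Rightarrow> real) \<Rightarrow> bool" where
  "quasi_metric \<rho> \<longleftrightarrow>
     continuous_on UNIV (\<lambda>(x, y). \<rho> x y) \<and>
     (\<forall>x y. 0 \<le> \<rho> x y) \<and>
     (\<forall>x y. \<rho> x y = 0 \<longleftrightarrow> x = y) \<and>
     (\<forall>x y. \<rho> x y = \<rho> y x) \<and>
     (\<exists>\<kappa>\<ge>1. \<forall>x y z. \<rho> x z \<le> \<kappa> * (\<rho> x y + \<rho> y z))"

text \<open>For \<open>x = y\<close> the right-hand side is 0, because \<open>0 powr \<beta> = 0\<close>.\<close>

definition holder_class ::
    "('e \<Rightarrow> 'e \<Rightarrow> real) \<Rightarrow> 'e set \<Rightarrow> real \<Rightarrow> real \<Rightarrow> ('e \<Rightarrow> complex) set" where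
  "holder_class \<rho> K \<beta> \<eta> = {f. \<exists>C>0. \<forall>x\<in>K. \<forall>y\<in>K.
     cmod (f x - f y) \<le> C * \<rho> x y powr \<beta> * ln (1 + inverse (\<rho> x y)) powr \<eta>}"

text \<open>
  Real powers of extended nonnegative reals, with \<open>x\<^sup>0 = 1\<close>, and \<open>0\<^sup>a = \<infinity>\<close>, \<open>\<infinity>\<^sup>a = 0\<close> for \<open>a < 0\<close>
  (in contrast, \<open>0 powr a = 0\<close> on the reals for every \<open>a\<close>).
\<close>

definition epowr :: "ennreal \<Rightarrow> real \<Rightarrow> ennreal" where
  "epowr x a =
     (if a = 0 then 1
      else if x = 0 then (if a < 0 then \<top> else 0)
      else if x = \<top> then (if a < 0 then 0 else \<top>)
      else ennreal (enn2real x powr a))"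

text \<open>
  The quotient is formed in \<^typ>\<open>ennreal\<close>, so that at points with \<open>\<rho> x y = 1\<close>, where the logarithm
  vanishes, it is \<open>\<infinity>\<close> if \<open>\<eta> > 0\<close> and \<open>f x \<noteq> f y\<close>, and 0 if \<open>\<eta> < 0\<close>. (Here \<open>0 / 0 = 0\<close>.)
\<close>

definition modulus_sup ::
    "('e::real_normed_vector \<Rightarrow> 'e \<Rightarrow> real) \<Rightarrow> 'e set \<Rightarrow> real \<Rightarrow> real \<Rightarrow> real \<Rightarrow> ('e \<Rightarrow> complex) \<Rightarrow> ennreal"
  where
  "modulus_sup \<rho> K r \<beta> \<eta> f =
     (SUP (x, y) \<in> {(x, y). x \<in> K \<and> y \<in> K \<and> 0 < norm (x - y) \<and> norm (x - y) \<le> r}.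
        ennreal (cmod (f x - f y)) /
        (ennreal (\<rho> x y powr \<beta>) * epowr (ennreal \<bar>ln (\<rho> x y)\<bar>) \<eta>))"

text \<open>The parameter space consists of the points \<open>x = (\<alpha>, u)\<close>; thus \<open>\<alpha> = fst x\<close>.\<close>

definition series_term ::
    "(nat \<Rightarrow> 'w \<Rightarrow> real) \<Rightarrow> (nat \<Rightarrow> 'w \<Rightarrow> real \<times> 'u \<Rightarrow> complex) \<Rightarrow> (nat \<Rightarrow> 'w \<Rightarrow> complex) \<Rightarrow>
      nat \<Rightarrow> real \<times> 'u \<Rightarrow> 'w \<Rightarrow> complex" where
  "series_term T V g n x \<omega> = of_real (T n \<omega> powr (- 1 / fst x)) * V n \<omega> x * g n \<omega>"

definition partial_series ::
    "(nat \<Rightarrow> 'w \<Rightarrow> real) \<Rightarrow> (nat \<Rightarrow> 'w \<Rightarrow> real \<times> 'u \<Rightarrow> complex) \<Rightarrow> (nat \<Rightarrow> 'w \<Rightarrow> complex) \<Rightarrow>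
      nat \<Rightarrow> real \<times> 'u \<Rightarrow> 'w \<Rightarrow> complex" where
  "partial_series T V g N x \<omega> = (\<Sum>n=1..N. series_term T V g n x \<omega>)"

definition full_series ::
    "(nat \<Rightarrow> 'w \<Rightarrow> real) \<Rightarrow> (nat \<Rightarrow> 'w \<Rightarrow> real \<times> 'u \<Rightarrow> complex) \<Rightarrow> (nat \<Rightarrow> 'w \<Rightarrow> complex) \<Rightarrow>
      real \<times> 'u \<Rightarrow> 'w \<Rightarrow> complex" where
  "full_series T V g x \<omega> = (\<Sum>n. series_term T V g (Suc n) x \<omega>)"

end

theory Submission
  imports Defs "HOL-Real_Asymp.Real_Asymp"
begin

text \<open>
  Given the arrival times and the fields, \<open>S\<^sub>N(x) - S\<^sub>N(y)\<close> is a sum of independent sub-Gaussian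
  variables with known coefficients, hence it has Gaussian tails at the scale of the square root of
  the sum of the squared coefficients. Near the diagonal every coefficient
  \<open>T\<^sub>n\<^sup>-\<^sup>1\<^sup>/\<^sup>\<alpha> V\<^sub>n(x)\<close> has increments bounded by \<open>A\<^sub>n \<rho>\<^sup>\<beta> |log \<rho>|\<^sup>\<eta>\<close> with random \<open>A\<^sub>n\<close>, where \<open>\<eta>\<close> has to
  be replaced by \<open>max \<eta> 0\<close> because the first factor is merely Lipschitz in \<open>\<alpha>\<close>. Chaining along
  \<open>2\<^sup>-\<^sup>l\<close>-nets for \<open>\<rho>\<close>, whose cardinality is exponential in \<open>l\<close>, costs a factor \<open>\<surd>l\<close> at level \<open>l\<close>; as
  \<open>l\<close> is comparable to \<open>|log \<rho>|\<close>, this is the additional exponent \<open>1/2\<close> of the logarithm.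

  Convergence, regularity of the limit and rate are obtained together. Let
  \<open>0 < \<theta> < 1/b - 1/min(2p,2)\<close>, choose a small \<open>\<delta> > 0\<close>, put \<open>s = \<theta> + \<delta>\<close> and multiply the \<open>n\<close>-th term
  by \<open>n\<^sup>s\<close>. Almost surely \<open>T\<^sub>n \<ge> c n\<close> with a random \<open>c > 0\<close>
  (\<open>poisson_arrival_times_lower_bound\<close>), and together with the moment assumption this leaves enough
  room for the weighted bounds \<open>n\<^sup>s A\<^sub>n\<close> to be square-summable (\<open>modulus_moments\<close>). The union bound is
  taken over all links of the chain and over all \<open>N\<close>; the latter costs only a factor
  \<open>\<surd>(log N) = O(N\<^sup>\<delta>)\<close> (\<open>sub_gaussian_partial_sums_bound\<close>). So the weighted partial sums and their
  moduli of continuity grow at most like \<open>N\<^sup>\<delta>\<close> (\<open>partial_sums_modulus\<close>). Removing the weight by Abel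
  summation turns this growth into convergence with remainder \<open>O(N\<^sup>\<delta>\<^sup>-\<^sup>s) = O(N\<^sup>-\<^sup>\<theta>)\<close>, uniformly on \<open>K\<close>;
  applied to the differences of the terms at two points, the same summation gives the modulus of
  the limit (\<open>damped_series_regularity\<close>).
\<close>

section \<open>Moduli of continuity on dyadic scales\<close>

text \<open>
  The modulus of continuity \<open>t\<^sup>\<beta> |log t|\<^sup>\<mu>\<close> at the scale \<open>t = 2\<^sup>-\<^sup>l\<close>, up to constants. In this discrete
  form it is submultiplicative, which is what sums over finer and finer scales need.
\<close>

definition level_weight :: "real \<Rightarrow> real \<Rightarrow> nat \<Rightarrow> real" where
  "level_weight \<beta> \<mu> l = 2 powr (- (real l * \<beta>)) * (real l + 1) powr \<mu>"

lemma level_weight_pos: "0 < level_weight \<beta> \<mu> l"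
  by (simp add: level_weight_def)

lemma level_weight_add_le:
  assumes "0 \<le> \<mu>"
  shows "level_weight \<beta> \<mu> (k + j) \<le> level_weight \<beta> \<mu> k * level_weight \<beta> \<mu> j"
proof -
  have "(real (k + j) + 1) powr \<mu> \<le> ((real k + 1) * (real j + 1)) powr \<mu>"
    using assms by (intro powr_mono2) (auto simp: algebra_simps)
  also have "\<dots> = (real k + 1) powr \<mu> * (real j + 1) powr \<mu>"
    by (simp add: powr_mult)
  finally have poly: "(real (k + j) + 1) powr \<mu> \<le> (real k + 1) powr \<mu> * (real j + 1) powr \<mu>" .
  have expo: "2 powr (- (real (k + j) * \<beta>)) = 2 powr (- (real k * \<beta>)) * 2 powr (- (real j * \<beta>))"
    by (simp add: powr_add [symmetric] algebra_simps)
  show ?thesis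
    unfolding level_weight_def expo
    using mult_left_mono[OF poly, of "2 powr (- (real k * \<beta>)) * 2 powr (- (real j * \<beta>))"]
    by (simp add: mult_ac)
qed

lemma summable_level_weight:
  assumes "0 < \<beta>" "0 \<le> \<mu>"
  shows "summable (level_weight \<beta> \<mu>)"
proof (rule summable_comparison_test_bigo)
  show "summable (\<lambda>l. norm ((2 powr (- \<beta> / 2)) ^ l))"
    using assms by (auto intro!: summable_geometric simp: powr_less_one)
  have "level_weight \<beta> \<mu> \<in> O(\<lambda>l. 2 powr (- (real l * \<beta> / 2)))"
    unfolding level_weight_def using assms by real_asymp
  moreover have "2 powr (- (real l * \<beta> / 2)) = (2 powr (- \<beta> / 2)) ^ l" for l
    by (simp add: powr_realpow [symmetric] powr_powr mult.commute)
  ultimately show "level_weight \<beta> \<mu> \<in> O(\<lambda>l. (2 powr (- \<beta> / 2)) ^ l)"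
    by simp
qed

lemma level_weight_le_suminf:
  assumes "0 < \<beta>" "0 \<le> \<mu>"
  shows "level_weight \<beta> \<mu> l \<le> suminf (level_weight \<beta> \<mu>)"
  using sum_le_suminf[OF summable_level_weight[OF assms], of "{l}"]
  by (simp add: less_imp_le level_weight_pos)

text \<open>
  A union bound over exponentially many links at level \<open>l\<close> costs the factor \<open>sqrt (l + 1)\<close>, that is,
  half a power of the logarithm.
\<close>

lemma level_weight_half:
  "level_weight \<beta> (\<mu> + 1 / 2) l = level_weight \<beta> \<mu> l * sqrt (real l + 1)"
  by (simp add: level_weight_def powr_add powr_half_sqrt)

lemma level_weight_tendsto_0:
  assumes "0 < \<beta>" "0 \<le> \<mu>"
  shows "level_weight \<beta> \<mu> \<longlonglongrightarrow> 0"
  using summable_LIMSEQ_zero[OF summable_level_weight[OF assms]] .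

text \<open>
  Comparing \<open>\<rho>\<close> up to a constant factor shifts levels by a constant, which the weights absorb.
\<close>

lemma level_weight_shift_le:
  assumes "0 \<le> \<mu>" "j \<le> l"
  shows "level_weight \<beta> \<mu> (l - j) \<le> 2 powr (real j * \<beta>) * level_weight \<beta> \<mu> l"
proof -
  have "(real (l - j) + 1) powr \<mu> \<le> (real l + 1) powr \<mu>"
    using assms by (intro powr_mono2) auto
  moreover have "2 powr (- (real (l - j) * \<beta>)) = 2 powr (real j * \<beta>) * 2 powr (- (real l * \<beta>))"
    using assms by (simp add: powr_add [symmetric] of_nat_diff algebra_simps)
  ultimately show ?thesis
    by (simp add: level_weight_def algebra_simps)
qed

lemma dyadic_level:
  fixes t :: real
  assumes "0 < t" "t \<le> 2 powr (- real l)"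
  obtains k where "l \<le> k" "2 powr (- real k - 1) < t" "t \<le> 2 powr (- real k)"
proof
  define k where "k = nat \<lfloor>- log 2 t\<rfloor>"
  have "real l \<le> - log 2 t"
    using assms log_le_cancel_iff[of 2 t "2 powr (- real l)"] by simp
  then have *: "real k \<le> - log 2 t" "- log 2 t < real k + 1" "l \<le> k"
    unfolding k_def by linarith+
  then show "l \<le> k" by simp
  show "t \<le> 2 powr (- real k)"
    using * assms powr_mono[of "log 2 t" "- real k" 2] by simp
  show "2 powr (- real k - 1) < t"
    using * assms powr_less_mono[of "- real k - 1" "log 2 t" 2] by simp
qed

section \<open>Nets and chaining\<close>

text \<open>
  The net consists of the points whose coordinates, measured from \<open>lo\<close>, are multiples of \<open>1 / m\<close> of the side lengths.
\<close>

lemma box_net: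
  fixes lo hi :: "'e::euclidean_space"
  assumes ne: "x\<^sub>0 \<in> cbox lo hi" and m: "1 \<le> m"
  obtains D where "finite D" "D \<subseteq> cbox lo hi" "card D \<le> (m + 1) ^ DIM('e)"
    "\<And>x. x \<in> cbox lo hi \<Longrightarrow> \<exists>y\<in>D. norm (x - y) \<le> (\<Sum>i\<in>Basis. (hi - lo) \<bullet> i) / real m"
proof -
  define pt where
    "pt f = (\<Sum>i\<in>Basis. (lo \<bullet> i + (hi - lo) \<bullet> i * real (f i) / real m) *\<^sub>R i)" for f :: "'e \<Rightarrow> nat"
  define F where "F = (Basis :: 'e set) \<rightarrow>\<^sub>E {..m}"
  have pt_inner: "pt f \<bullet> i = lo \<bullet> i + (hi - lo) \<bullet> i * real (f i) / real m" if "i \<in> Basis" for f i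
    using that unfolding pt_def by (simp add: inner_sum_left_Basis)
  have le: "lo \<bullet> i \<le> hi \<bullet> i" if "i \<in> Basis" for i
    using ne that by (auto simp: mem_box intro: order_trans)
  have fin: "finite F"
    unfolding F_def by (intro finite_PiE) auto
  show thesis
  proof
    show "finite (pt ` F)"
      using fin by simp
    have "card (pt ` F) \<le> card F"
      using fin by (rule card_image_le)
    also have "\<dots> = (m + 1) ^ DIM('e)"
      unfolding F_def by (simp add: card_PiE)
    finally show "card (pt ` F) \<le> (m + 1) ^ DIM('e)" .
    show "pt ` F \<subseteq> cbox lo hi"
    proof safe
      fix f assume f: "f \<in> F"
      show "pt f \<in> cbox lo hi"
        unfolding mem_box
      proof
        fix i :: 'e assume i: "i \<in> Basis"
        have "f i \<le> m" using f i by (auto simp: F_def)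
        then have "(hi - lo) \<bullet> i * (real (f i) / real m) \<le> (hi - lo) \<bullet> i * 1"
          using le[OF i] m by (intro mult_left_mono) (auto simp: inner_diff_left)
        then show "lo \<bullet> i \<le> pt f \<bullet> i \<and> pt f \<bullet> i \<le> hi \<bullet> i"
          using i le[OF i] by (simp add: pt_inner inner_diff_left)
      qed
    qed
    fix x assume x: "x \<in> cbox lo hi"
    define t where "t i = (x \<bullet> i - lo \<bullet> i) / ((hi - lo) \<bullet> i)" for i
    define f where "f = restrict (\<lambda>i. nat \<lfloor>real m * t i\<rfloor>) Basis"
    have xb: "lo \<bullet> i \<le> x \<bullet> i" "x \<bullet> i \<le> hi \<bullet> i" if "i \<in> Basis" for i
      using x that by (auto simp: mem_box)
    have t01: "0 \<le> t i" "t i \<le> 1" if "i \<in> Basis" for i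
      using xb[OF that] le[OF that] by (auto simp: t_def divide_simps inner_diff_left)
    have fF: "f \<in> F"
      unfolding F_def
    proof (rule PiE_I)
      fix i :: 'e assume i: "i \<in> Basis"
      have "real m * t i \<le> real m"
        using t01[OF i] by (simp add: mult_left_le)
      then have "nat \<lfloor>real m * t i\<rfloor> \<le> m"
        by linarith
      then show "f i \<in> {..m}"
        using i by (simp add: f_def)
    qed (simp add: f_def)
    have "norm (x - pt f) \<le> (\<Sum>i\<in>Basis. \<bar>(x - pt f) \<bullet> i\<bar>)"
      by (rule norm_le_l1)
    also have "\<dots> \<le> (\<Sum>i\<in>Basis. (hi - lo) \<bullet> i / real m)"
    proof (rule sum_mono)
      fix i :: 'e assume i: "i \<in> Basis"
      have fi: "real (f i) \<le> real m * t i" "real m * t i \<le> real (f i) + 1"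
        using i t01[OF i] by (auto simp: f_def)
      have xi: "x \<bullet> i - lo \<bullet> i = (hi - lo) \<bullet> i * t i"
        using xb[OF i] le[OF i] by (auto simp: t_def inner_diff_left)
      have "(x - pt f) \<bullet> i = (hi - lo) \<bullet> i * (t i - real (f i) / real m)"
        unfolding inner_diff_left[of x] pt_inner[OF i] right_diff_distrib xi [symmetric] by simp
      moreover have "\<bar>t i - real (f i) / real m\<bar> \<le> 1 / real m"
      proof -
        have "t i - real (f i) / real m = (real m * t i - real (f i)) / real m"
          using m by (simp add: diff_divide_distrib)
        moreover have "\<bar>real m * t i - real (f i)\<bar> \<le> 1"
          using fi by simp
        ultimately show ?thesis
          using m by (simp add: abs_divide divide_right_mono)
      qed
      ultimately show "\<bar>(x - pt f) \<bullet> i\<bar> \<le> (hi - lo) \<bullet> i / real m"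
        using le[OF i] mult_left_mono[of "\<bar>t i - real (f i) / real m\<bar>" "1 / real m" "(hi - lo) \<bullet> i"]
        by (simp add: abs_mult inner_diff_left)
    qed
    finally show "\<exists>y\<in>pt ` F. norm (x - y) \<le> (\<Sum>i\<in>Basis. (hi - lo) \<bullet> i) / real m"
      using fF by (auto simp: sum_divide_distrib)
  qed
qed

text \<open>
  Both points are joined to the net at their own level by telescoping along their approximations in
  the finer nets. By the quasi-triangle inequality all links have length at most
  \<open>3 \<kappa>\<^sup>2 2\<^sup>-\<^sup>l\<close>, and by submultiplicativity the level weights sum up to a multiple of the weight at the
  coarsest level. The constant does not depend on \<open>f\<close>, so that the estimate can be used for all
  partial sums of a series at once.
\<close>

lemma chaining_modulus:
  fixes f :: "'e::metric_space \<Rightarrow> 'b::real_normed_vector"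
  assumes sym: "\<And>x y. \<rho> x y = \<rho> y x"
    and \<kappa>: "1 \<le> \<kappa>" and tri: "\<And>x y z. \<rho> x z \<le> \<kappa> * (\<rho> x y + \<rho> y z)"
    and D: "\<And>l. D l \<subseteq> K" "\<And>l x. x \<in> K \<Longrightarrow> \<exists>y\<in>D l. \<rho> x y \<le> 2 powr (- real l)"
    and w: "0 < \<beta>" "0 \<le> \<mu>" and B: "0 \<le> B"
    and lim: "\<And>x y. x \<in> K \<Longrightarrow> (\<And>l. y l \<in> K \<and> \<rho> x (y l) \<le> 2 powr (- real l)) \<Longrightarrow> (\<lambda>l. f (y l)) \<longlonglongrightarrow> f x"
    and links: "\<And>l u v. l\<^sub>0 \<le> l \<Longrightarrow> u \<in> D l \<Longrightarrow> v \<in> D l \<union> D (Suc l) \<Longrightarrow>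
        \<rho> u v \<le> 3 * \<kappa>\<^sup>2 * 2 powr (- real l) \<Longrightarrow> norm (f u - f v) \<le> B * level_weight \<beta> \<mu> l"
    and xy: "x \<in> K" "y \<in> K" "\<rho> x y \<le> 2 powr (- real k)" "l\<^sub>0 \<le> k"
  shows "norm (f x - f y) \<le> B * (1 + 2 * suminf (level_weight \<beta> \<mu>)) * level_weight \<beta> \<mu> k"
proof -
  define w where "w = level_weight \<beta> \<mu>"
  have sw: "summable w"
    unfolding w_def using assms by (intro summable_level_weight)
  have w_pos: "0 < w l" for l
    by (simp add: w_def level_weight_pos)
  have \<kappa>2: "\<kappa> \<le> \<kappa>\<^sup>2"
    using \<kappa> by (simp add: power2_eq_square)
  obtain \<pi> where \<pi>: "\<And>l x. x \<in> K \<Longrightarrow> \<pi> l x \<in> D l \<and> \<rho> x (\<pi> l x) \<le> 2 powr (- real l)"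
  proof -
    have "\<forall>l. \<exists>p. \<forall>x\<in>K. p x \<in> D l \<and> \<rho> x (p x) \<le> 2 powr (- real l)"
      using D(2) by (intro allI bchoice) blast
    then show ?thesis
      using that by metis
  qed
  have \<pi>K: "\<pi> l x \<in> K" if "x \<in> K" for l x
    using \<pi>[OF that] D(1) by blast
  have to_net: "norm (f x - f (\<pi> k x)) \<le> B * (suminf w * w k)" if x: "x \<in> K" for x
  proof -
    have lim_net: "(\<lambda>n. f (\<pi> (k + n) x)) \<longlonglongrightarrow> f x"
    proof -
      have "(\<lambda>n. f (\<pi> n x)) \<longlonglongrightarrow> f x"
        using x \<pi> \<pi>K by (intro lim) auto
      from LIMSEQ_ignore_initial_segment[OF this, of k] show ?thesis
        by (simp add: add.commute)
    qed
    have step: "norm (f (\<pi> (k + Suc n) x) - f (\<pi> (k + n) x)) \<le> B * (w k * w n)" for n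
    proof -
      have "\<rho> (\<pi> (k + n) x) (\<pi> (Suc (k + n)) x) \<le> \<kappa> * (2 powr (- real (k + n)) + 2 powr (- real (Suc (k + n))))"
        using tri[of "\<pi> (k + n) x" "\<pi> (Suc (k + n)) x" x] \<pi>[OF x, of "k + n"] \<pi>[OF x, of "Suc (k + n)"] \<kappa>
        by (smt (verit) mult_left_mono sym)
      also have "\<dots> \<le> \<kappa> * (3 * 2 powr (- real (k + n)))"
      proof (rule mult_left_mono)
        have "2 powr (- real (Suc (k + n))) \<le> (2::real) powr (- real (k + n))"
          by (intro powr_mono) auto
        then show "2 powr (- real (k + n)) + 2 powr (- real (Suc (k + n))) \<le> (3::real) * 2 powr (- real (k + n))"
          using powr_ge_zero[of 2 "- real (k + n)"] by linarith
      qed (use \<kappa> in simp)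
      also have "\<dots> \<le> \<kappa>\<^sup>2 * (3 * 2 powr (- real (k + n)))"
        using \<kappa>2 by (intro mult_right_mono) auto
      finally have "norm (f (\<pi> (k + n) x) - f (\<pi> (Suc (k + n)) x)) \<le> B * w (k + n)"
        unfolding w_def using xy \<pi>[OF x] by (intro links) auto
      also have "\<dots> \<le> B * (w k * w n)"
        unfolding w_def using B assms by (intro mult_left_mono level_weight_add_le) auto
      finally show ?thesis
        by (simp add: norm_minus_commute)
    qed
    have partial: "norm (f (\<pi> (k + n) x) - f (\<pi> k x)) \<le> B * (suminf w * w k)" for n
    proof -
      have "f (\<pi> (k + n) x) - f (\<pi> k x) = (\<Sum>i<n. f (\<pi> (k + Suc i) x) - f (\<pi> (k + i) x))"
        using sum_lessThan_telescope[of "\<lambda>i. f (\<pi> (k + i) x)" n] by simp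
      also have "norm \<dots> \<le> (\<Sum>i<n. B * (w k * w i))"
        by (intro sum_norm_le step)
      also have "\<dots> = B * w k * (\<Sum>i<n. w i)"
        by (simp add: sum_distrib_left mult_ac)
      also have "\<dots> \<le> B * w k * suminf w"
        using B w_pos sw by (intro mult_left_mono sum_le_suminf) (auto simp: less_imp_le)
      finally show ?thesis
        by (simp add: mult_ac)
    qed
    have "(\<lambda>n. norm (f (\<pi> (k + n) x) - f (\<pi> k x))) \<longlonglongrightarrow> norm (f x - f (\<pi> k x))"
      by (intro tendsto_intros lim_net)
    then show ?thesis
      by (rule LIMSEQ_le_const2) (use partial in auto)
  qed
  have "\<rho> (\<pi> k x) (\<pi> k y) \<le> \<kappa> * (\<rho> (\<pi> k x) x + \<rho> x (\<pi> k y))"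
    by (rule tri)
  also have "\<dots> \<le> \<kappa> * (2 powr (- real k) + \<kappa> * (2 powr (- real k) + 2 powr (- real k)))"
  proof -
    have "\<rho> x (\<pi> k y) \<le> \<kappa> * (2 powr (- real k) + 2 powr (- real k))"
      using tri[of x "\<pi> k y" y] xy \<pi>[of y k] \<kappa> by (smt (verit) mult_left_mono)
    then show ?thesis
      using \<pi>[of x k] xy \<kappa> by (intro mult_left_mono add_mono) (auto simp: sym)
  qed
  also have "\<dots> = (\<kappa> + 2 * \<kappa>\<^sup>2) * 2 powr (- real k)"
    by (simp add: algebra_simps power2_eq_square)
  also have "\<dots> \<le> 3 * \<kappa>\<^sup>2 * 2 powr (- real k)"
    using \<kappa>2 by (intro mult_right_mono) auto
  finally have "norm (f (\<pi> k x) - f (\<pi> k y)) \<le> B * w k"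
    unfolding w_def using xy \<pi> by (intro links) auto
  then have "norm (f x - f y) \<le> B * w k + B * (suminf w * w k) + B * (suminf w * w k)"
    using to_net[OF xy(1)] to_net[OF xy(2)]
      norm_triangle_ineq[of "f x - f (\<pi> k x)" "f (\<pi> k x) - f y"]
      norm_triangle_ineq[of "f (\<pi> k x) - f (\<pi> k y)" "f (\<pi> k y) - f y"]
      norm_minus_commute[of "f (\<pi> k y)" "f y"] by simp
  also have "\<dots> = B * (1 + 2 * suminf w) * w k"
    by (simp add: algebra_simps)
  finally show ?thesis
    by (simp add: w_def)
qed

text \<open>
  A segment is cut into \<open>m\<close> steps of length at most \<open>h\<close>: local control implies global control.
\<close>

lemma convex_oscillation_le:
  fixes f :: "'e::real_normed_vector \<Rightarrow> 'b::real_normed_vector"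
  assumes "convex K" and B: "\<And>x y. x \<in> K \<Longrightarrow> y \<in> K \<Longrightarrow> norm (x - y) \<le> h \<Longrightarrow> norm (f x - f y) \<le> B"
    and m: "0 < m" and xy: "x \<in> K" "y \<in> K" "norm (x - y) \<le> real m * h"
  shows "norm (f x - f y) \<le> real m * B"
proof -
  define z where "z i = x + (real i / real m) *\<^sub>R (y - x)" for i
  have zK: "z i \<in> K" if "i \<le> m" for i
  proof -
    have "(1 - real i / real m) *\<^sub>R x + (real i / real m) *\<^sub>R y \<in> K"
      using that m by (intro convexD[OF assms(1)] xy) (auto simp: divide_simps)
    then show ?thesis
      by (simp add: z_def algebra_simps)
  qed
  have "f y - f x = (\<Sum>i<m. f (z (Suc i)) - f (z i))"
    using sum_lessThan_telescope[of "\<lambda>i. f (z i)" m] m by (simp add: z_def)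
  also have "norm \<dots> \<le> (\<Sum>i<m. B)"
  proof (rule sum_norm_le)
    fix i assume "i \<in> {..<m}"
    then have i: "i < m" by simp
    have "z (Suc i) - z i = (1 / real m) *\<^sub>R (y - x)"
      by (simp add: z_def scaleR_left_diff_distrib [symmetric] diff_divide_distrib [symmetric])
    then have "norm (z (Suc i) - z i) \<le> h"
      using xy(3) m by (simp add: norm_minus_commute divide_simps mult.commute)
    then show "norm (f (z (Suc i)) - f (z i)) \<le> B"
      using i by (intro B zK) auto
  qed
  finally show ?thesis
    by (simp add: norm_minus_commute)
qed

section \<open>Abel summation\<close>

text \<open>
  The left-hand side is at most the integral of \<open>s t\<^sup>\<delta>\<^sup>-\<^sup>s\<^sup>-\<^sup>1\<close> over \<open>[n, n + 1]\<close>. Written as a difference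
  of values of a decreasing function, the bound telescopes.
\<close>

lemma powr_difference_le:
  assumes "0 \<le> \<delta>" "\<delta> < s" "0 < n"
  shows "(real n powr (- s) - real (Suc n) powr (- s)) * real n powr \<delta>
    \<le> s / (s - \<delta>) * (real n powr (\<delta> - s) - real (Suc n) powr (\<delta> - s))"
proof -
  \<comment> \<open>The claim is that \<open>G\<close> decreases on \<open>[n, n + 1]\<close>: its derivative is \<open>s t\<^sup>-\<^sup>s\<^sup>-\<^sup>1 (n\<^sup>\<delta> - t\<^sup>\<delta>)\<close>.\<close>
  define G where "G t = s / (s - \<delta>) * t powr (\<delta> - s) - real n powr \<delta> * t powr (- s)" for t :: real
  have "G (real (Suc n)) \<le> G (real n)"
  proof (rule DERIV_nonpos_imp_nonincreasing[where f = G])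
    fix t assume t: "real n \<le> t" "t \<le> real (Suc n)"
    then have t0: "0 < t" using assms by simp
    have "(G has_real_derivative
        (s / (s - \<delta>) * ((\<delta> - s) * t powr (\<delta> - s - 1)) - real n powr \<delta> * (- s * t powr (- s - 1)))) (at t)"
      unfolding G_def using t0 assms by (auto intro!: derivative_eq_intros has_real_derivative_powr)
    moreover have "s / (s - \<delta>) * ((\<delta> - s) * t powr (\<delta> - s - 1)) - real n powr \<delta> * (- s * t powr (- s - 1))
        = s * t powr (- s - 1) * (real n powr \<delta> - t powr \<delta>)"
    proof -
      have "t powr (\<delta> - s - 1) = t powr \<delta> * t powr (- s - 1)"
        by (simp add: powr_add [symmetric] algebra_simps)
      moreover have "s / (s - \<delta>) * (\<delta> - s) = - s"
      proof -
        have "s \<noteq> \<delta>" using assms by simp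
        then show ?thesis by (simp add: divide_simps) (simp add: algebra_simps)
      qed
      ultimately show ?thesis
        by (simp only: mult.assoc [symmetric]) (simp add: algebra_simps)
    qed
    moreover have "s * t powr (- s - 1) * (real n powr \<delta> - t powr \<delta>) \<le> 0"
      using assms t by (intro mult_nonneg_nonpos) (auto intro: powr_mono2)
    ultimately show "\<exists>y. (G has_real_derivative y) (at t) \<and> y \<le> 0"
      by force
  qed simp
  moreover have "real n powr \<delta> * real n powr (- s) = real n powr (\<delta> - s)"
    by (simp add: powr_add [symmetric])
  ultimately show ?thesis
    by (simp add: G_def algebra_simps)
qed

text \<open>
  Summation by parts; the weights decrease faster than the partial sums may grow.
\<close>

lemma abel_block_le:
  fixes c :: "nat \<Rightarrow> complex"
  assumes \<delta>: "0 \<le> \<delta>" "\<delta> < s"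
    and bound: "\<And>N. 1 \<le> N \<Longrightarrow> cmod (\<Sum>n=1..N. c n) \<le> B * real N powr \<delta>"
    and NM: "1 \<le> N" "N \<le> M"
  shows "cmod (\<Sum>n=Suc N..M. of_real (real n powr (- s)) * c n)
    \<le> B * (2 + s / (s - \<delta>)) * real N powr (\<delta> - s)"
proof -
  define X where "X m = (\<Sum>n=1..m. c n)" for m
  define a where "a n = real n powr (- s)" for n :: nat
  have B: "0 \<le> B"
    using order_trans[OF norm_ge_zero bound[of 1]] by simp
  have a_dec: "a (Suc n) \<le> a n" if "1 \<le> n" for n
    unfolding a_def using that \<delta> by (intro powr_mono2') auto
  have a_nn: "0 \<le> a n" for n
    by (simp add: a_def)
  have aX: "cmod (of_real (a n) * X n) \<le> B * real n powr (\<delta> - s)" if "1 \<le> n" for n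
  proof -
    have "cmod (of_real (a n) * X n) \<le> a n * (B * real n powr \<delta>)"
      using mult_left_mono[OF bound[OF that] a_nn[of n]] a_nn by (simp add: norm_mult X_def)
    also have "\<dots> = B * real n powr (\<delta> - s)"
      by (simp add: a_def powr_add [symmetric] mult.left_commute)
    finally show ?thesis .
  qed
  have parts: "(\<Sum>n=Suc N..M. of_real (a n) * c n) = of_real (a M) * X M - of_real (a N) * X N
      + (\<Sum>n=N..<M. of_real (a n - a (Suc n)) * X n)"
    using NM(2)
  proof (induction M rule: dec_induct)
    case (step m)
    have "X (Suc m) = X m + c (Suc m)"
      by (simp add: X_def)
    with step show ?case
      by (simp add: algebra_simps)
  qed simp
  have "cmod (\<Sum>n=N..<M. of_real (a n - a (Suc n)) * X n)
      \<le> (\<Sum>n=N..<M. B * (s / (s - \<delta>) * (real n powr (\<delta> - s) - real (Suc n) powr (\<delta> - s))))"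
  proof (rule sum_norm_le)
    fix n assume "n \<in> {N..<M}"
    then have n: "1 \<le> n" using NM by simp
    have "cmod (of_real (a n - a (Suc n)) * X n) = (a n - a (Suc n)) * cmod (X n)"
      unfolding norm_mult norm_of_real using a_dec[OF n] by simp
    also have "\<dots> \<le> (a n - a (Suc n)) * (B * real n powr \<delta>)"
      using a_dec[OF n] bound[OF n] by (intro mult_left_mono) (auto simp: X_def)
    also have "\<dots> = B * ((a n - a (Suc n)) * real n powr \<delta>)"
      by simp
    also have "\<dots> \<le> B * (s / (s - \<delta>) * (real n powr (\<delta> - s) - real (Suc n) powr (\<delta> - s)))"
      unfolding a_def using B n \<delta> by (intro mult_left_mono powr_difference_le) auto
    finally show "cmod (of_real (a n - a (Suc n)) * X n)
        \<le> B * (s / (s - \<delta>) * (real n powr (\<delta> - s) - real (Suc n) powr (\<delta> - s)))" .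
  qed
  also have "\<dots> = B * (s / (s - \<delta>)) * (real N powr (\<delta> - s) - real M powr (\<delta> - s))"
  proof -
    have "(\<Sum>n=N..<M. real n powr (\<delta> - s) - real (Suc n) powr (\<delta> - s)) = real N powr (\<delta> - s) - real M powr (\<delta> - s)"
      using sum_Suc_diff'[OF NM(2), of "\<lambda>n. - (real n powr (\<delta> - s))"] by simp
    then show ?thesis
      by (simp only: sum_distrib_left [symmetric] mult.assoc)
  qed
  also have "\<dots> \<le> B * (s / (s - \<delta>)) * real N powr (\<delta> - s)"
    using B \<delta> by (intro mult_left_mono) auto
  finally have rest: "cmod (\<Sum>n=N..<M. of_real (a n - a (Suc n)) * X n) \<le> B * (s / (s - \<delta>)) * real N powr (\<delta> - s)" .
  have "B * real M powr (\<delta> - s) \<le> B * real N powr (\<delta> - s)"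
    using B \<delta> NM by (intro mult_left_mono powr_mono2') auto
  then have "cmod (\<Sum>n=Suc N..M. of_real (a n) * c n)
      \<le> B * real N powr (\<delta> - s) + B * real N powr (\<delta> - s) + B * (s / (s - \<delta>)) * real N powr (\<delta> - s)"
    unfolding parts using aX[of M] aX[of N] NM rest
      norm_triangle_ineq[of "of_real (a M) * X M - of_real (a N) * X N" "\<Sum>n=N..<M. of_real (a n - a (Suc n)) * X n"]
      norm_triangle_ineq4[of "of_real (a M) * X M" "of_real (a N) * X N"]
    by linarith
  then show ?thesis
    by (simp add: a_def algebra_simps)
qed

lemma abel_summation:
  fixes c :: "nat \<Rightarrow> complex"
  assumes \<delta>: "0 \<le> \<delta>" "\<delta> < s"
    and bound: "\<And>N. 1 \<le> N \<Longrightarrow> cmod (\<Sum>n=1..N. c n) \<le> B * real N powr \<delta>"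
  defines "h \<equiv> \<lambda>n. of_real (real n powr (- s)) * c n"
  shows "summable (\<lambda>n. h (Suc n))"
    and "\<And>N. 1 \<le> N \<Longrightarrow> cmod ((\<Sum>n. h (Suc n)) - (\<Sum>n=1..N. h n)) \<le> B * (2 + s / (s - \<delta>)) * real N powr (\<delta> - s)"
    and "cmod (\<Sum>n. h (Suc n)) \<le> B * (3 + s / (s - \<delta>))"
proof -
  define C where "C = B * (2 + s / (s - \<delta>))"
  have block: "cmod (\<Sum>n=Suc N..M. h n) \<le> C * real N powr (\<delta> - s)" if "1 \<le> N" "N \<le> M" for N M
    unfolding C_def h_def by (rule abel_block_le[OF \<delta> bound that])
  have lim: "(\<lambda>N. C * real N powr (\<delta> - s)) \<longlonglongrightarrow> 0"
    using \<delta> by real_asymp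
  have shift: "(\<Sum>n=m..<n. h (Suc n)) = (\<Sum>n=Suc m..n. h n)" for m n
    by (metis atLeastLessThanSuc_atLeastAtMost sum.shift_bounds_Suc_ivl)
  show sm: "summable (\<lambda>n. h (Suc n))"
    unfolding summable_Cauchy
  proof (intro allI impI)
    fix e :: real assume "0 < e"
    with lim have "eventually (\<lambda>N. C * real N powr (\<delta> - s) < e) sequentially"
      by (rule order_tendstoD)
    then obtain N0 where N0: "\<And>N. N0 \<le> N \<Longrightarrow> C * real N powr (\<delta> - s) < e"
      by (auto simp: eventually_sequentially)
    show "\<exists>N. \<forall>m\<ge>N. \<forall>n. cmod (\<Sum>n=m..<n. h (Suc n)) < e"
    proof (intro exI[of _ "max N0 1"] allI impI)
      fix m n assume m: "max N0 1 \<le> m"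
      show "cmod (\<Sum>n=m..<n. h (Suc n)) < e"
      proof (cases "m \<le> n")
        case True
        then show ?thesis
          unfolding shift using block[of m n] N0[of m] m by simp
      qed (use \<open>0 < e\<close> in simp)
    qed
  qed
  show tail: "cmod ((\<Sum>n. h (Suc n)) - (\<Sum>n=1..N. h n)) \<le> B * (2 + s / (s - \<delta>)) * real N powr (\<delta> - s)"
    if N: "1 \<le> N" for N
  proof -
    have "(\<lambda>M. \<Sum>n<M. h (Suc n)) \<longlonglongrightarrow> (\<Sum>n. h (Suc n))"
      using sm by (rule summable_LIMSEQ)
    then have "(\<lambda>M. (\<Sum>n=1..M. h n) - (\<Sum>n=1..N. h n)) \<longlonglongrightarrow> (\<Sum>n. h (Suc n)) - (\<Sum>n=1..N. h n)"
      using shift[of 0] by (intro tendsto_intros) (simp add: atLeast0LessThan)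
    then have "(\<lambda>M. cmod ((\<Sum>n=1..M. h n) - (\<Sum>n=1..N. h n))) \<longlonglongrightarrow> cmod ((\<Sum>n. h (Suc n)) - (\<Sum>n=1..N. h n))"
      by (rule tendsto_norm)
    then show ?thesis
    proof (rule LIMSEQ_le_const2, intro exI allI impI)
      fix M assume M: "N \<le> M"
      then have "(\<Sum>n=1..M. h n) = (\<Sum>n=1..N. h n) + (\<Sum>n=Suc N..M. h n)"
        using N sum.ub_add_nat[of 1 N h "M - N"] by simp
      then show "cmod ((\<Sum>n=1..M. h n) - (\<Sum>n=1..N. h n)) \<le> B * (2 + s / (s - \<delta>)) * real N powr (\<delta> - s)"
        using block[OF N M] by (simp add: C_def)
    qed
  qed
  have "cmod (h 1) \<le> B"
    using bound[of 1] by (simp add: h_def)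
  then show "cmod (\<Sum>n. h (Suc n)) \<le> B * (3 + s / (s - \<delta>))"
    using tail[of 1] norm_triangle_ineq[of "(\<Sum>n. h (Suc n)) - h 1" "h 1"]
    by (simp add: algebra_simps)
qed

section \<open>Local bounds from the assumptions on the quasi-metric and the fields\<close>

text \<open>
  Since \<open>\<rho>\<close> is dominated by a power of the distance, Euclidean grids with mesh exponentially small in
  \<open>l\<close> are \<open>2\<^sup>-\<^sup>l\<close>-nets for \<open>\<rho>\<close>; their cardinality is exponential in \<open>l\<close>.
\<close>

lemma dyadic_nets:
  fixes lo hi :: "'e::euclidean_space"
  assumes x\<^sub>0: "x\<^sub>0 \<in> cbox lo hi" and H: "0 < H" "0 < c"
    and \<rho>: "\<And>x y. norm (x - y) \<le> 1 \<Longrightarrow> \<rho> x y \<le> c * norm (x - y) powr H"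
  obtains D B where "1 \<le> B" "\<And>l. finite (D l)" "\<And>l. D l \<subseteq> cbox lo hi"
    "\<And>l. real (card (D l)) \<le> B ^ Suc l"
    "\<And>l x. x \<in> cbox lo hi \<Longrightarrow> \<exists>y\<in>D l. \<rho> x y \<le> 2 powr (- real l)"
proof -
  define R where "R = (\<Sum>i\<in>Basis. (hi - lo) \<bullet> i)"
  have R: "0 \<le> R"
    unfolding R_def using x\<^sub>0 by (intro sum_nonneg) (auto simp: mem_box inner_diff_left intro: order_trans)
  \<comment> \<open>Level \<open>l\<close> uses \<open>m\<^sub>0\<close> to the power \<open>l + 1\<close> grid cells per side: the first factor brings \<open>\<rho>\<close> below 1, each further one halves it.\<close>
  obtain m\<^sub>0 :: nat where m\<^sub>0: "max (max 1 R) (max (R * c powr (1 / H)) (2 powr (1 / H))) \<le> real m\<^sub>0"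
    using real_arch_simple by blast
  then have m\<^sub>0': "1 \<le> m\<^sub>0" "R \<le> real m\<^sub>0" "R * c powr (1 / H) \<le> real m\<^sub>0" "2 powr (1 / H) \<le> real m\<^sub>0"
    by auto
  have "\<exists>D. finite D \<and> D \<subseteq> cbox lo hi \<and> card D \<le> (m\<^sub>0 ^ Suc l + 1) ^ DIM('e) \<and>
      (\<forall>x\<in>cbox lo hi. \<exists>y\<in>D. norm (x - y) \<le> R / real (m\<^sub>0 ^ Suc l))" for l
    unfolding R_def using box_net[OF x\<^sub>0, of "m\<^sub>0 ^ Suc l"] m\<^sub>0'(1) by (metis one_le_power)
  then obtain D where D: "\<And>l. finite (D l)" "\<And>l. D l \<subseteq> cbox lo hi"
      "\<And>l. card (D l) \<le> (m\<^sub>0 ^ Suc l + 1) ^ DIM('e)"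
      "\<And>l x. x \<in> cbox lo hi \<Longrightarrow> \<exists>y\<in>D l. norm (x - y) \<le> R / real (m\<^sub>0 ^ Suc l)"
    by metis
  show thesis
  proof
    show "1 \<le> (2 * real m\<^sub>0) ^ DIM('e)"
      using m\<^sub>0'(1) by (intro one_le_power) simp
    show "finite (D l)" "D l \<subseteq> cbox lo hi" for l
      by (rule D)+
    show "real (card (D l)) \<le> ((2 * real m\<^sub>0) ^ DIM('e)) ^ Suc l" for l
    proof -
      have "real (card (D l)) \<le> real ((m\<^sub>0 ^ Suc l + 1) ^ DIM('e))"
        using D(3) by (simp only: of_nat_le_iff)
      also have "\<dots> = (real m\<^sub>0 ^ Suc l + 1) ^ DIM('e)"
        by (simp add: add.commute)
      also have "\<dots> \<le> ((2 * real m\<^sub>0) ^ Suc l) ^ DIM('e)"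
      proof (rule power_mono)
        have "1 \<le> real m\<^sub>0 ^ Suc l"
          using m\<^sub>0'(1) by (intro one_le_power) simp
        moreover have "2 * real m\<^sub>0 ^ Suc l \<le> 2 ^ Suc l * real m\<^sub>0 ^ Suc l"
          by (intro mult_right_mono) auto
        ultimately show "real m\<^sub>0 ^ Suc l + 1 \<le> (2 * real m\<^sub>0) ^ Suc l"
          by (simp only: power_mult_distrib)
      qed simp
      also have "\<dots> = ((2 * real m\<^sub>0) ^ DIM('e)) ^ Suc l"
        by (simp only: power_mult [symmetric] mult.commute)
      finally show ?thesis .
    qed
    fix l x assume "x \<in> cbox lo hi"
    then obtain y where y: "y \<in> D l" "norm (x - y) \<le> R / real (m\<^sub>0 ^ Suc l)"
      using D(4) by blast
    have "R / real (m\<^sub>0 ^ Suc l) \<le> 1"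
    proof -
      have "real m\<^sub>0 * 1 \<le> real m\<^sub>0 * real m\<^sub>0 ^ l"
        using m\<^sub>0'(1) by (intro mult_left_mono one_le_power) auto
      then have "R \<le> real (m\<^sub>0 ^ Suc l)"
        using m\<^sub>0'(2) by simp
      then show ?thesis
        using m\<^sub>0'(1) by (simp add: divide_simps)
    qed
    then have "\<rho> x y \<le> c * norm (x - y) powr H"
      using y by (intro \<rho>) simp
    also have "\<dots> \<le> c * (R / real (m\<^sub>0 ^ Suc l)) powr H"
      using y H by (intro mult_left_mono powr_mono2) auto
    also have "\<dots> = c * (R / real m\<^sub>0) powr H / (real m\<^sub>0 powr H) ^ l"
    proof -
      have "(real m\<^sub>0 powr H) ^ l = (real m\<^sub>0 ^ l) powr H"
        using m\<^sub>0'(1) by (simp add: powr_realpow [symmetric] powr_powr mult.commute)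
      moreover have "R / real (m\<^sub>0 ^ Suc l) = (R / real m\<^sub>0) / real m\<^sub>0 ^ l"
        by simp
      ultimately show ?thesis
        using R by (simp only: powr_divide) simp
    qed
    also have "\<dots> \<le> 1 / 2 ^ l"
    proof (rule frac_le)
      have "R / real m\<^sub>0 \<le> c powr (- (1 / H))"
        using m\<^sub>0' H by (simp add: powr_minus divide_simps)
      then have "(R / real m\<^sub>0) powr H \<le> (c powr (- (1 / H))) powr H"
        using R H by (intro powr_mono2) auto
      also have "\<dots> = 1 / c"
        using H by (simp only: powr_powr) (simp add: powr_minus divide_inverse)
      finally show "c * (R / real m\<^sub>0) powr H \<le> 1"
        using H by (simp add: field_simps)
      have "(2 powr (1 / H)) powr H \<le> real m\<^sub>0 powr H"
        using m\<^sub>0' H by (intro powr_mono2) auto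
      then have "2 \<le> real m\<^sub>0 powr H"
        using H by (simp add: powr_powr)
      then show "2 ^ l \<le> (real m\<^sub>0 powr H) ^ l"
        by (intro power_mono) auto
    qed (use H in auto)
    also have "1 / 2 ^ l = 2 powr (- real l)"
      by (simp add: powr_minus powr_realpow divide_inverse)
    finally show "\<exists>y\<in>D l. \<rho> x y \<le> 2 powr (- real l)"
      using y by blast
  qed
qed

text \<open>
  The comparison of \<open>\<rho>\<close> with the distance is only assumed for points at distance at most 1. That
  points with small \<open>\<rho>\<close> are close at all follows from compactness: \<open>\<rho>\<close> attains a positive minimum
  on the pairs at distance at least \<open>e\<close>.
\<close>

lemma small_quasi_metric_imp_close:
  fixes \<rho> :: "'e::metric_space \<Rightarrow> 'e \<Rightarrow> real"
  assumes K: "compact K" and cont: "continuous_on UNIV (\<lambda>(x, y). \<rho> x y)"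
    and pos: "\<And>x y. x \<noteq> y \<Longrightarrow> 0 < \<rho> x y" and e: "0 < e"
  obtains l :: nat where "\<And>x y. x \<in> K \<Longrightarrow> y \<in> K \<Longrightarrow> \<rho> x y \<le> 2 powr (- real l) \<Longrightarrow> dist x y < e"
proof -
  define F where "F = (K \<times> K) \<inter> {p. e \<le> dist (fst p) (snd p)}"
  have "compact F"
    unfolding F_def by (intro compact_Int_closed compact_Times K closed_Collect_le continuous_intros)
  show thesis
  proof (cases "F = {}")
    case True
    show ?thesis
    proof (rule that[of 0])
      fix x y assume "x \<in> K" "y \<in> K"
      then have "(x, y) \<notin> F"
        using True by simp
      with \<open>x \<in> K\<close> \<open>y \<in> K\<close> show "dist x y < e"
        by (auto simp: F_def)
    qed
  next
    case False
    obtain p where p: "p \<in> F" "\<And>q. q \<in> F \<Longrightarrow> (\<lambda>(x, y). \<rho> x y) p \<le> (\<lambda>(x, y). \<rho> x y) q"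
      using continuous_attains_inf[OF \<open>compact F\<close> False continuous_on_subset[OF cont]] by blast
    then have "0 < \<rho> (fst p) (snd p)"
      using e by (intro pos) (auto simp: F_def)
    then obtain l where l: "(1 / 2 :: real) ^ l < \<rho> (fst p) (snd p)"
      using real_arch_pow_inv[of "\<rho> (fst p) (snd p)" "1 / 2"] by auto
    show ?thesis
    proof (rule that[of l])
      fix x y assume xy: "x \<in> K" "y \<in> K" "\<rho> x y \<le> 2 powr (- real l)"
      show "dist x y < e"
      proof (rule ccontr)
        assume "\<not> dist x y < e"
        then have "\<rho> (fst p) (snd p) \<le> \<rho> x y"
          using p(2)[of "(x, y)"] xy by (auto simp: F_def split: prod.splits)
        moreover have "2 powr (- real l) = (1 / 2 :: real) ^ l"
          by (simp add: powr_minus powr_realpow power_one_over inverse_eq_divide)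
        ultimately show False
          using xy l by simp
      qed
    qed
  qed
qed

text \<open>
  At scale \<open>t = 2\<^sup>-\<^sup>k\<close> with \<open>k \<ge> 1\<close>, \<open>|log t|\<close> is comparable to \<open>k\<close> and bounded away from 0, so the
  quotient defining the supremum is one of real numbers and a negative power of the logarithm
  is bounded.
\<close>

lemma modulus_sup_increment:
  fixes \<rho> :: "'e::real_normed_vector \<Rightarrow> 'e \<Rightarrow> real"
  assumes \<beta>: "0 < \<beta>"
  obtains C where "0 \<le> C"
    "\<And>f x y l. 1 \<le> l \<Longrightarrow> x \<in> K \<Longrightarrow> y \<in> K \<Longrightarrow> 0 < norm (x - y) \<Longrightarrow> norm (x - y) \<le> r \<Longrightarrow>
      0 < \<rho> x y \<Longrightarrow> \<rho> x y \<le> 2 powr (- real l) \<Longrightarrow> modulus_sup \<rho> K r \<beta> \<eta> f < \<top> \<Longrightarrow>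
      cmod (f x - f y) \<le> C * enn2real (modulus_sup \<rho> K r \<beta> \<eta> f) * level_weight \<beta> (max \<eta> 0) l"
proof
  define w where "w = level_weight \<beta> (max \<eta> 0)"
  \<comment> \<open>For negative \<open>\<eta>\<close> the power of the logarithm is largest where \<open>|ln t| = ln 2\<close>.\<close>
  define C\<^sub>0 where "C\<^sub>0 = max 1 ((ln 2) powr \<eta>)"
  have w_nn: "0 \<le> w l" for l
    by (simp add: w_def level_weight_pos less_imp_le)
  have sw: "0 \<le> suminf w"
    unfolding w_def using \<beta> by (intro suminf_nonneg summable_level_weight) (auto intro: less_imp_le level_weight_pos)
  show "0 \<le> C\<^sub>0 * suminf w"
    using sw by (simp add: C\<^sub>0_def)
  fix f x y and l :: nat
  assume l: "1 \<le> l" and xy: "x \<in> K" "y \<in> K" "0 < norm (x - y)" "norm (x - y) \<le> r"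
    and \<rho>: "0 < \<rho> x y" "\<rho> x y \<le> 2 powr (- real l)" and fin: "modulus_sup \<rho> K r \<beta> \<eta> f < \<top>"
  define t where "t = \<rho> x y"
  define A where "A = enn2real (modulus_sup \<rho> K r \<beta> \<eta> f)"
  have A: "modulus_sup \<rho> K r \<beta> \<eta> f = ennreal A" "0 \<le> A"
    using fin by (auto simp: A_def less_top)
  obtain k where k: "l \<le> k" "2 powr (- real k - 1) < t" "t \<le> 2 powr (- real k)"
    using dyadic_level[OF \<rho>] by (auto simp: t_def)
  have t0: "0 < t" using \<rho> by (simp add: t_def)
  have k1: "1 \<le> k" using k l by simp
  have ln_t: "ln t \<le> - (real k * ln 2)" "- ((real k + 1) * ln 2) < ln t"
  proof -
    have "ln t \<le> ln (2 powr (- real k))"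
      using k t0 by (subst ln_le_cancel_iff) auto
    then show "ln t \<le> - (real k * ln 2)"
      by (simp add: ln_powr)
    have "ln (2 powr (- real k - 1)) < ln t"
      using k t0 by (subst ln_less_cancel_iff) auto
    then show "- ((real k + 1) * ln 2) < ln t"
      by (simp add: ln_powr algebra_simps)
  qed
  have ln2: "0 < ln (2::real)" "ln (2::real) < 1"
    using ln_2_less_1 by auto
  have kln: "ln 2 \<le> real k * ln 2" "(real k + 1) * ln 2 \<le> real k + 1"
    using k1 ln2 by auto
  then have abs_ln: "ln 2 \<le> \<bar>ln t\<bar>" "\<bar>ln t\<bar> \<le> real k + 1"
    using ln_t ln2 by linarith+
  have abs_ln_pos: "0 < \<bar>ln t\<bar>"
    using abs_ln ln2 by linarith
  have log_le: "\<bar>ln t\<bar> powr \<eta> \<le> C\<^sub>0 * (real k + 1) powr max \<eta> 0"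
  proof (cases "0 \<le> \<eta>")
    case True
    then have "\<bar>ln t\<bar> powr \<eta> \<le> 1 * (real k + 1) powr max \<eta> 0"
      using abs_ln by (auto intro: powr_mono2)
    also have "\<dots> \<le> C\<^sub>0 * (real k + 1) powr max \<eta> 0"
      by (intro mult_right_mono) (auto simp: C\<^sub>0_def)
    finally show ?thesis .
  next
    case False
    then have "\<bar>ln t\<bar> powr \<eta> \<le> (ln 2) powr \<eta>"
      using abs_ln ln2 by (intro powr_mono2') auto
    with False show ?thesis
      by (simp add: C\<^sub>0_def max_def)
  qed
  have "ennreal (cmod (f x - f y)) / (ennreal (t powr \<beta>) * epowr (ennreal \<bar>ln t\<bar>) \<eta>) \<le> modulus_sup \<rho> K r \<beta> \<eta> f"
    unfolding modulus_sup_def t_def using xy by (intro SUP_upper2[of "(x, y)"]) auto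
  also have "epowr (ennreal \<bar>ln t\<bar>) \<eta> = ennreal (\<bar>ln t\<bar> powr \<eta>)"
    using abs_ln_pos by (auto simp: epowr_def ennreal_eq_0_iff)
  finally have "ennreal (cmod (f x - f y) / (t powr \<beta> * \<bar>ln t\<bar> powr \<eta>)) \<le> ennreal A"
    using t0 abs_ln_pos by (simp add: A divide_ennreal ennreal_mult [symmetric])
  then have "cmod (f x - f y) / (t powr \<beta> * \<bar>ln t\<bar> powr \<eta>) \<le> A"
    using A by (simp add: ennreal_le_iff)
  then have "cmod (f x - f y) \<le> A * (t powr \<beta> * \<bar>ln t\<bar> powr \<eta>)"
    using t0 abs_ln_pos by (simp add: divide_le_eq)
  also have "\<dots> \<le> A * ((2 powr (- real k)) powr \<beta> * (C\<^sub>0 * (real k + 1) powr max \<eta> 0))"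
    using A k t0 \<beta> log_le by (intro mult_left_mono mult_mono powr_mono2) auto
  also have "\<dots> = A * (C\<^sub>0 * w k)"
    by (simp add: w_def level_weight_def powr_powr)
  also have "\<dots> \<le> A * (C\<^sub>0 * (w l * suminf w))"
  proof -
    have "w k = w (l + (k - l))"
      using k by simp
    also have "\<dots> \<le> w l * w (k - l)"
      unfolding w_def by (rule level_weight_add_le) simp
    also have "\<dots> \<le> w l * suminf w"
      using w_nn \<beta> unfolding w_def by (intro mult_left_mono level_weight_le_suminf) auto
    finally show ?thesis
      using A by (intro mult_left_mono) (auto simp: C\<^sub>0_def)
  qed
  finally show "cmod (f x - f y) \<le> C\<^sub>0 * suminf w * enn2real (modulus_sup \<rho> K r \<beta> \<eta> f) * level_weight \<beta> (max \<eta> 0) l"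
    by (simp add: A_def w_def mult_ac)
qed

text \<open>
  The derivative of \<open>t powr (- 1 / \<alpha>)\<close> with respect to \<open>\<alpha>\<close> contains the factor \<open>ln t\<close>, which is paid
  for by an arbitrarily small power of \<open>t\<close>. As \<open>t\<close> is only bounded from below, the logarithm is
  estimated by \<open>t powr \<epsilon> + t powr (- \<epsilon>)\<close>.
\<close>

lemma negative_power_bounds:
  fixes a b c \<epsilon> :: real
  assumes a: "0 < a" "0 < b" and c: "0 < c" "c \<le> 1" and \<epsilon>: "0 < \<epsilon>" "\<epsilon> < 1 / b"
  obtains C where "0 \<le> C"
    "\<And>n t \<alpha>. 1 \<le> n \<Longrightarrow> c * real n \<le> t \<Longrightarrow> \<alpha> \<in> {a..b} \<Longrightarrow> t powr (- 1 / \<alpha>) \<le> C * real n powr (\<epsilon> - 1 / b)"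
    "\<And>n t \<alpha> \<alpha>'. 1 \<le> n \<Longrightarrow> c * real n \<le> t \<Longrightarrow> \<alpha> \<in> {a..b} \<Longrightarrow> \<alpha>' \<in> {a..b} \<Longrightarrow>
      \<bar>t powr (- 1 / \<alpha>) - t powr (- 1 / \<alpha>')\<bar> \<le> C * real n powr (\<epsilon> - 1 / b) * \<bar>\<alpha> - \<alpha>'\<bar>"
proof -
  define C\<^sub>0 where "C\<^sub>0 = c powr (- (1 / a + \<epsilon>))"
  have base: "t powr (- e) \<le> C\<^sub>0 * real n powr (\<epsilon> - 1 / b)"
    if "1 \<le> n" "c * real n \<le> t" "1 / b - \<epsilon> \<le> e" "e \<le> 1 / a + \<epsilon>" for n t e
  proof -
    have "t powr (- e) \<le> (c * real n) powr (- e)"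
      using that \<epsilon> c by (intro powr_mono2') auto
    also have "\<dots> = c powr (- e) * real n powr (- e)"
      using c by (simp add: powr_mult)
    also have "\<dots> \<le> C\<^sub>0 * real n powr (\<epsilon> - 1 / b)"
      unfolding C\<^sub>0_def using that c by (intro mult_mono powr_mono' powr_mono) auto
    finally show ?thesis .
  qed
  have inv: "1 / b \<le> 1 / \<alpha>" "1 / \<alpha> \<le> 1 / a" if "\<alpha> \<in> {a..b}" for \<alpha>
    using that a by (auto simp: frac_le)
  have ln_le: "ln x \<le> x powr \<epsilon> / \<epsilon>" if "0 < x" for x
    using ln_le_minus_one[of "x powr \<epsilon>"] that \<epsilon> by (simp add: ln_powr field_simps)
  define C\<^sub>1 where "C\<^sub>1 = 2 * C\<^sub>0 / (\<epsilon> * a\<^sup>2)"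
  have C\<^sub>0: "0 < C\<^sub>0" using c by (simp add: C\<^sub>0_def)
  have C\<^sub>1: "0 \<le> C\<^sub>1" using C\<^sub>0 a \<epsilon> by (simp add: C\<^sub>1_def)
  show thesis
  proof (rule that[of "C\<^sub>0 + C\<^sub>1"])
    show "0 \<le> C\<^sub>0 + C\<^sub>1" using C\<^sub>0 C\<^sub>1 by simp
    show "t powr (- 1 / \<alpha>) \<le> (C\<^sub>0 + C\<^sub>1) * real n powr (\<epsilon> - 1 / b)"
      if "1 \<le> n" "c * real n \<le> t" "\<alpha> \<in> {a..b}" for n t \<alpha>
    proof -
      have "t powr (- (1 / \<alpha>)) \<le> C\<^sub>0 * real n powr (\<epsilon> - 1 / b)"
        using inv[OF that(3)] \<epsilon> by (intro base that) auto
      also have "\<dots> \<le> (C\<^sub>0 + C\<^sub>1) * real n powr (\<epsilon> - 1 / b)"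
        using C\<^sub>1 by (intro mult_right_mono) auto
      finally show ?thesis by simp
    qed
    show "\<bar>t powr (- 1 / \<alpha>) - t powr (- 1 / \<alpha>')\<bar> \<le> (C\<^sub>0 + C\<^sub>1) * real n powr (\<epsilon> - 1 / b) * \<bar>\<alpha> - \<alpha>'\<bar>"
      if n: "1 \<le> n" "c * real n \<le> t" and \<alpha>: "\<alpha> \<in> {a..b}" "\<alpha>' \<in> {a..b}" for n t \<alpha> \<alpha>'
    proof -
      have t0: "0 < t"
        using n c by (smt (verit) mult_pos_pos of_nat_0_less_iff less_le_trans zero_less_one)
      have "norm (t powr (- 1 / \<alpha>) - t powr (- 1 / \<alpha>')) \<le> C\<^sub>1 * real n powr (\<epsilon> - 1 / b) * norm (\<alpha> - \<alpha>')"
      proof (rule field_differentiable_bound[where S = "{a..b}" and f' = "\<lambda>z. t powr (- 1 / z) * (ln t / z\<^sup>2)"])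
        fix z assume z: "z \<in> {a..b}"
        show "((\<lambda>z. t powr (- 1 / z)) has_field_derivative t powr (- 1 / z) * (ln t / z\<^sup>2)) (at z within {a..b})"
        proof -
          have "((\<lambda>z. exp (- 1 / z * ln t)) has_field_derivative exp (- 1 / z * ln t) * (ln t / z\<^sup>2)) (at z within {a..b})"
            using z a by (auto intro!: derivative_eq_intros simp: power2_eq_square)
          then show ?thesis
            using t0 by (simp add: powr_def)
        qed
        have ln_abs: "\<bar>ln t\<bar> \<le> (t powr \<epsilon> + t powr (- \<epsilon>)) / \<epsilon>"
        proof -
          have "- ln t \<le> t powr (- \<epsilon>) / \<epsilon>"
            using ln_le[of "1 / t"] t0 by (simp add: ln_div powr_minus powr_divide) (simp add: divide_simps)
          moreover have "0 \<le> t powr \<epsilon> / \<epsilon>" "0 \<le> t powr (- \<epsilon>) / \<epsilon>"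
            using \<epsilon> by auto
          ultimately show ?thesis
            using ln_le[OF t0] by (simp add: add_divide_distrib abs_le_iff)
        qed
        have "norm (t powr (- 1 / z) * (ln t / z\<^sup>2)) = t powr (- (1 / z)) * \<bar>ln t\<bar> / z\<^sup>2"
          by (simp add: abs_mult)
        also have "\<dots> \<le> t powr (- (1 / z)) * ((t powr \<epsilon> + t powr (- \<epsilon>)) / \<epsilon>) / a\<^sup>2"
          using z a \<epsilon> ln_abs by (intro frac_le mult_left_mono power_mono mult_nonneg_nonneg) auto
        also have "\<dots> = (t powr (- (1 / z - \<epsilon>)) + t powr (- (1 / z + \<epsilon>))) / (\<epsilon> * a\<^sup>2)"
          by (simp add: distrib_left powr_add [symmetric] add_divide_distrib algebra_simps)
        also have "\<dots> \<le> (C\<^sub>0 * real n powr (\<epsilon> - 1 / b) + C\<^sub>0 * real n powr (\<epsilon> - 1 / b)) / (\<epsilon> * a\<^sup>2)"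
          using inv[OF z] \<epsilon> a n by (intro divide_right_mono add_mono base) auto
        also have "\<dots> = C\<^sub>1 * real n powr (\<epsilon> - 1 / b)"
          by (simp add: C\<^sub>1_def)
        finally show "norm (t powr (- 1 / z) * (ln t / z\<^sup>2)) \<le> C\<^sub>1 * real n powr (\<epsilon> - 1 / b)" .
      qed (use \<alpha> in auto)
      also have "\<dots> \<le> (C\<^sub>0 + C\<^sub>1) * real n powr (\<epsilon> - 1 / b) * norm (\<alpha> - \<alpha>')"
        using C\<^sub>0 by (intro mult_right_mono) auto
      finally show ?thesis by simp
    qed
  qed
qed

section \<open>Regularity of damped series\<close>

text \<open>
  Chaining applied to every partial sum. The hypothesis \<open>cont\<close>, whose constants \<open>A n\<close> are arbitrary,
  serves only to make each partial sum the limit of its values on the nets; the quantitative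
  information is in \<open>links\<close> and \<open>start\<close>.
\<close>

lemma partial_sums_modulus:
  fixes c :: "nat \<Rightarrow> 'e::real_normed_vector \<Rightarrow> complex"
  assumes K: "convex K" "bounded K" "x\<^sub>0 \<in> K"
    and sym: "\<And>x y. \<rho> x y = \<rho> y x"
    and \<kappa>: "1 \<le> \<kappa>" and tri: "\<And>x y z. \<rho> x z \<le> \<kappa> * (\<rho> x y + \<rho> y z)"
    and h: "0 < h" "\<And>x y. x \<in> K \<Longrightarrow> y \<in> K \<Longrightarrow> norm (x - y) \<le> h \<Longrightarrow> \<rho> x y \<le> 2 powr (- real l\<^sub>0)"
    and D: "\<And>l. D l \<subseteq> K" "\<And>l x. x \<in> K \<Longrightarrow> \<exists>y\<in>D l. \<rho> x y \<le> 2 powr (- real l)"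
    and w: "0 < \<beta>" "0 \<le> \<mu>" and B: "0 \<le> B" "0 \<le> B\<^sub>0"
    and cont: "\<And>n x y l. 1 \<le> n \<Longrightarrow> x \<in> K \<Longrightarrow> y \<in> K \<Longrightarrow> l\<^sub>0 \<le> l \<Longrightarrow> \<rho> x y \<le> 2 powr (- real l) \<Longrightarrow>
        cmod (c n x - c n y) \<le> A n * level_weight \<beta> \<mu> l"
    and links: "\<And>N l u v. 1 \<le> N \<Longrightarrow> l\<^sub>0 \<le> l \<Longrightarrow> u \<in> D l \<Longrightarrow> v \<in> D l \<union> D (Suc l) \<Longrightarrow>
        \<rho> u v \<le> 3 * \<kappa>\<^sup>2 * 2 powr (- real l) \<Longrightarrow>
        cmod (\<Sum>n=1..N. c n u - c n v) \<le> B * real N powr \<delta> * level_weight \<beta> \<mu> l"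
    and start: "\<And>N. 1 \<le> N \<Longrightarrow> cmod (\<Sum>n=1..N. c n x\<^sub>0) \<le> B\<^sub>0 * real N powr \<delta>"
  obtains C where "0 \<le> C"
    "\<And>N x. 1 \<le> N \<Longrightarrow> x \<in> K \<Longrightarrow> cmod (\<Sum>n=1..N. c n x) \<le> C * real N powr \<delta>"
    "\<And>N x y k. 1 \<le> N \<Longrightarrow> x \<in> K \<Longrightarrow> y \<in> K \<Longrightarrow> l\<^sub>0 \<le> k \<Longrightarrow> \<rho> x y \<le> 2 powr (- real k) \<Longrightarrow>
       cmod (\<Sum>n=1..N. c n x - c n y) \<le> C * level_weight \<beta> \<mu> k * real N powr \<delta>"
proof -
  define w where "w = level_weight \<beta> \<mu>"
  define S where "S = 1 + 2 * suminf w"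
  have w_nn: "0 \<le> w l" for l
    by (simp add: w_def level_weight_pos less_imp_le)
  have S: "0 \<le> S"
    unfolding S_def w_def using w by (intro add_nonneg_nonneg mult_nonneg_nonneg suminf_nonneg summable_level_weight)
      (auto intro: less_imp_le level_weight_pos)
  have modulus: "cmod (\<Sum>n=1..N. c n x - c n y) \<le> B * S * w k * real N powr \<delta>"
    if N: "1 \<le> N" and xy: "x \<in> K" "y \<in> K" and k: "l\<^sub>0 \<le> k" "\<rho> x y \<le> 2 powr (- real k)" for N x y k
  proof -
    have "cmod ((\<Sum>n=1..N. c n x) - (\<Sum>n=1..N. c n y)) \<le> B * real N powr \<delta> * (1 + 2 * suminf (level_weight \<beta> \<mu>)) * level_weight \<beta> \<mu> k"
    proof (rule chaining_modulus[where \<rho> = \<rho> and K = K and D = D and l\<^sub>0 = l\<^sub>0 and \<kappa> = \<kappa>])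
      fix x y assume x: "x \<in> K" and y: "\<And>l. y l \<in> K \<and> \<rho> x (y l) \<le> 2 powr (- real l)"
      show "(\<lambda>l. \<Sum>n=1..N. c n (y l)) \<longlonglongrightarrow> (\<Sum>n=1..N. c n x)"
      proof (rule tendsto_sum)
        fix n assume "n \<in> {1..N}"
        then have n: "1 \<le> n" by simp
        have "(\<lambda>l. c n (y l) - c n x) \<longlonglongrightarrow> 0"
        proof (rule Lim_null_comparison)
          show "\<forall>\<^sub>F l in sequentially. cmod (c n (y l) - c n x) \<le> A n * level_weight \<beta> \<mu> l"
            using eventually_ge_at_top[of l\<^sub>0]
          proof eventually_elim
            case (elim l)
            then show ?case
              using cont[OF n x, of "y l" l] y[of l] by (simp add: norm_minus_commute)
          qed
          show "(\<lambda>l. A n * level_weight \<beta> \<mu> l) \<longlonglongrightarrow> 0"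
            using w by (intro tendsto_mult_right_zero level_weight_tendsto_0)
        qed
        then show "(\<lambda>l. c n (y l)) \<longlonglongrightarrow> c n x"
          by (simp add: LIM_zero_iff)
      qed
    next
      fix l u v assume "l\<^sub>0 \<le> l" "u \<in> D l" "v \<in> D l \<union> D (Suc l)" "\<rho> u v \<le> 3 * \<kappa>\<^sup>2 * 2 powr (- real l)"
      then show "cmod ((\<Sum>n=1..N. c n u) - (\<Sum>n=1..N. c n v)) \<le> B * real N powr \<delta> * level_weight \<beta> \<mu> l"
        using links[OF N] by (simp add: sum_subtractf)
    qed (rule sym | rule tri | (use \<kappa> D w B xy k in auto))+
    then show ?thesis
      by (simp add: sum_subtractf S_def w_def mult_ac)
  qed
  obtain R where R: "\<And>x. x \<in> K \<Longrightarrow> norm x \<le> R"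
    using K by (auto simp: bounded_iff)
  obtain m :: nat where "2 * R / h < real m"
    using reals_Archimedean2 by blast
  then have m: "2 * R \<le> real (Suc m) * h"
    using h by (simp add: field_simps)
  define C\<^sub>1 where "C\<^sub>1 = B\<^sub>0 + real (Suc m) * (B * S * w l\<^sub>0)"
  have C\<^sub>1: "0 \<le> C\<^sub>1"
    unfolding C\<^sub>1_def using B S w_nn by simp
  have bound: "cmod (\<Sum>n=1..N. c n x) \<le> C\<^sub>1 * real N powr \<delta>" if N: "1 \<le> N" and x: "x \<in> K" for N x
  proof -
    have "cmod ((\<Sum>n=1..N. c n x) - (\<Sum>n=1..N. c n x\<^sub>0)) \<le> real (Suc m) * (B * S * w l\<^sub>0 * real N powr \<delta>)"
    proof (rule convex_oscillation_le[OF K(1), where h = h])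
      fix x y assume "x \<in> K" "y \<in> K" "norm (x - y) \<le> h"
      then show "cmod ((\<Sum>n=1..N. c n x) - (\<Sum>n=1..N. c n y)) \<le> B * S * w l\<^sub>0 * real N powr \<delta>"
        using modulus[OF N _ _ order_refl h(2)] by (simp add: sum_subtractf)
    qed (use x K norm_triangle_ineq4[of x x\<^sub>0] R[OF x] R[OF K(3)] m in auto)
    then show ?thesis
      using start[OF N] norm_triangle_ineq[of "(\<Sum>n=1..N. c n x) - (\<Sum>n=1..N. c n x\<^sub>0)" "\<Sum>n=1..N. c n x\<^sub>0"]
      by (simp add: C\<^sub>1_def algebra_simps)
  qed
  show thesis
  proof (rule that[of "B * S + C\<^sub>1"])
    show "0 \<le> B * S + C\<^sub>1" using B S C\<^sub>1 by simp
    show "cmod (\<Sum>n=1..N. c n x) \<le> (B * S + C\<^sub>1) * real N powr \<delta>" if "1 \<le> N" "x \<in> K" for N x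
      using bound[OF that] B S by (simp add: distrib_right add_increasing)
    show "cmod (\<Sum>n=1..N. c n x - c n y) \<le> (B * S + C\<^sub>1) * level_weight \<beta> \<mu> k * real N powr \<delta>"
      if "1 \<le> N" "x \<in> K" "y \<in> K" "l\<^sub>0 \<le> k" "\<rho> x y \<le> 2 powr (- real k)" for N x y k
    proof -
      have "B * S * w k * real N powr \<delta> \<le> (B * S + C\<^sub>1) * w k * real N powr \<delta>"
        using C\<^sub>1 w_nn by (intro mult_right_mono) auto
      then show ?thesis
        using modulus[OF that] by (simp add: w_def)
    qed
  qed
qed

text \<open>
  Below the scale \<open>l\<^sub>0\<close> the level weight is comparable to the modulus of the class; above it, the
  modulus is bounded from below because \<open>\<rho>\<close> is bounded on the compact set, and it suffices that \<open>f\<close>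
  is bounded.
\<close>

lemma holder_classI_local:
  fixes f :: "'e::metric_space \<Rightarrow> complex"
  assumes K: "compact K" and cont: "continuous_on UNIV (\<lambda>(x, y). \<rho> x y)"
    and pos: "\<And>x y. x \<noteq> y \<Longrightarrow> 0 < \<rho> x y"
    and \<beta>: "0 < \<beta>" "0 \<le> \<mu>" and l\<^sub>0: "1 \<le> l\<^sub>0" and C: "0 \<le> C"
    and local: "\<And>x y k. x \<in> K \<Longrightarrow> y \<in> K \<Longrightarrow> l\<^sub>0 \<le> k \<Longrightarrow> \<rho> x y \<le> 2 powr (- real k) \<Longrightarrow>
      cmod (f x - f y) \<le> C * level_weight \<beta> \<mu> k"
    and bound: "\<And>x. x \<in> K \<Longrightarrow> cmod (f x) \<le> C"
  shows "f \<in> holder_class \<rho> K \<beta> \<mu>"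
proof -
  have bdd: "bounded ((\<lambda>(x, y). \<rho> x y) ` (K \<times> K))"
    by (intro compact_imp_bounded compact_continuous_image compact_Times K continuous_on_subset[OF cont]) auto
  obtain R where R: "\<And>x y. x \<in> K \<Longrightarrow> y \<in> K \<Longrightarrow> \<rho> x y \<le> R"
  proof -
    obtain R where R: "\<forall>t\<in>(\<lambda>(x, y). \<rho> x y) ` (K \<times> K). norm t \<le> R"
      using bdd by (auto simp: bounded_iff)
    show ?thesis
    proof (rule that[of R])
      fix x y assume "x \<in> K" "y \<in> K"
      then have "norm (\<rho> x y) \<le> R"
        using R by (intro bspec[OF R, of "\<rho> x y"]) force
      then show "\<rho> x y \<le> R" by simp
    qed
  qed
  define R' where "R' = max R 1"
  have R': "0 < R'" "\<And>x y. x \<in> K \<Longrightarrow> y \<in> K \<Longrightarrow> \<rho> x y \<le> R'"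
    using R by (auto simp: R'_def le_max_iff_disj)
  define far where "far = (2 powr (- real l\<^sub>0)) powr \<beta> * ln (1 + inverse R') powr \<mu>"
  have far: "0 < far"
  proof -
    have "0 < ln (1 + inverse R')"
      using R' by (intro ln_gt_zero) simp
    then show ?thesis by (simp add: far_def)
  qed
  define near where "near = 2 powr \<beta> * (2 / ln 2) powr \<mu>"
  have near: "0 < near" by (simp add: near_def)
  define C' where "C' = C * near + 2 * C / far + 1"
  have "0 < C'"
    unfolding C'_def using C far near by (intro add_nonneg_pos add_nonneg_nonneg) auto
  moreover have "cmod (f x - f y) \<le> C' * \<rho> x y powr \<beta> * ln (1 + inverse (\<rho> x y)) powr \<mu>"
    if x: "x \<in> K" and y: "y \<in> K" for x y
  proof (cases "x = y")
    case False
    define t where "t = \<rho> x y"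
    define g where "g = t powr \<beta> * ln (1 + inverse t) powr \<mu>"
    have t0: "0 < t" using pos[OF False] by (simp add: t_def)
    have g: "0 \<le> g" by (simp add: g_def)
    have "cmod (f x - f y) \<le> C' * g"
    proof (cases "t \<le> 2 powr (- real l\<^sub>0)")
      case True
      obtain k where k: "l\<^sub>0 \<le> k" "2 powr (- real k - 1) < t" "t \<le> 2 powr (- real k)"
        using dyadic_level[OF t0 True] by blast
      have k1: "1 \<le> k" using k l\<^sub>0 by simp
      have "(2 powr (- real k)) powr \<beta> \<le> (2 * t) powr \<beta>"
        using k \<beta> by (intro powr_mono2) (auto simp: powr_diff)
      then have 1: "(2 powr (- real k)) powr \<beta> \<le> 2 powr \<beta> * t powr \<beta>"
        using t0 by (simp add: powr_mult)
      have "real k * ln 2 = ln (2 powr real k)"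
        by (simp add: ln_powr)
      also have "\<dots> \<le> ln (1 + inverse t)"
      proof (subst ln_le_cancel_iff)
        have "t * 2 powr real k \<le> 2 powr (- real k) * 2 powr real k"
          using k by (intro mult_right_mono) auto
        then have "t * 2 powr real k \<le> 1"
          by (simp add: powr_add [symmetric])
        then show "2 powr real k \<le> 1 + inverse t"
          using t0 by (simp add: field_simps)
      qed (use t0 in \<open>auto intro: add_pos_pos\<close>)
      finally have kln: "real k * ln 2 \<le> ln (1 + inverse t)" .
      have "real k + 1 \<le> 2 / ln 2 * (real k * ln 2)"
        using k1 by simp
      also have "\<dots> \<le> 2 / ln 2 * ln (1 + inverse t)"
        using kln by (intro mult_left_mono) auto
      finally have "(real k + 1) powr \<mu> \<le> (2 / ln 2 * ln (1 + inverse t)) powr \<mu>"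
        using \<beta> by (intro powr_mono2) auto
      then have 2: "(real k + 1) powr \<mu> \<le> (2 / ln 2) powr \<mu> * ln (1 + inverse t) powr \<mu>"
        by (simp only: powr_mult)
      have "cmod (f x - f y) \<le> C * level_weight \<beta> \<mu> k"
        using k by (intro local x y) (auto simp: t_def)
      also have "level_weight \<beta> \<mu> k = (2 powr (- real k)) powr \<beta> * (real k + 1) powr \<mu>"
        by (simp add: level_weight_def powr_powr)
      also have "C * \<dots> \<le> C * ((2 powr \<beta> * t powr \<beta>) * ((2 / ln 2) powr \<mu> * ln (1 + inverse t) powr \<mu>))"
        using C 1 2 by (intro mult_left_mono mult_mono) auto
      also have "\<dots> = C * near * g"
        by (simp add: near_def g_def mult_ac)
      also have "\<dots> \<le> C' * g"
        using C far g by (intro mult_right_mono) (auto simp: C'_def)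
      finally show ?thesis .
    next
      case False
      have "far \<le> g"
        unfolding far_def g_def
      proof (rule mult_mono)
        show "(2 powr (- real l\<^sub>0)) powr \<beta> \<le> t powr \<beta>"
          using False \<beta> by (intro powr_mono2) auto
        have "inverse R' \<le> inverse t"
          using R'(2)[OF x y] t0 by (intro le_imp_inverse_le) (auto simp: t_def)
        moreover have "0 < inverse R'" using R' by simp
        ultimately have "ln (1 + inverse R') \<le> ln (1 + inverse t)" "0 \<le> ln (1 + inverse R')"
          by (intro ln_mono ln_ge_zero; linarith)+
        then show "ln (1 + inverse R') powr \<mu> \<le> ln (1 + inverse t) powr \<mu>"
          using \<beta> by (intro powr_mono2) auto
      qed auto
      have "cmod (f x - f y) \<le> 2 * C"
        using bound[OF x] bound[OF y] norm_triangle_ineq4[of "f x" "f y"] by linarith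
      also have "\<dots> = 2 * C / far * far"
        using far by simp
      also have "\<dots> \<le> 2 * C / far * g"
        using \<open>far \<le> g\<close> C far by (intro mult_left_mono) auto
      also have "\<dots> \<le> C' * g"
        using C near g by (intro mult_right_mono) (auto simp: C'_def)
      finally show ?thesis .
    qed
    then show ?thesis
      by (simp add: g_def t_def mult.assoc)
  qed (use \<open>0 < C'\<close> in simp)
  ultimately show ?thesis
    unfolding holder_class_def by blast
qed

text \<open>
  All three claims are Abel summation, applied to the terms at one point or to their differences
  at two points.
\<close>

lemma damped_series_regularity:
  fixes c :: "nat \<Rightarrow> 'e::metric_space \<Rightarrow> complex"
  assumes K: "compact K" and cont: "continuous_on UNIV (\<lambda>(x, y). \<rho> x y)"
    and pos: "\<And>x y. x \<noteq> y \<Longrightarrow> 0 < \<rho> x y"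
    and \<beta>: "0 < \<beta>" "0 \<le> \<mu>" and l\<^sub>0: "1 \<le> l\<^sub>0" and \<delta>: "0 \<le> \<delta>" "\<delta> < s" and C: "0 \<le> C"
    and bound: "\<And>N x. 1 \<le> N \<Longrightarrow> x \<in> K \<Longrightarrow> cmod (\<Sum>n=1..N. c n x) \<le> C * real N powr \<delta>"
    and modulus: "\<And>N x y k. 1 \<le> N \<Longrightarrow> x \<in> K \<Longrightarrow> y \<in> K \<Longrightarrow> l\<^sub>0 \<le> k \<Longrightarrow> \<rho> x y \<le> 2 powr (- real k) \<Longrightarrow>
       cmod (\<Sum>n=1..N. c n x - c n y) \<le> C * level_weight \<beta> \<mu> k * real N powr \<delta>"
  defines "h \<equiv> \<lambda>n x. of_real (real n powr (- s)) * c n x"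
  shows "uniform_limit K (\<lambda>N x. \<Sum>n=1..N. h n x) (\<lambda>x. \<Sum>n. h (Suc n) x) sequentially"
    and "(\<lambda>x. \<Sum>n. h (Suc n) x) \<in> holder_class \<rho> K \<beta> \<mu>"
    and "\<exists>B\<ge>0. \<forall>N\<ge>1. \<forall>x\<in>K. cmod ((\<Sum>n. h (Suc n) x) - (\<Sum>n=1..N. h n x)) \<le> B * real N powr (\<delta> - s)"
proof -
  define L where "L = 3 + s / (s - \<delta>)"
  have L: "3 \<le> L" using \<delta> by (simp add: L_def)
  have sm: "summable (\<lambda>n. h (Suc n) x)" if "x \<in> K" for x
    unfolding h_def by (rule abel_summation(1)[OF \<delta> bound[OF _ that]])
  have tail: "cmod ((\<Sum>n. h (Suc n) x) - (\<Sum>n=1..N. h n x)) \<le> C * L * real N powr (\<delta> - s)"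
    if "1 \<le> N" "x \<in> K" for N x
  proof -
    have "cmod ((\<Sum>n. h (Suc n) x) - (\<Sum>n=1..N. h n x)) \<le> C * (2 + s / (s - \<delta>)) * real N powr (\<delta> - s)"
      unfolding h_def by (rule abel_summation(2)[OF \<delta> bound[OF _ that(2)] that(1)])
    also have "\<dots> \<le> C * L * real N powr (\<delta> - s)"
      using C by (intro mult_right_mono mult_left_mono) (auto simp: L_def)
    finally show ?thesis .
  qed
  then show "\<exists>B\<ge>0. \<forall>N\<ge>1. \<forall>x\<in>K. cmod ((\<Sum>n. h (Suc n) x) - (\<Sum>n=1..N. h n x)) \<le> B * real N powr (\<delta> - s)"
    using C L by (intro exI[of _ "C * L"]) auto
  show "uniform_limit K (\<lambda>N x. \<Sum>n=1..N. h n x) (\<lambda>x. \<Sum>n. h (Suc n) x) sequentially"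
  proof (rule uniform_limitI)
    fix e :: real assume e: "0 < e"
    have "(\<lambda>N. C * L * real N powr (\<delta> - s)) \<longlonglongrightarrow> 0"
      using \<delta> by real_asymp
    from order_tendstoD(2)[OF this e] eventually_ge_at_top[of 1]
    show "\<forall>\<^sub>F N in sequentially. \<forall>x\<in>K. dist (\<Sum>n=1..N. h n x) (\<Sum>n. h (Suc n) x) < e"
      by eventually_elim (use tail in \<open>force simp: dist_norm norm_minus_commute\<close>)
  qed
  show "(\<lambda>x. \<Sum>n. h (Suc n) x) \<in> holder_class \<rho> K \<beta> \<mu>"
  proof (rule holder_classI_local[OF K cont pos \<beta> l\<^sub>0])
    show "0 \<le> C * L" using C L by simp
    show "cmod (\<Sum>n. h (Suc n) x) \<le> C * L" if "x \<in> K" for x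
      unfolding h_def L_def by (rule abel_summation(3)[OF \<delta> bound[OF _ that]])
    show "cmod ((\<Sum>n. h (Suc n) x) - (\<Sum>n. h (Suc n) y)) \<le> C * L * level_weight \<beta> \<mu> k"
      if "x \<in> K" "y \<in> K" "l\<^sub>0 \<le> k" "\<rho> x y \<le> 2 powr (- real k)" for x y k
    proof -
      have "(\<Sum>n. h (Suc n) x) - (\<Sum>n. h (Suc n) y) = (\<Sum>n. of_real (real (Suc n) powr (- s)) * (c (Suc n) x - c (Suc n) y))"
        by (subst suminf_diff[OF sm[OF that(1)] sm[OF that(2)]]) (simp add: h_def right_diff_distrib)
      also have "cmod \<dots> \<le> C * level_weight \<beta> \<mu> k * L"
        unfolding L_def by (rule abel_summation(3)[OF \<delta> modulus[OF _ that]])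
      finally show ?thesis
        by (simp add: mult_ac)
    qed
  qed
qed

section \<open>Arrival times and moments of the fields\<close>

lemma AE_summable_of_nn_integral_le:
  fixes f :: "nat \<Rightarrow> 'a \<Rightarrow> real"
  assumes [measurable]: "\<And>k. f k \<in> borel_measurable M" and nn: "\<And>k x. 0 \<le> f k x"
    and le: "\<And>k. (\<integral>\<^sup>+x. ennreal (f k x) \<partial>M) \<le> ennreal (q k)"
    and q: "\<And>k. 0 \<le> q k" "summable q"
  shows "AE x in M. summable (\<lambda>k. f k x)"
proof -
  have "(\<integral>\<^sup>+x. (\<Sum>k. ennreal (f k x)) \<partial>M) = (\<Sum>k. \<integral>\<^sup>+x. ennreal (f k x) \<partial>M)"
    by (rule nn_integral_suminf) measurable
  also have "\<dots> \<le> (\<Sum>k. ennreal (q k))"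
    by (intro suminf_le le) auto
  also have "\<dots> = ennreal (suminf q)"
    using q by (intro suminf_ennreal2) auto
  finally have "(\<integral>\<^sup>+x. (\<Sum>k. ennreal (f k x)) \<partial>M) \<noteq> \<infinity>"
    by (auto simp: top_unique)
  then have "AE x in M. (\<Sum>k. ennreal (f k x)) \<noteq> \<infinity>"
    by (intro nn_integral_PInf_AE) measurable
  then show ?thesis
    by eventually_elim (intro summable_suminf_not_top nn, simp)
qed

lemma AE_bounded_of_nn_integral_le:
  fixes f :: "nat \<Rightarrow> nat \<Rightarrow> 'a \<Rightarrow> real"
  assumes [measurable]: "\<And>j k. f j k \<in> borel_measurable M"
    and le: "\<And>j k. (\<integral>\<^sup>+x. ennreal (f j k x) \<partial>M) \<le> ennreal (p j * q k)"
    and p: "\<And>k. 0 \<le> p k" "summable p" and q: "\<And>k. 0 \<le> q k" "summable q"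
  shows "AE x in M. \<exists>C. \<forall>j k. f j k x \<le> C"
proof -
  have "(\<integral>\<^sup>+x. (\<Sum>j. \<Sum>k. ennreal (f j k x)) \<partial>M) = (\<Sum>j. \<Sum>k. \<integral>\<^sup>+x. ennreal (f j k x) \<partial>M)"
    by (simp add: nn_integral_suminf)
  also have "\<dots> \<le> (\<Sum>j. \<Sum>k. ennreal (p j * q k))"
    by (intro suminf_le le) auto
  also have "\<dots> = (\<Sum>j. ennreal (p j * suminf q))"
  proof (rule suminf_cong)
    fix j
    have "(\<Sum>k. ennreal (p j * q k)) = ennreal (\<Sum>k. p j * q k)"
      using p q by (intro suminf_ennreal2) (auto intro: summable_mult)
    then show "(\<Sum>k. ennreal (p j * q k)) = ennreal (p j * suminf q)"
      using q by (simp add: suminf_mult)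
  qed
  also have "\<dots> = ennreal (\<Sum>j. p j * suminf q)"
    using p q by (intro suminf_ennreal2) (auto intro!: summable_mult2 suminf_nonneg mult_nonneg_nonneg)
  finally have "(\<integral>\<^sup>+x. (\<Sum>j. \<Sum>k. ennreal (f j k x)) \<partial>M) \<noteq> \<infinity>"
    by (auto simp: top_unique)
  then have "AE x in M. (\<Sum>j. \<Sum>k. ennreal (f j k x)) \<noteq> \<infinity>"
    by (intro nn_integral_PInf_AE) measurable
  then show ?thesis
  proof eventually_elim
    case (elim x)
    then obtain C where C: "(\<Sum>j. \<Sum>k. ennreal (f j k x)) = ennreal C" "0 \<le> C"
      by (cases "\<Sum>j. \<Sum>k. ennreal (f j k x)" rule: ennreal_cases) auto
    have "f j k x \<le> C" for j k
    proof -
      have "ennreal (f j k x) \<le> (\<Sum>k. ennreal (f j k x))"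
        using sum_le_suminf[of "\<lambda>k. ennreal (f j k x)" "{k}"] by simp
      also have "\<dots> \<le> (\<Sum>j. \<Sum>k. ennreal (f j k x))"
        using sum_le_suminf[of "\<lambda>j. \<Sum>k. ennreal (f j k x)" "{j}"] by simp
      finally show ?thesis
        using C by (simp add: ennreal_le_iff)
    qed
    then show ?case by blast
  qed
qed

lemma poisson_pgf:
  assumes "0 < l" "0 \<le> c"
  shows "(\<integral>\<^sup>+n. ennreal (c ^ n) \<partial>measure_pmf (poisson_pmf l)) = ennreal (exp (l * (c - 1)))"
proof -
  have "(\<integral>\<^sup>+n. ennreal (c ^ n) \<partial>measure_pmf (poisson_pmf l))
      = (\<Sum>n. ennreal (pmf (poisson_pmf l) n) * ennreal (c ^ n))"
    by (simp add: nn_integral_measure_pmf nn_integral_count_space_nat)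
  also have "\<dots> = (\<Sum>n. ennreal (exp (- l) * ((l * c) ^ n /\<^sub>R fact n)))"
    using assms by (intro suminf_cong)
      (simp add: ennreal_mult [symmetric] power_mult_distrib divide_inverse mult_ac)
  also have "\<dots> = ennreal (exp (- l) * exp (l * c))"
    using assms by (intro suminf_ennreal_eq sums_mult exp_converges) auto
  also have "exp (- l) * exp (l * c) = exp (l * (c - 1))"
    by (simp add: exp_add [symmetric] algebra_simps)
  finally show ?thesis .
qed

text \<open>
  With \<open>N\<^sub>k\<close> Poisson distributed with mean \<open>k\<close>, the expectations of \<open>8\<^sup>-\<^sup>k 2\<close> to the power \<open>N\<^sub>k\<close> and of
  \<open>1/2\<close> to the power \<open>N\<^sub>k\<close> are \<open>(e/8)\<^sup>k\<close> and \<open>exp (- k/2)\<close>. Both are summable, so almost surely both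
  variables tend to 0.
\<close>

lemma (in prob_space) poisson_process_growth:
  assumes N: "poisson_process M 1 N"
  shows "AE \<omega> in M. (\<forall>\<^sub>F k in sequentially. N (real k) \<omega> < 3 * k) \<and> (\<forall>n. \<exists>k. n \<le> N (real k) \<omega>)"
proof -
  have meas [measurable]: "N (real k) \<in> measurable M (count_space UNIV)" for k :: nat
    using N by (simp add: poisson_process_def)
  have pgf: "(\<integral>\<^sup>+\<omega>. ennreal (c ^ N (real k) \<omega>) \<partial>M) \<le> ennreal (exp (real k * (c - 1)))" if "0 \<le> c" for c k
  proof (cases "k = 0")
    case True
    have "(\<integral>\<^sup>+\<omega>. ennreal (c ^ N (real k) \<omega>) \<partial>M) = (\<integral>\<^sup>+\<omega>. 1 \<partial>M)"
      using N True by (intro nn_integral_cong) (simp add: poisson_process_def)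
    then show ?thesis
      using True by (simp add: emeasure_space_1)
  next
    case False
    have "distr M (count_space UNIV) (N (real k)) = distr M (count_space UNIV) (\<lambda>\<omega>. N (real k) \<omega> - N 0 \<omega>)"
      using N by (intro distr_cong) (auto simp: poisson_process_def)
    also have "\<dots> = measure_pmf (poisson_pmf (real k))"
      using N False by (auto simp: poisson_process_def)
    finally have "(\<integral>\<^sup>+n. ennreal (c ^ n) \<partial>distr M (count_space UNIV) (N (real k))) = ennreal (exp (real k * (c - 1)))"
      using that False by (simp add: poisson_pgf)
    then show ?thesis
      by (simp add: nn_integral_distr)
  qed
  have "AE \<omega> in M. summable (\<lambda>k. (1 / 8) ^ k * 2 ^ N (real k) \<omega> :: real)"
  proof (rule AE_summable_of_nn_integral_le)
    show "(\<integral>\<^sup>+\<omega>. ennreal ((1 / 8) ^ k * 2 ^ N (real k) \<omega>) \<partial>M) \<le> ennreal ((exp 1 / 8) ^ k)" for k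
    proof -
      have "(\<integral>\<^sup>+\<omega>. ennreal ((1 / 8) ^ k * 2 ^ N (real k) \<omega>) \<partial>M)
          = ennreal ((1 / 8) ^ k) * (\<integral>\<^sup>+\<omega>. ennreal (2 ^ N (real k) \<omega>) \<partial>M)"
        by (subst nn_integral_cmult [symmetric]) (auto simp: ennreal_mult)
      also have "\<dots> \<le> ennreal ((1 / 8) ^ k) * ennreal (exp (real k * (2 - 1)))"
        by (intro mult_left_mono pgf) auto
      also have "\<dots> = ennreal ((exp 1 / 8) ^ k)"
        by (simp add: ennreal_mult [symmetric] power_divide exp_of_nat_mult [symmetric] power_one_over)
      finally show ?thesis .
    qed
    show "summable (\<lambda>k. (exp 1 / 8 :: real) ^ k)"
      using exp_le by (intro summable_geometric) simp
  qed auto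
  moreover have "AE \<omega> in M. summable (\<lambda>k. (1 / 2) ^ N (real k) \<omega> :: real)"
  proof (rule AE_summable_of_nn_integral_le)
    show "(\<integral>\<^sup>+\<omega>. ennreal ((1 / 2) ^ N (real k) \<omega>) \<partial>M) \<le> ennreal (exp (- 1 / 2) ^ k)" for k
      using pgf[of "1 / 2" k] by (simp add: exp_of_nat_mult [symmetric])
    show "summable (\<lambda>k. exp (- 1 / 2 :: real) ^ k)"
      by (intro summable_geometric) simp
  qed auto
  ultimately show ?thesis
  proof eventually_elim
    case (elim \<omega>)
    have "\<forall>\<^sub>F k in sequentially. (1 / 8) ^ k * 2 ^ N (real k) \<omega> < (1 :: real)"
      using summable_LIMSEQ_zero[OF elim(1)] by (rule order_tendstoD) simp
    then have "\<forall>\<^sub>F k in sequentially. N (real k) \<omega> < 3 * k"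
    proof eventually_elim
      case (elim k)
      then have "(2 :: real) ^ N (real k) \<omega> < 8 ^ k"
        by (simp add: power_one_over divide_simps)
      also have "(8 :: real) ^ k = 2 ^ (3 * k)"
        by (simp add: power_mult)
      finally show ?case
        by simp
    qed
    moreover have "\<exists>k. n \<le> N (real k) \<omega>" for n
    proof -
      have "\<forall>\<^sub>F k in sequentially. (1 / 2) ^ N (real k) \<omega> < (1 / 2 :: real) ^ n"
        using summable_LIMSEQ_zero[OF elim(2)] by (rule order_tendstoD) simp
      then obtain k where "(1 / 2) ^ N (real k) \<omega> < (1 / 2 :: real) ^ n"
        by (auto simp: eventually_sequentially)
      then have "n < N (real k) \<omega>"
        by (subst (asm) power_strict_decreasing_iff) auto
      then show ?thesis
        by (intro exI[of _ k]) simp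
    qed
    ultimately show ?case by blast
  qed
qed

text \<open>
  For large \<open>n\<close>, \<open>n \<le> N\<^sub>t\<close> implies \<open>n < 3 (t + 1)\<close>. The remaining finitely many arrival times are bounded
  from below by a positive number because the counting process vanishes near 0. That \<open>N\<close> is unbounded is used as well: the
  infimum of the empty set of times would be an arbitrary real number.
\<close>

lemma (in prob_space) poisson_arrival_times_lower_bound:
  assumes "poisson_arrival_times M 1 T"
  shows "AE \<omega> in M. \<exists>c>0. c \<le> 1 \<and> (\<forall>n\<ge>1. c * real n \<le> T n \<omega>)"
proof -
  obtain N where N: "poisson_process M 1 N" and T: "\<And>n. 1 \<le> n \<Longrightarrow> AE \<omega> in M. T n \<omega> = Inf {t. 0 \<le> t \<and> n \<le> N t \<omega>}"
    using assms by (auto simp: poisson_arrival_times_def)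
  have "AE \<omega> in M. \<forall>n\<in>{1..}. T n \<omega> = Inf {t. 0 \<le> t \<and> n \<le> N t \<omega>}"
    using T by (intro AE_ball_countable') auto
  then show ?thesis
    using poisson_process_growth[OF N] AE_space
  proof eventually_elim
    case (elim \<omega>)
    have mono: "N s \<omega> \<le> N t \<omega>" if "0 \<le> s" "s \<le> t" for s t
      using N elim(3) that by (auto simp: poisson_process_def mono_on_def)
    have N0: "N 0 \<omega> = 0"
      using N elim(3) by (auto simp: poisson_process_def)
    have "\<forall>\<^sub>F s in at_right 0. N s \<omega> = N 0 \<omega>"
      using N elim(3) unfolding poisson_process_def by blast
    then obtain e where e: "0 < e" "\<And>s. 0 < s \<Longrightarrow> s < e \<Longrightarrow> N s \<omega> = 0"
      using N0 by (auto simp: eventually_at_right_field)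
    obtain k\<^sub>0 where k\<^sub>0: "\<And>k. k\<^sub>0 \<le> k \<Longrightarrow> N (real k) \<omega> < 3 * k"
      using elim(2) by (auto simp: eventually_sequentially)
    \<comment> \<open>For \<open>n > 3 k\<^sub>0\<close> only times beyond \<open>k\<^sub>0\<close> have \<open>n\<close> arrivals; for \<open>n \<ge> 6\<close>, \<open>n / 3 - 1 \<ge> n / 6\<close>.\<close>
    define m where "m = 3 * k\<^sub>0 + 6"
    define c where "c = min (min 1 (1 / 6)) (e / real m)"
    have c: "0 < c" "c \<le> 1" "c \<le> 1 / 6" "c * real m \<le> e"
      using e by (auto simp: c_def m_def min_def divide_simps)
    have "c * real n \<le> t" if n: "1 \<le> n" and t: "0 \<le> t" "n \<le> N t \<omega>" for n t
    proof (cases "n \<le> m")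
      case True
      have "e \<le> t"
      proof (rule ccontr)
        assume "\<not> e \<le> t"
        then have "N t \<omega> = 0"
          using t N0 e(2)[of t] by (cases "t = 0") auto
        with n t show False by simp
      qed
      moreover have "c * real n \<le> c * real m"
        using True c by (intro mult_left_mono) auto
      ultimately show ?thesis
        using c by linarith
    next
      case False
      define k where "k = max k\<^sub>0 (nat \<lceil>t\<rceil>)"
      have "t \<le> real k"
        unfolding k_def by linarith
      then have "n < 3 * k"
        using mono[of t "real k"] k\<^sub>0[of k] t by (simp add: k_def)
      then have "n < 3 * nat \<lceil>t\<rceil>"
        using False by (simp add: k_def m_def max_def split: if_splits)
      then have "real n < 3 * real (nat \<lceil>t\<rceil>)"
        by linarith
      moreover have "real (nat \<lceil>t\<rceil>) \<le> t + 1"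
        using t by linarith
      moreover have "6 \<le> real n"
        using False by (simp add: m_def)
      ultimately have "real n / 6 \<le> t"
        by linarith
      moreover have "c * real n \<le> 1 / 6 * real n"
        using c by (intro mult_right_mono) auto
      ultimately show ?thesis
        by simp
    qed
    then have *: "c * real n \<le> t" if "1 \<le> n" "t \<in> {t. 0 \<le> t \<and> n \<le> N t \<omega>}" for n t
      using that by simp
    have nonempty: "{t. 0 \<le> t \<and> n \<le> N t \<omega>} \<noteq> {}" for n
    proof -
      obtain k where "n \<le> N (real k) \<omega>"
        using elim(2) by blast
      then have "real k \<in> {t. 0 \<le> t \<and> n \<le> N t \<omega>}"
        by simp
      then show ?thesis by blast
    qed
    have "c * real n \<le> T n \<omega>" if "1 \<le> n" for n
    proof -
      have "T n \<omega> = Inf {t. 0 \<le> t \<and> n \<le> N t \<omega>}"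
        using elim(1) that by simp
      then show ?thesis
        using cInf_greatest[OF nonempty *[OF that]] by simp
    qed
    then show ?case
      using c by (intro exI[of _ c]) auto
  qed
qed

text \<open>
  The \<open>q\<close>-th powers of \<open>n powr (- \<gamma> / 2) * W n\<close> have a summable expectation; since \<open>q \<le> 2\<close>, summability
  of the \<open>q\<close>-th powers implies that of the squares.
\<close>

lemma AE_summable_weighted_squares:
  fixes W :: "nat \<Rightarrow> 'a \<Rightarrow> real"
  assumes [measurable]: "\<And>n. 1 \<le> n \<Longrightarrow> W n \<in> borel_measurable M"
    and W: "\<And>n x. 1 \<le> n \<Longrightarrow> 0 \<le> W n x"
    and q: "0 < q" "q \<le> 2" "1 < \<gamma> * q / 2"
    and moment: "\<And>n. 1 \<le> n \<Longrightarrow> (\<integral>\<^sup>+x. ennreal (W n x powr q) \<partial>M) \<le> ennreal C"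
  shows "AE x in M. summable (\<lambda>n. real (Suc n) powr (- \<gamma>) * (W (Suc n) x)\<^sup>2)"
proof -
  define h where "h n x = real (Suc n) powr (- \<gamma> / 2) * W (Suc n) x" for n x
  have h_nn: "0 \<le> h n x" for n x
    by (simp add: h_def W)
  have [measurable]: "W (Suc n) \<in> borel_measurable M" for n
    by simp
  have h_meas [measurable]: "h n \<in> borel_measurable M" for n
    unfolding h_def by measurable
  have "AE x in M. summable (\<lambda>n. h n x powr q)"
  proof (rule AE_summable_of_nn_integral_le)
    show "(\<integral>\<^sup>+x. ennreal (h n x powr q) \<partial>M) \<le> ennreal (real (Suc n) powr (- (\<gamma> * q / 2)) * max C 0)" for n
    proof -
      have "h n x powr q = real (Suc n) powr (- (\<gamma> * q / 2)) * W (Suc n) x powr q" for x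
        unfolding h_def by (subst powr_mult) (auto simp: W powr_powr)
      then have "(\<integral>\<^sup>+x. ennreal (h n x powr q) \<partial>M)
          = ennreal (real (Suc n) powr (- (\<gamma> * q / 2))) * (\<integral>\<^sup>+x. ennreal (W (Suc n) x powr q) \<partial>M)"
        by (subst nn_integral_cmult [symmetric]) (auto simp: ennreal_mult)
      also have "\<dots> \<le> ennreal (real (Suc n) powr (- (\<gamma> * q / 2))) * ennreal (max C 0)"
        by (intro mult_left_mono order_trans[OF moment]) (auto intro: ennreal_leI)
      finally show ?thesis
        by (simp add: ennreal_mult)
    qed
    have "summable (\<lambda>n. real n powr (- (\<gamma> * q / 2)))"
      using q by (simp add: summable_real_powr_iff)
    then show "summable (\<lambda>n. real (Suc n) powr (- (\<gamma> * q / 2)) * max C 0)"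
      using summable_Suc_iff[of "\<lambda>n. real n powr (- (\<gamma> * q / 2))"] by (intro summable_mult2) blast
  qed auto
  then show ?thesis
  proof eventually_elim
    case (elim x)
    have "\<forall>\<^sub>F n in sequentially. h n x powr q < 1"
      using summable_LIMSEQ_zero[OF elim] by (rule order_tendstoD) simp
    then have ev: "\<forall>\<^sub>F n in sequentially. norm ((h n x)\<^sup>2) \<le> h n x powr q"
    proof eventually_elim
      case (elim n)
      have "h n x \<le> 1"
        using elim q ge_one_powr_ge_zero[of "h n x" q] by (cases "h n x \<le> 1") auto
      then have "h n x powr 2 \<le> h n x powr q"
        using h_nn q by (intro powr_mono') auto
      then show ?case
        using h_nn[of n x] by simp
    qed
    have "summable (\<lambda>n. (h n x)\<^sup>2)"
      by (rule summable_comparison_test_ev[OF ev elim])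
    moreover have "(h n x)\<^sup>2 = real (Suc n) powr (- \<gamma>) * (W (Suc n) x)\<^sup>2" for n
      by (simp add: h_def power_mult_distrib powr_half_sqrt power2_eq_square powr_add [symmetric])
    ultimately show ?case
      by simp
  qed
qed

section \<open>Sub-Gaussian sums with independent random coefficients\<close>

text \<open>
  Fubini's theorem for independent sub-sigma-algebras: the identity map into the first and the
  identity map into the second are independent random elements. This is the form in which one
  conditions on the arrival times and the fields.
\<close>

lemma (in prob_space) nn_integral_indep_diagonal:
  assumes sp: "space A = space M" "space B = space M"
    and indep: "indep_set (sets A) (sets B)"
    and h: "h \<in> borel_measurable (A \<Otimes>\<^sub>M B)"
  shows "(\<integral>\<^sup>+\<omega>. h (\<omega>, \<omega>) \<partial>M) = (\<integral>\<^sup>+x. \<integral>\<^sup>+y. h (x, y) \<partial>M \<partial>M)"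
proof -
  have sub: "sets A \<subseteq> sets M" "sets B \<subseteq> sets M"
    using indep unfolding indep_sets2_eq by auto
  have rv [measurable]: "(\<lambda>\<omega>. \<omega>) \<in> measurable M A" "(\<lambda>\<omega>. \<omega>) \<in> measurable M B"
    using sub sp by (auto intro!: measurableI simp: sets.Int_space_eq2)
  have pre: "sigma_sets (space M) {(\<lambda>\<omega>. \<omega>) -` X \<inter> space M |X. X \<in> sets C} = sets C" if "space C = space M" for C
  proof -
    have "{(\<lambda>\<omega>. \<omega>) -` X \<inter> space M |X. X \<in> sets C} = sets C"
      using that sets.Int_space_eq2[of _ C] by (auto simp: vimage_def)
    then show ?thesis
      using sets.sigma_sets_eq[of C] that by simp
  qed
  have "indep_var A (\<lambda>\<omega>. \<omega>) B (\<lambda>\<omega>. \<omega>)"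
    unfolding indep_var_eq pre[OF sp(1)] pre[OF sp(2)] using rv indep by simp
  then have diag: "distr M A (\<lambda>\<omega>. \<omega>) \<Otimes>\<^sub>M distr M B (\<lambda>\<omega>. \<omega>) = distr M (A \<Otimes>\<^sub>M B) (\<lambda>\<omega>. (\<omega>, \<omega>))"
    by (simp add: indep_var_distribution_eq)
  interpret DA: prob_space "distr M A (\<lambda>\<omega>. \<omega>)"
    by (rule prob_space_distr) simp
  interpret DB: prob_space "distr M B (\<lambda>\<omega>. \<omega>)"
    by (rule prob_space_distr) simp
  have "(\<integral>\<^sup>+\<omega>. h (\<omega>, \<omega>) \<partial>M) = (\<integral>\<^sup>+z. h z \<partial>distr M (A \<Otimes>\<^sub>M B) (\<lambda>\<omega>. (\<omega>, \<omega>)))"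
    using h by (subst nn_integral_distr) auto
  also have "\<dots> = (\<integral>\<^sup>+x. \<integral>\<^sup>+y. h (x, y) \<partial>distr M B (\<lambda>\<omega>. \<omega>) \<partial>distr M A (\<lambda>\<omega>. \<omega>))"
    using h unfolding diag [symmetric] by (subst DB.nn_integral_fst [symmetric]) auto
  also have "\<dots> = (\<integral>\<^sup>+x. \<integral>\<^sup>+y. h (x, y) \<partial>distr M B (\<lambda>\<omega>. \<omega>) \<partial>M)"
    using h by (subst nn_integral_distr) (auto intro!: DB.borel_measurable_nn_integral)
  also have "\<dots> = (\<integral>\<^sup>+x. \<integral>\<^sup>+y. h (x, y) \<partial>M \<partial>M)"
  proof (rule nn_integral_cong)
    fix x assume "x \<in> space M"
    then have "(\<lambda>y. h (x, y)) \<in> borel_measurable B"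
      using h sp by (intro measurable_compose[OF measurable_Pair1' h]) auto
    then show "(\<integral>\<^sup>+y. h (x, y) \<partial>distr M B (\<lambda>\<omega>. \<omega>)) = (\<integral>\<^sup>+y. h (x, y) \<partial>M)"
      by (subst nn_integral_distr) auto
  qed
  finally show ?thesis .
qed

text \<open>
  With the coefficients frozen the integral factorizes, and the definition of sub-Gaussianity with
  parameter 1 bounds each factor by 1. Subtracting the random variance proxy inside the exponential
  makes the bound free of assumptions on the size of the coefficients.
\<close>

lemma (in prob_space) sub_gaussian_sum_exp_moment:
  fixes z g :: "nat \<Rightarrow> 'a \<Rightarrow> complex"
  assumes sp: "space A = space M" "space B = space M"
    and indep: "indep_set (sets A) (sets B)"
    and I: "finite I"
    and z: "\<And>n. n \<in> I \<Longrightarrow> z n \<in> borel_measurable A"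
    and g: "\<And>n. n \<in> I \<Longrightarrow> g n \<in> borel_measurable B" "indep_vars (\<lambda>_. borel) g I"
      "\<And>n. n \<in> I \<Longrightarrow> sub_gaussian M 1 (g n)"
  shows "(\<integral>\<^sup>+\<omega>. ennreal (exp (Re (\<Sum>n\<in>I. z n \<omega> * g n \<omega>) - (\<Sum>n\<in>I. (cmod (z n \<omega>))\<^sup>2) / 2)) \<partial>M) \<le> 1"
proof -
  define h where "h = (\<lambda>(x, y). ennreal (exp (Re (\<Sum>n\<in>I. z n x * g n y) - (\<Sum>n\<in>I. (cmod (z n x))\<^sup>2) / 2)))"
  have h: "h \<in> borel_measurable (A \<Otimes>\<^sub>M B)"
  proof -
    have [measurable]: "(\<lambda>p. z n (fst p)) \<in> borel_measurable (A \<Otimes>\<^sub>M B)"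
      "(\<lambda>p. g n (snd p)) \<in> borel_measurable (A \<Otimes>\<^sub>M B)" if "n \<in> I" for n
      using z[OF that] g(1)[OF that] by auto
    show ?thesis
      unfolding h_def case_prod_unfold by measurable
  qed
  have inner: "(\<integral>\<^sup>+y. h (x, y) \<partial>M) \<le> 1" for x
  proof -
    define f where "f n w = ennreal (exp (Re (z n x * w) - (cmod (z n x))\<^sup>2 / 2))" for n and w :: complex
    have [measurable]: "f n \<in> borel_measurable borel" for n
      unfolding f_def by measurable
    have "(\<integral>\<^sup>+y. h (x, y) \<partial>M) = (\<integral>\<^sup>+y. (\<Prod>n\<in>I. f n (g n y)) \<partial>M)"
      using I by (simp add: h_def f_def prod_ennreal exp_sum [symmetric] sum_subtractf sum_divide_distrib)
    also have "\<dots> = (\<Prod>n\<in>I. \<integral>\<^sup>+y. f n (g n y) \<partial>M)"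
      by (intro indep_vars_nn_integral I indep_vars_compose2[OF g(2)]) auto
    also have "\<dots> \<le> (\<Prod>n\<in>I. 1)"
    proof (rule prod_mono_ennreal)
      fix n assume n: "n \<in> I"
      have [measurable]: "g n \<in> borel_measurable M"
        using g(3)[OF n] by (simp add: sub_gaussian_def)
      have "(\<integral>\<^sup>+y. f n (g n y) \<partial>M)
          = ennreal (exp (- ((cmod (z n x))\<^sup>2 / 2))) * (\<integral>\<^sup>+y. ennreal (exp (Re (cnj (cnj (z n x)) * g n y))) \<partial>M)"
        by (subst nn_integral_cmult [symmetric]) (auto simp: f_def ennreal_mult [symmetric] exp_add [symmetric])
      also have "\<dots> \<le> ennreal (exp (- ((cmod (z n x))\<^sup>2 / 2))) * ennreal (exp (1\<^sup>2 * (cmod (cnj (z n x)))\<^sup>2 / 2))"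
        using g(3)[OF n] unfolding sub_gaussian_def by (intro mult_left_mono) (blast, simp)
      also have "\<dots> = 1"
        by (simp add: ennreal_mult [symmetric] exp_add [symmetric])
      finally show "(\<integral>\<^sup>+y. f n (g n y) \<partial>M) \<le> 1" .
    qed
    finally show ?thesis by simp
  qed
  have "(\<integral>\<^sup>+\<omega>. h (\<omega>, \<omega>) \<partial>M) \<le> (\<integral>\<^sup>+x. 1 \<partial>M)"
    unfolding nn_integral_indep_diagonal[OF sp indep h] by (intro nn_integral_mono inner)
  then show ?thesis
    by (simp add: h_def emeasure_space_1)
qed

lemma log_level_le_powr:
  assumes "0 < \<delta>" "0 \<le> c"
  obtains C where "0 < C"
    "\<And>N l. 1 \<le> N \<Longrightarrow> sqrt (c * (real l + 1) + 2 * ln (real N + 1)) \<le> C * sqrt (real l + 1) * real N powr \<delta>"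
proof
  define C where "C = c + 2 * (1 + 1 / (2 * \<delta>))"
  show "0 < sqrt C"
    using assms by (simp add: C_def add_nonneg_pos)
  fix N l :: nat assume N: "1 \<le> N"
  define t where "t = real N powr (2 * \<delta>)"
  have t1: "1 \<le> t"
    using N assms by (simp add: t_def ge_one_powr_ge_zero)
  have "ln (real N + 1) \<le> ln (2 * real N)"
    using N by simp
  also have "\<dots> = ln 2 + ln (real N)"
    using N by (simp add: ln_mult)
  also have "\<dots> \<le> 1 + t / (2 * \<delta>)"
    using N assms ln_powr_bound[of "real N" "2 * \<delta>"] ln_2_less_1 by (simp add: t_def)
  also have "\<dots> \<le> (1 + 1 / (2 * \<delta>)) * t"
    using t1 by (simp add: algebra_simps)
  finally have ln_le: "ln (real N + 1) \<le> (1 + 1 / (2 * \<delta>)) * t" .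
  have "c * (real l + 1) + 2 * ln (real N + 1) \<le> c * (real l + 1) * t + 2 * ((1 + 1 / (2 * \<delta>)) * t) * (real l + 1)"
  proof (rule add_mono)
    show "c * (real l + 1) \<le> c * (real l + 1) * t"
      using t1 assms mult_left_mono[of 1 t "c * (real l + 1)"] by simp
    have "0 \<le> 2 * ((1 + 1 / (2 * \<delta>)) * t)"
      using t1 assms by simp
    then have "2 * ((1 + 1 / (2 * \<delta>)) * t) * 1 \<le> 2 * ((1 + 1 / (2 * \<delta>)) * t) * (real l + 1)"
      by (intro mult_left_mono) auto
    with ln_le show "2 * ln (real N + 1) \<le> 2 * ((1 + 1 / (2 * \<delta>)) * t) * (real l + 1)"
      by simp
  qed
  also have "\<dots> = C * (real l + 1) * t"
    by (simp add: C_def algebra_simps)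
  finally have "sqrt (c * (real l + 1) + 2 * ln (real N + 1)) \<le> sqrt (C * (real l + 1) * t)"
    by (rule real_sqrt_le_mono)
  also have "\<dots> = sqrt C * sqrt (real l + 1) * real N powr \<delta>"
    using N by (simp add: real_sqrt_mult t_def powr_half_sqrt [symmetric] powr_powr)
  finally show "sqrt (c * (real l + 1) + 2 * ln (real N + 1)) \<le> sqrt C * sqrt (real l + 1) * real N powr \<delta>" .
qed

text \<open>
  The union bound over all \<open>N\<close>, all levels \<open>l\<close> and all items at level \<open>l\<close>, carried out with exponential
  moments. Let \<open>Z\<close> be one of the sums, \<open>Q\<close> the sum of its squared coefficients and \<open>u\<close> one of the four
  directions \<open>\<plusminus>1, \<plusminus>\<i>\<close>. The variables \<open>exp (\<theta> Re (u Z) - \<theta>\<^sup>2 Q / 2)\<close> have mean at most 1, so with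
  weights \<open>exp (- \<theta>\<^sup>2)\<close> and \<open>\<theta>\<^sup>2 = c (l + 1) + 2 ln (N + 1)\<close> the sum of all of them is integrable, hence almost
  surely finite. Taking logarithms gives \<open>Re (u Z) = O(\<theta> (1 + Q))\<close> simultaneously for all sums, where
  \<open>\<theta>\<close> is at most a multiple of \<open>sqrt (l + 1) * N powr \<delta>\<close>.
\<close>

lemma (in prob_space) sub_gaussian_partial_sums_bound:
  fixes g :: "nat \<Rightarrow> 'a \<Rightarrow> complex" and z :: "nat \<Rightarrow> 'i \<Rightarrow> nat \<Rightarrow> 'a \<Rightarrow> complex"
  assumes sp: "space A = space M" "space B = space M"
    and indep: "indep_set (sets A) (sets B)"
    and g: "\<And>n. 1 \<le> n \<Longrightarrow> g n \<in> borel_measurable B" "indep_vars (\<lambda>_. borel) g {1..}"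
      "\<And>n. 1 \<le> n \<Longrightarrow> sub_gaussian M 1 (g n)"
    and E: "\<And>l. finite (E l)" "\<And>l. real (card (E l)) \<le> D ^ Suc l" "1 \<le> D"
    and z: "\<And>l e n. e \<in> E l \<Longrightarrow> 1 \<le> n \<Longrightarrow> z l e n \<in> borel_measurable A"
    and \<delta>: "0 < \<delta>"
  shows "AE \<omega> in M. \<exists>C\<ge>0. \<forall>N\<ge>1. \<forall>l. \<forall>e\<in>E l.
    cmod (\<Sum>n=1..N. z l e n \<omega> * g n \<omega>)
      \<le> C * sqrt (real l + 1) * real N powr \<delta> * (1 + (\<Sum>n=1..N. (cmod (z l e n \<omega>))\<^sup>2))"
proof -
  define c where "c = 1 + ln D"
  have c1: "1 \<le> c"
    using E by (simp add: c_def)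
  obtain C\<^sub>0 where C\<^sub>0: "0 < C\<^sub>0" "\<And>N l. 1 \<le> N \<Longrightarrow>
      sqrt (c * (real l + 1) + 2 * ln (real N + 1)) \<le> C\<^sub>0 * sqrt (real l + 1) * real N powr \<delta>"
    using log_level_le_powr[OF \<delta>, of c] c1 by auto
  define \<theta> where "\<theta> N l = sqrt (c * (real l + 1) + 2 * ln (real N + 1))" for N l :: nat
  have \<theta>1: "1 \<le> \<theta> N l" for N l
  proof -
    have "1 * 1 \<le> c * (real l + 1)"
      using c1 by (intro mult_mono) auto
    moreover have "0 \<le> ln (real N + 1)" by simp
    ultimately have "1 \<le> c * (real l + 1) + 2 * ln (real N + 1)" by linarith
    then show ?thesis by (simp add: \<theta>_def)
  qed
  have \<theta>sq: "(\<theta> N l)\<^sup>2 = c * (real l + 1) + 2 * ln (real N + 1)" for N l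
    using c1 by (simp add: \<theta>_def)
  \<comment> \<open>The modulus of a complex number is at most the sum of its real parts in two of these directions.\<close>
  define U where "U = {1, -1, \<i>, -\<i>}"
  have U: "finite U" "card U = 4" "\<And>u. u \<in> U \<Longrightarrow> cmod u = 1"
    by (auto simp: U_def) (simp add: complex_eq_iff card_insert_if)
  define Z where "Z N l e \<omega> = (\<Sum>n=1..N. z l e n \<omega> * g n \<omega>)" for N l e \<omega>
  define Q where "Q N l e \<omega> = (\<Sum>n=1..N. (cmod (z l e n \<omega>))\<^sup>2)" for N l e \<omega>
  define X where "X N l e u \<omega> = exp (- (\<theta> N l)\<^sup>2) * exp (\<theta> N l * Re (u * Z N l e \<omega>) - (\<theta> N l)\<^sup>2 * Q N l e \<omega> / 2)" for N l e u \<omega>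
  define F where "F N l \<omega> = (\<Sum>e\<in>E l. \<Sum>u\<in>U. X N l e u \<omega>)" for N l \<omega>
  have AM: "f \<in> borel_measurable M" if "f \<in> borel_measurable A" for f :: "'a \<Rightarrow> complex"
  proof -
    have "sets A \<subseteq> sets M" using indep unfolding indep_sets2_eq by auto
    then show ?thesis using that sp by (auto simp: measurable_def)
  qed
  have [measurable]: "g n \<in> borel_measurable M" if "1 \<le> n" for n
    using g(3)[OF that] by (simp add: sub_gaussian_def)
  have Xm [measurable]: "X N l e u \<in> borel_measurable M" if "e \<in> E l" for N l e u
  proof -
    have [measurable]: "z l e n \<in> borel_measurable M" if "n \<in> {1..N}" for n
      using that z[OF \<open>e \<in> E l\<close>] by (intro AM) auto
    have [measurable]: "g n \<in> borel_measurable M" if "n \<in> {1..N}" for n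
      using that by auto
    show ?thesis
      unfolding X_def Z_def Q_def by measurable
  qed
  have X_int: "(\<integral>\<^sup>+\<omega>. ennreal (X N l e u \<omega>) \<partial>M) \<le> ennreal (exp (- (\<theta> N l)\<^sup>2))" if e: "e \<in> E l" and u: "u \<in> U" for N l e u
  proof -
    let ?z = "\<lambda>n \<omega>. of_real (\<theta> N l) * u * z l e n \<omega>"
    have eq: "exp (\<theta> N l * Re (u * Z N l e \<omega>) - (\<theta> N l)\<^sup>2 * Q N l e \<omega> / 2)
        = exp (Re (\<Sum>n=1..N. ?z n \<omega> * g n \<omega>) - (\<Sum>n=1..N. (cmod (?z n \<omega>))\<^sup>2) / 2)" for \<omega>
    proof -
      have "(\<Sum>n=1..N. ?z n \<omega> * g n \<omega>) = of_real (\<theta> N l) * (u * Z N l e \<omega>)"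
        by (simp add: Z_def sum_distrib_left mult_ac)
      moreover have "(\<Sum>n=1..N. (cmod (?z n \<omega>))\<^sup>2) = (\<theta> N l)\<^sup>2 * Q N l e \<omega>"
        using U(3)[OF u] by (simp add: Q_def sum_distrib_left norm_mult power_mult_distrib)
      ultimately show ?thesis by simp
    qed
    have le1: "(\<integral>\<^sup>+\<omega>. ennreal (exp (Re (\<Sum>n=1..N. ?z n \<omega> * g n \<omega>) - (\<Sum>n=1..N. (cmod (?z n \<omega>))\<^sup>2) / 2)) \<partial>M) \<le> 1"
    proof (rule sub_gaussian_sum_exp_moment[OF sp indep])
      show "indep_vars (\<lambda>_. borel) g {1..N}"
        using g(2) by (rule indep_vars_subset) auto
      show "?z n \<in> borel_measurable A" if "n \<in> {1..N}" for n
      proof -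
        have [measurable]: "z l e n \<in> borel_measurable A"
          using that by (intro z e) auto
        show ?thesis by measurable
      qed
    qed (use g in auto)
    have [measurable]: "(\<lambda>\<omega>. exp (\<theta> N l * Re (u * Z N l e \<omega>) - (\<theta> N l)\<^sup>2 * Q N l e \<omega> / 2)) \<in> borel_measurable M"
    proof -
      have "(\<lambda>\<omega>. exp ((\<theta> N l)\<^sup>2) * X N l e u \<omega>) \<in> borel_measurable M"
        using Xm[OF e] by measurable
      moreover have "exp ((\<theta> N l)\<^sup>2) * X N l e u \<omega> = exp (\<theta> N l * Re (u * Z N l e \<omega>) - (\<theta> N l)\<^sup>2 * Q N l e \<omega> / 2)" for \<omega>
        unfolding X_def mult.assoc [symmetric] exp_add [symmetric] by simp
      ultimately show ?thesis
        by (simp only:)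
    qed
    have "(\<integral>\<^sup>+\<omega>. ennreal (X N l e u \<omega>) \<partial>M) = ennreal (exp (- (\<theta> N l)\<^sup>2)) *
        (\<integral>\<^sup>+\<omega>. ennreal (exp (\<theta> N l * Re (u * Z N l e \<omega>) - (\<theta> N l)\<^sup>2 * Q N l e \<omega> / 2)) \<partial>M)"
      unfolding X_def by (subst nn_integral_cmult [symmetric]) (auto simp: ennreal_mult simp del: times_complex.sel)
    also have "\<dots> \<le> ennreal (exp (- (\<theta> N l)\<^sup>2)) * 1"
      using le1 unfolding eq by (intro mult_left_mono) auto
    finally show ?thesis by simp
  qed
  have "AE \<omega> in M. \<exists>C. \<forall>N l. F N l \<omega> \<le> C"
  proof (rule AE_bounded_of_nn_integral_le)
    show [measurable]: "F N l \<in> borel_measurable M" for N l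
      unfolding F_def by measurable
    show "(\<integral>\<^sup>+\<omega>. ennreal (F N l \<omega>) \<partial>M) \<le> ennreal (1 / (real (Suc N))\<^sup>2 * (4 * exp (- 1) ^ Suc l))" for N l
    proof -
      have Xnn: "0 \<le> X N l e u \<omega>" for e u \<omega>
        by (simp add: X_def)
      have "(\<integral>\<^sup>+\<omega>. ennreal (F N l \<omega>) \<partial>M) = (\<Sum>e\<in>E l. \<Sum>u\<in>U. \<integral>\<^sup>+\<omega>. ennreal (X N l e u \<omega>) \<partial>M)"
        by (simp add: F_def Xnn sum_ennreal [symmetric] sum_nonneg nn_integral_sum del: sum_ennreal)
      also have "\<dots> \<le> (\<Sum>e\<in>E l. \<Sum>u\<in>U. ennreal (exp (- (\<theta> N l)\<^sup>2)))"
        by (intro sum_mono X_int)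
      also have "\<dots> = ennreal (real (card (E l)) * (4 * exp (- (\<theta> N l)\<^sup>2)))"
        by (simp add: U ennreal_mult ennreal_of_nat_eq_real_of_nat)
      also have "\<dots> \<le> ennreal (D ^ Suc l * (4 * exp (- (\<theta> N l)\<^sup>2)))"
        using E by (intro ennreal_leI mult_right_mono) auto
      also have "D ^ Suc l * (4 * exp (- (\<theta> N l)\<^sup>2)) = 1 / (real (Suc N))\<^sup>2 * (4 * exp (- 1) ^ Suc l)"
      proof -
        have "exp (- (\<theta> N l)\<^sup>2) = exp (- c) ^ Suc l * exp (- 2 * ln (real (Suc N)))"
          unfolding \<theta>sq exp_of_nat_mult [symmetric] exp_add [symmetric] by (simp add: algebra_simps)
        moreover have "exp (- c) = exp (- 1) / D"
          using E by (simp add: c_def exp_add exp_minus exp_diff divide_simps)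
        moreover have "exp (- 2 * ln (real (Suc N))) = 1 / (real (Suc N))\<^sup>2"
          using exp_of_nat_mult[of 2 "ln (real (Suc N))"] by (simp add: exp_minus divide_inverse)
        ultimately show ?thesis
          using E by (simp only: power_divide) simp
      qed
      finally show ?thesis .
    qed
    show "summable (\<lambda>N. 1 / (real (Suc N))\<^sup>2)"
      using inverse_power_summable[of 2] summable_Suc_iff[of "\<lambda>n. inverse (real n ^ 2)"]
      by (simp add: divide_inverse del: of_nat_Suc)
    have "summable (\<lambda>l. exp (- 1 :: real) ^ l)"
      by (intro summable_geometric) simp
    then show "summable (\<lambda>l. 4 * exp (- 1 :: real) ^ Suc l)"
      by (intro summable_mult) (simp add: summable_mult)
  qed auto
  then show ?thesis
  proof eventually_elim
    case (elim \<omega>)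
    then obtain \<Xi> where \<Xi>: "\<And>N l. F N l \<omega> \<le> \<Xi>" by blast
    define L where "L = ln (max \<Xi> 1)"
    have L: "0 \<le> L" by (simp add: L_def)
    have Xle: "X N l e u \<omega> \<le> exp L" if "e \<in> E l" "u \<in> U" for N l e u
    proof -
      have "X N l e u \<omega> \<le> (\<Sum>u\<in>U. X N l e u \<omega>)"
        using that U by (intro member_le_sum) (auto simp: X_def)
      also have "\<dots> \<le> F N l \<omega>"
        unfolding F_def using that E by (intro member_le_sum) (auto simp: X_def intro!: sum_nonneg)
      also have "\<dots> \<le> exp L"
        using \<Xi>[of N l] by (simp add: L_def)
      finally show ?thesis .
    qed
    have dir: "Re (u * Z N l e \<omega>) \<le> (1 + L) * \<theta> N l * (1 + Q N l e \<omega>)" if "e \<in> E l" "u \<in> U" for N l e u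
    proof -
      have Qnn: "0 \<le> Q N l e \<omega>" by (simp add: Q_def sum_nonneg)
      have "\<theta> N l * Re (u * Z N l e \<omega>) - (\<theta> N l)\<^sup>2 * Q N l e \<omega> / 2 - (\<theta> N l)\<^sup>2 \<le> L"
        using Xle[OF that, of N] by (simp add: X_def exp_add [symmetric])
      also have "L \<le> (\<theta> N l)\<^sup>2 * L"
        using L \<theta>1[of N l] by (simp add: mult_le_cancel_right1 one_le_power)
      finally have "\<theta> N l * Re (u * Z N l e \<omega>) \<le> (\<theta> N l)\<^sup>2 * (L + 1 + Q N l e \<omega> / 2)"
        by (simp add: algebra_simps)
      also have "\<dots> \<le> (\<theta> N l)\<^sup>2 * ((1 + L) * (1 + Q N l e \<omega>))"
        using L Qnn by (intro mult_left_mono) (auto simp: algebra_simps)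
      finally have "\<theta> N l * Re (u * Z N l e \<omega>) \<le> \<theta> N l * ((1 + L) * \<theta> N l * (1 + Q N l e \<omega>))"
        by (simp add: power2_eq_square mult_ac)
      then show ?thesis
        using \<theta>1[of N l] by (simp add: mult_le_cancel_left)
    qed
    have main: "cmod (Z N l e \<omega>) \<le> 2 * (1 + L) * \<theta> N l * (1 + Q N l e \<omega>)" if "e \<in> E l" for N l e
    proof -
      have "cmod (Z N l e \<omega>) \<le> \<bar>Re (Z N l e \<omega>)\<bar> + \<bar>Im (Z N l e \<omega>)\<bar>"
        by (rule cmod_le)
      moreover have "\<bar>Re (Z N l e \<omega>)\<bar> \<le> (1 + L) * \<theta> N l * (1 + Q N l e \<omega>)"
        using dir[OF that, of 1 N] dir[OF that, of "-1" N] by (simp add: U_def abs_le_iff)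
      moreover have "\<bar>Im (Z N l e \<omega>)\<bar> \<le> (1 + L) * \<theta> N l * (1 + Q N l e \<omega>)"
        using dir[OF that, of "\<i>" N] dir[OF that, of "-\<i>" N] by (simp add: U_def abs_le_iff)
      ultimately show ?thesis
        unfolding mult.assoc by linarith
    qed
    show ?case
    proof (intro exI[of _ "2 * (1 + L) * C\<^sub>0"] conjI allI impI ballI)
      show "0 \<le> 2 * (1 + L) * C\<^sub>0"
        using L C\<^sub>0 by simp
      fix N l e assume N: "1 \<le> (N::nat)" and e: "e \<in> E l"
      have "cmod (Z N l e \<omega>) \<le> 2 * (1 + L) * \<theta> N l * (1 + Q N l e \<omega>)"
        by (rule main[OF e])
      also have "\<dots> \<le> 2 * (1 + L) * (C\<^sub>0 * sqrt (real l + 1) * real N powr \<delta>) * (1 + Q N l e \<omega>)"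
        using C\<^sub>0(2)[OF N, of l] L unfolding \<theta>_def
        by (intro mult_right_mono mult_left_mono) (auto simp: Q_def intro!: add_nonneg_nonneg sum_nonneg)
      finally show "cmod (\<Sum>n=1..N. z l e n \<omega> * g n \<omega>)
          \<le> 2 * (1 + L) * C\<^sub>0 * sqrt (real l + 1) * real N powr \<delta> * (1 + (\<Sum>n=1..N. (cmod (z l e n \<omega>))\<^sup>2))"
        by (simp add: Z_def Q_def mult.assoc)
    qed
  qed
qed

section \<open>Paths of the fields and independence of their sigma-algebras\<close>

lemma distance_bound_imp_small:
  fixes \<rho> :: "'e::real_normed_vector \<Rightarrow> 'e \<Rightarrow> real"
  assumes H: "0 < H" "0 < c"
    and \<rho>: "\<And>x y. norm (x - y) \<le> 1 \<Longrightarrow> \<rho> x y \<le> c * norm (x - y) powr H"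
  obtains h where "0 < h" "\<And>x y. norm (x - y) \<le> h \<Longrightarrow> \<rho> x y \<le> 2 powr (- real l)"
proof -
  define h where "h = min 1 ((2 powr (- real l) / c) powr (1 / H))"
  show thesis
  proof (rule that[of h])
    show "0 < h" using H by (simp add: h_def)
    fix x y :: 'e assume xy: "norm (x - y) \<le> h"
    then have "\<rho> x y \<le> c * norm (x - y) powr H"
      by (intro \<rho>) (simp add: h_def)
    also have "\<dots> \<le> c * ((2 powr (- real l) / c) powr (1 / H)) powr H"
      using xy H by (intro mult_left_mono powr_mono2) (auto simp: h_def)
    also have "\<dots> = 2 powr (- real l)"
      using H by (simp add: powr_powr)
    finally show "\<rho> x y \<le> 2 powr (- real l)" .
  qed
qed

text \<open>
  Finiteness of the supremum controls increments of \<open>v\<close> at small scales only. As \<open>K\<close> is convex, this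
  still bounds \<open>v\<close> on all of \<open>K\<close> by its value at one point and the supremum. The last bound says that
  Lipschitz functions have small increments with respect to \<open>\<rho>\<close>; here \<open>H\<^sub>2 \<le> 1\<close> and \<open>\<beta> \<le> 1\<close> enter.
\<close>

lemma path_bounds_of_modulus:
  fixes \<rho> :: "'e::real_normed_vector \<Rightarrow> 'e \<Rightarrow> real"
  assumes K: "compact K" "convex K" "x\<^sub>0 \<in> K" and \<rho>: "quasi_metric \<rho>"
    and H: "0 < H\<^sub>1" "H\<^sub>2 \<le> 1" "0 < c\<^sub>1" "0 < c\<^sub>2"
      "\<And>x y. norm (x - y) \<le> 1 \<Longrightarrow> c\<^sub>1 * norm (x - y) powr H\<^sub>2 \<le> \<rho> x y \<and> \<rho> x y \<le> c\<^sub>2 * norm (x - y) powr H\<^sub>1"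
    and r: "0 < r" and \<beta>: "0 < \<beta>" "\<beta> \<le> 1"
  obtains C l\<^sub>1 where "0 \<le> C" "1 \<le> l\<^sub>1"
    "\<And>v x. x \<in> K \<Longrightarrow> modulus_sup \<rho> K r \<beta> \<eta> v < \<top> \<Longrightarrow>
       cmod (v x) \<le> C * (cmod (v x\<^sub>0) + enn2real (modulus_sup \<rho> K r \<beta> \<eta> v))"
    "\<And>v x y l. x \<in> K \<Longrightarrow> y \<in> K \<Longrightarrow> l\<^sub>1 \<le> l \<Longrightarrow> \<rho> x y \<le> 2 powr (- real l) \<Longrightarrow> modulus_sup \<rho> K r \<beta> \<eta> v < \<top> \<Longrightarrow>
       cmod (v x - v y) \<le> C * enn2real (modulus_sup \<rho> K r \<beta> \<eta> v) * level_weight \<beta> (max \<eta> 0) l"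
    "\<And>x y l. x \<in> K \<Longrightarrow> y \<in> K \<Longrightarrow> l\<^sub>1 \<le> l \<Longrightarrow> \<rho> x y \<le> 2 powr (- real l) \<Longrightarrow>
       norm (x - y) \<le> C * level_weight \<beta> (max \<eta> 0) l"
proof -
  define w where "w = level_weight \<beta> (max \<eta> 0)"
  define m where "m v = enn2real (modulus_sup \<rho> K r \<beta> \<eta> v)" for v
  have w_nn: "0 \<le> w l" for l
    by (simp add: w_def level_weight_pos less_imp_le)
  have m_nn: "0 \<le> m v" for v
    by (simp add: m_def)
  have pos: "0 < \<rho> x y" if "x \<noteq> y" for x y
    using \<rho> that by (auto simp: quasi_metric_def less_le)
  have cont: "continuous_on UNIV (\<lambda>(x, y). \<rho> x y)"
    using \<rho> by (simp add: quasi_metric_def)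
  obtain C\<^sub>0 where C\<^sub>0: "0 \<le> C\<^sub>0"
    "\<And>v x y l. 1 \<le> l \<Longrightarrow> x \<in> K \<Longrightarrow> y \<in> K \<Longrightarrow> 0 < norm (x - y) \<Longrightarrow> norm (x - y) \<le> r \<Longrightarrow>
      0 < \<rho> x y \<Longrightarrow> \<rho> x y \<le> 2 powr (- real l) \<Longrightarrow> modulus_sup \<rho> K r \<beta> \<eta> v < \<top> \<Longrightarrow>
      cmod (v x - v y) \<le> C\<^sub>0 * m v * w l"
    unfolding m_def w_def using modulus_sup_increment[OF \<beta>(1), of K r \<rho> \<eta>] by metis
  obtain l\<^sub>a where l\<^sub>a: "\<And>x y. x \<in> K \<Longrightarrow> y \<in> K \<Longrightarrow> \<rho> x y \<le> 2 powr (- real l\<^sub>a) \<Longrightarrow> dist x y < min r 1"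
    using small_quasi_metric_imp_close[OF K(1) cont pos, of "min r 1"] r by auto
  define l\<^sub>1 where "l\<^sub>1 = max 1 l\<^sub>a"
  have close: "norm (x - y) < min r 1" if "x \<in> K" "y \<in> K" "l\<^sub>1 \<le> l" "\<rho> x y \<le> 2 powr (- real l)" for x y l
  proof -
    have "2 powr (- real l) \<le> (2::real) powr (- real l\<^sub>a)"
      using that by (intro powr_mono) (auto simp: l\<^sub>1_def)
    with that(4) have "\<rho> x y \<le> 2 powr (- real l\<^sub>a)"
      by (rule order_trans)
    from l\<^sub>a[OF that(1,2) this] show ?thesis
      by (simp add: dist_norm)
  qed
  have incr: "cmod (v x - v y) \<le> C\<^sub>0 * m v * w l"
    if "x \<in> K" "y \<in> K" "l\<^sub>1 \<le> l" "\<rho> x y \<le> 2 powr (- real l)" "modulus_sup \<rho> K r \<beta> \<eta> v < \<top>" for v x y l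
  proof (cases "x = y")
    case False
    then show ?thesis
      using that close[OF that(1-4)] pos[of x y] by (intro C\<^sub>0(2)) (auto simp: l\<^sub>1_def)
  qed (use C\<^sub>0 m_nn w_nn in simp)
  obtain h where h: "0 < h" "\<And>x y. norm (x - y) \<le> h \<Longrightarrow> \<rho> x y \<le> 2 powr (- real l\<^sub>1)"
    using distance_bound_imp_small[of H\<^sub>1 c\<^sub>2 \<rho> l\<^sub>1] H by metis
  obtain R where R: "\<And>x. x \<in> K \<Longrightarrow> norm x \<le> R"
    using compact_imp_bounded[OF K(1)] by (auto simp: bounded_iff)
  obtain k :: nat where "2 * R / h < real k"
    using reals_Archimedean2 by blast
  then have k: "2 * R \<le> real (Suc k) * h"
    using h by (simp add: field_simps)
  have sup: "cmod (v x) \<le> (1 + real (Suc k) * C\<^sub>0 * w l\<^sub>1) * (cmod (v x\<^sub>0) + m v)"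
    if x: "x \<in> K" and v: "modulus_sup \<rho> K r \<beta> \<eta> v < \<top>" for v x
  proof -
    have "norm (v x - v x\<^sub>0) \<le> real (Suc k) * (C\<^sub>0 * m v * w l\<^sub>1)"
    proof (rule convex_oscillation_le[OF K(2), where h = h])
      show "norm (v x - v y) \<le> C\<^sub>0 * m v * w l\<^sub>1" if "x \<in> K" "y \<in> K" "norm (x - y) \<le> h" for x y
        using that h v by (intro incr) auto
      show "norm (x - x\<^sub>0) \<le> real (Suc k) * h"
        using norm_triangle_ineq4[of x x\<^sub>0] R[OF x] R[OF K(3)] k by linarith
    qed (use x K in auto)
    then have "cmod (v x) \<le> cmod (v x\<^sub>0) + real (Suc k) * (C\<^sub>0 * m v * w l\<^sub>1)"
      using norm_triangle_sub[of "v x" "v x\<^sub>0"] by linarith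
    also have "\<dots> \<le> (cmod (v x\<^sub>0) + m v) + real (Suc k) * C\<^sub>0 * w l\<^sub>1 * (cmod (v x\<^sub>0) + m v)"
    proof (rule add_mono)
      have "real (Suc k) * C\<^sub>0 * w l\<^sub>1 * m v \<le> real (Suc k) * C\<^sub>0 * w l\<^sub>1 * (cmod (v x\<^sub>0) + m v)"
        using C\<^sub>0 w_nn by (intro mult_left_mono mult_nonneg_nonneg) auto
      then show "real (Suc k) * (C\<^sub>0 * m v * w l\<^sub>1) \<le> real (Suc k) * C\<^sub>0 * w l\<^sub>1 * (cmod (v x\<^sub>0) + m v)"
        by (simp only: mult_ac)
    qed (use m_nn in simp)
    finally show ?thesis
      by (simp only: distrib_right mult_1_left)
  qed
  have dist_le: "norm (x - y) \<le> 1 / c\<^sub>1 * w l"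
    if xy: "x \<in> K" "y \<in> K" "l\<^sub>1 \<le> l" "\<rho> x y \<le> 2 powr (- real l)" for x y l
  proof -
    have n1: "norm (x - y) \<le> 1"
      using close[OF that] by simp
    have "norm (x - y) powr 1 \<le> norm (x - y) powr H\<^sub>2"
      using n1 H by (intro powr_mono') auto
    then have "c\<^sub>1 * norm (x - y) \<le> c\<^sub>1 * norm (x - y) powr H\<^sub>2"
      using H by (intro mult_left_mono) auto
    also have "\<dots> \<le> 2 powr (- real l)"
      using H(5)[OF n1] xy by linarith
    also have "\<dots> \<le> 2 powr (- (real l * \<beta>))"
      using \<beta> by (intro powr_mono) (auto simp: mult_left_le)
    also have "\<dots> * 1 \<le> w l"
      unfolding w_def level_weight_def by (intro mult_left_mono ge_one_powr_ge_zero) auto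
    finally show ?thesis
      using H by (simp add: field_simps)
  qed
  define C where "C = C\<^sub>0 + (1 + real (Suc k) * C\<^sub>0 * w l\<^sub>1) + 1 / c\<^sub>1"
  have nn: "0 \<le> real (Suc k) * C\<^sub>0 * w l\<^sub>1" "0 \<le> 1 / c\<^sub>1"
    using C\<^sub>0 w_nn H by (auto intro!: mult_nonneg_nonneg)
  show thesis
  proof (rule that[of C l\<^sub>1])
    show "0 \<le> C" using C\<^sub>0 nn by (simp add: C_def)
    show "1 \<le> l\<^sub>1" by (simp add: l\<^sub>1_def)
  next
    fix v x assume "x \<in> K" "modulus_sup \<rho> K r \<beta> \<eta> v < \<top>"
    from sup[OF this] have "cmod (v x) \<le> (1 + real (Suc k) * C\<^sub>0 * w l\<^sub>1) * (cmod (v x\<^sub>0) + m v)" .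
    also have "\<dots> \<le> C * (cmod (v x\<^sub>0) + m v)"
      using C\<^sub>0 nn m_nn by (intro mult_right_mono) (auto simp: C_def)
    finally show "cmod (v x) \<le> C * (cmod (v x\<^sub>0) + enn2real (modulus_sup \<rho> K r \<beta> \<eta> v))"
      by (simp add: m_def)
  next
    fix v x y l
    assume "x \<in> K" "y \<in> K" "l\<^sub>1 \<le> l" "\<rho> x y \<le> 2 powr (- real l)" "modulus_sup \<rho> K r \<beta> \<eta> v < \<top>"
    from incr[OF this] have "cmod (v x - v y) \<le> C\<^sub>0 * m v * w l" .
    also have "\<dots> \<le> C * m v * w l"
      using C\<^sub>0 nn m_nn w_nn by (intro mult_right_mono) (auto simp: C_def)
    finally show "cmod (v x - v y) \<le> C * enn2real (modulus_sup \<rho> K r \<beta> \<eta> v) * level_weight \<beta> (max \<eta> 0) l"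
      by (simp add: m_def w_def)
  next
    fix x y l assume "x \<in> K" "y \<in> K" "l\<^sub>1 \<le> l" "\<rho> x y \<le> 2 powr (- real l)"
    from dist_le[OF this] have "norm (x - y) \<le> 1 / c\<^sub>1 * w l" .
    also have "\<dots> \<le> C * w l"
      using C\<^sub>0 nn w_nn by (intro mult_right_mono) (auto simp: C_def)
    finally show "norm (x - y) \<le> C * level_weight \<beta> (max \<eta> 0) l"
      by (simp add: w_def)
  qed
qed

lemma measurable_vimage_seq_component:
  assumes "1 \<le> n" "\<And>\<omega> k. \<omega> \<in> space M \<Longrightarrow> 1 \<le> k \<Longrightarrow> X k \<omega> \<in> space N"
  shows "X n \<in> measurable (vimage_algebra (space M) (\<lambda>\<omega>. \<lambda>n\<in>{1..}. X n \<omega>) (\<Pi>\<^sub>M n\<in>{1..}. N)) N"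
proof -
  have "(\<lambda>\<omega>. \<lambda>n\<in>{1..}. X n \<omega>)
      \<in> measurable (vimage_algebra (space M) (\<lambda>\<omega>. \<lambda>n\<in>{1..}. X n \<omega>) (\<Pi>\<^sub>M n\<in>{1..}. N)) (\<Pi>\<^sub>M n\<in>{1..}. N)"
    using assms by (intro measurable_vimage_algebra1) (auto simp: space_PiM)
  from measurable_compose[OF this measurable_component_singleton[of n]] show ?thesis
    using assms by simp
qed

lemma (in prob_space) indep_set_sigma_Un:
  assumes indep: "indep_sets (\<lambda>i. [sets A, sets B, sets C] ! i) {..<3}"
    and sp: "space A = space M" "space B = space M" "space C = space M"
  shows "indep_set (sets (sigma (space M) (sets A \<union> sets B))) (sets C)"
proof -
  define I where "I = (\<lambda>b. if b then {0, 1} else {2::nat})"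
  let ?E = "\<lambda>i. [sets A, sets B, sets C] ! i"
  have I: "(\<Union>b\<in>UNIV. I b) = {..<3}"
    by (auto simp: I_def UNIV_bool)
  have "indep_sets (\<lambda>b. sigma_sets (space M) (\<Union>i\<in>I b. ?E i)) UNIV"
  proof (rule indep_sets_collect_sigma)
    show "indep_sets ?E (\<Union>b\<in>UNIV. I b)"
      unfolding I by (rule indep)
    show "Int_stable (?E i)" if "i \<in> I b" for b i
      using that by (auto simp: I_def sets.Int_stable split: if_splits)
    show "disjoint_family_on I UNIV"
      by (auto simp: disjoint_family_on_def I_def)
  qed
  moreover have "sigma_sets (space M) (\<Union>i\<in>I b. ?E i)
      = (case b of True \<Rightarrow> sets (sigma (space M) (sets A \<union> sets B)) | False \<Rightarrow> sets C)" for b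
  proof (cases b)
    case True
    have "sets A \<union> sets B \<subseteq> Pow (space M)"
      using sets.sets_into_space[of _ A] sets.sets_into_space[of _ B] sp by auto
    with True show ?thesis
      by (simp add: I_def)
  next
    case False
    then show ?thesis
      using sets.sigma_sets_eq[of C] sp by (simp add: I_def)
  qed
  ultimately show ?thesis
    by (simp add: indep_set_def)
qed

lemma measurable_sigma_Un:
  assumes "f \<in> measurable A N \<or> f \<in> measurable B N" "space A = \<Omega>" "space B = \<Omega>"
  shows "f \<in> measurable (sigma \<Omega> (sets A \<union> sets B)) N"
proof -
  have sub: "sets A \<union> sets B \<subseteq> Pow \<Omega>"
    using sets.sets_into_space[of _ A] sets.sets_into_space[of _ B] assms(2,3) by auto
  show ?thesis
  proof (rule measurableI)
    show "f x \<in> space N" if "x \<in> space (sigma \<Omega> (sets A \<union> sets B))" for x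
      using that assms sub by (auto simp: space_measure_of dest: measurable_space)
    show "f -` X \<inter> space (sigma \<Omega> (sets A \<union> sets B)) \<in> sets (sigma \<Omega> (sets A \<union> sets B))" if "X \<in> sets N" for X
      using that assms sub by (auto simp: space_measure_of intro!: in_measure_of dest: measurable_sets)
  qed
qed

lemma borel_measurable_epowr:
  assumes "0 < c"
  shows "(\<lambda>x. epowr x c) \<in> borel_measurable borel"
proof -
  have "(\<lambda>x. epowr x c) = (\<lambda>x. if x = \<top> then \<top> else ennreal (enn2real x powr c))"
    using assms by (auto simp: epowr_def)
  then show ?thesis by simp
qed

lemma powr_le_one_add_powr:
  fixes x q p :: real
  assumes "0 \<le> x" "0 < q" "q \<le> p"
  shows "x powr q \<le> 1 + x powr p"
proof (cases "x \<le> 1")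
  case True
  then have "x powr q \<le> 1"
    using assms powr_mono2[of q x 1] by simp
  then show ?thesis
    by (simp add: add_increasing2)
next
  case False
  then have "x powr q \<le> x powr p"
    using assms by (intro powr_mono) auto
  then show ?thesis by simp
qed

section \<open>Regularity and rate of convergence of the series\<close>

text \<open>
  All fields have the same law, so the moments of \<open>V 1\<close> are those of every \<open>V n\<close>. The exponent \<open>p\<close> of
  the moment assumptions is lowered to \<open>q \<le> 2\<close>.
\<close>

lemma (in prob_space) modulus_moments:
  fixes V :: "nat \<Rightarrow> 'a \<Rightarrow> 'e::real_normed_vector \<Rightarrow> complex"
  assumes P: "(\<lambda>v. v x\<^sub>0) \<in> borel_measurable P" "modulus_sup \<rho> K r \<beta> \<eta> \<in> borel_measurable P"
    and V: "iid_sequence M P V"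
    and q: "0 < q" "q \<le> 2" "q \<le> p"
    and moment: "integrable M (\<lambda>\<omega>. cmod (V 1 \<omega> x\<^sub>0) powr p)"
    and modulus: "(\<integral>\<^sup>+\<omega>. epowr (modulus_sup \<rho> K r \<beta> \<eta> (V 1 \<omega>)) p \<partial>M) < \<infinity>"
    and \<gamma>: "1 < \<gamma> * q / 2"
  shows "AE \<omega> in M. (\<forall>n\<ge>1. modulus_sup \<rho> K r \<beta> \<eta> (V n \<omega>) < \<top>) \<and>
    summable (\<lambda>n. real (Suc n) powr (- \<gamma>) *
      (cmod (V (Suc n) \<omega> x\<^sub>0) + enn2real (modulus_sup \<rho> K r \<beta> \<eta> (V (Suc n) \<omega>)))\<^sup>2)"
proof -
  define msup where "msup = modulus_sup \<rho> K r \<beta> \<eta>"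
  have msup [measurable]: "msup \<in> borel_measurable P"
    using P by (simp add: msup_def)
  have ev [measurable]: "(\<lambda>v. v x\<^sub>0) \<in> borel_measurable P"
    by (rule P)
  have p: "0 < p" using q by simp
  have [measurable]: "(\<lambda>x. epowr x p) \<in> borel_measurable borel"
    by (rule borel_measurable_epowr[OF p])
  have Vm [measurable]: "V n \<in> measurable M P" if "1 \<le> n" for n
    using V that unfolding iid_sequence_def indep_vars_def by auto
  have same: "(\<integral>\<^sup>+\<omega>. f (V n \<omega>) \<partial>M) = (\<integral>\<^sup>+\<omega>. f (V 1 \<omega>) \<partial>M)" if n: "1 \<le> n" and f: "f \<in> borel_measurable P" for f n
  proof -
    have "(\<integral>\<^sup>+\<omega>. f (V n \<omega>) \<partial>M) = integral\<^sup>N (distr M P (V n)) f"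
      using f Vm[OF n] by (simp add: nn_integral_distr)
    also have "distr M P (V n) = distr M P (V 1)"
      using V n unfolding iid_sequence_def by blast
    also have "integral\<^sup>N (distr M P (V 1)) f = (\<integral>\<^sup>+\<omega>. f (V 1 \<omega>) \<partial>M)"
      using f Vm[of 1] by (simp add: nn_integral_distr)
    finally show ?thesis .
  qed
  define D\<^sub>1 where "D\<^sub>1 = (\<integral>\<^sup>+\<omega>. epowr (msup (V 1 \<omega>)) p \<partial>M)"
  define D\<^sub>2 where "D\<^sub>2 = (\<integral>\<^sup>+\<omega>. ennreal (cmod (V 1 \<omega> x\<^sub>0) powr p) \<partial>M)"
  have D\<^sub>1: "(\<integral>\<^sup>+\<omega>. epowr (msup (V n \<omega>)) p \<partial>M) = D\<^sub>1" if "1 \<le> n" for n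
    unfolding D\<^sub>1_def by (rule same[OF that, of "\<lambda>v. epowr (msup v) p"]) measurable
  have D\<^sub>2: "(\<integral>\<^sup>+\<omega>. ennreal (cmod (V n \<omega> x\<^sub>0) powr p) \<partial>M) = D\<^sub>2" if "1 \<le> n" for n
    unfolding D\<^sub>2_def by (rule same[OF that, of "\<lambda>v. ennreal (cmod (v x\<^sub>0) powr p)"]) measurable
  have fin: "D\<^sub>1 < \<top>" "D\<^sub>2 < \<top>"
    using modulus moment by (auto simp: D\<^sub>1_def D\<^sub>2_def msup_def integrable_iff_bounded)
  have finite_mod: "AE \<omega> in M. msup (V n \<omega>) < \<top>" if n: "1 \<le> n" for n
  proof -
    have [measurable]: "V n \<in> measurable M P" by (rule Vm[OF n])
    have "AE \<omega> in M. epowr (msup (V n \<omega>)) p \<noteq> \<infinity>"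
      using D\<^sub>1[OF n] fin by (intro nn_integral_PInf_AE) auto
    then show ?thesis
      by eventually_elim (use p in \<open>auto simp: epowr_def less_top split: if_splits\<close>)
  qed
  have "AE \<omega> in M. \<forall>n\<in>{1..}. msup (V n \<omega>) < \<top>"
    using finite_mod by (intro AE_ball_countable') auto
  moreover have "AE \<omega> in M. summable (\<lambda>n. real (Suc n) powr (- \<gamma>) * (cmod (V (Suc n) \<omega> x\<^sub>0) + enn2real (msup (V (Suc n) \<omega>)))\<^sup>2)"
  proof (rule AE_summable_weighted_squares[where q = q and W = "\<lambda>n \<omega>. cmod (V n \<omega> x\<^sub>0) + enn2real (msup (V n \<omega>))"])
    show "(\<lambda>\<omega>. cmod (V n \<omega> x\<^sub>0) + enn2real (msup (V n \<omega>))) \<in> borel_measurable M" if n: "1 \<le> n" for n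
    proof -
      have [measurable]: "V n \<in> measurable M P" by (rule Vm[OF n])
      have [measurable]: "(\<lambda>\<omega>. V n \<omega> x\<^sub>0) \<in> borel_measurable M"
        by (rule measurable_compose[OF Vm[OF n] ev])
      show ?thesis by measurable
    qed
    show "(\<integral>\<^sup>+\<omega>. ennreal ((cmod (V n \<omega> x\<^sub>0) + enn2real (msup (V n \<omega>))) powr q) \<partial>M)
        \<le> ennreal (enn2real (ennreal (2 powr q) * (2 + D\<^sub>2 + D\<^sub>1)))" if n: "1 \<le> n" for n
    proof -
      have [measurable]: "V n \<in> measurable M P" by (rule Vm[OF n])
      have [measurable]: "(\<lambda>\<omega>. V n \<omega> x\<^sub>0) \<in> borel_measurable M"
        by (rule measurable_compose[OF Vm[OF n] ev])
      have pointwise: "ennreal ((u + enn2real y) powr q) \<le> ennreal (2 powr q) * (2 + ennreal (u powr p) + epowr y p)"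
        if "0 \<le> u" for u and y :: ennreal
      proof -
        define t where "t = enn2real y"
        have t: "0 \<le> t" by (simp add: t_def)
        have "(u + t) powr q \<le> (2 * max u t) powr q"
          using that t q by (intro powr_mono2) auto
        also have "\<dots> = 2 powr q * max u t powr q"
          by (simp add: powr_mult)
        also have "\<dots> \<le> 2 powr q * (u powr q + t powr q)"
          by (intro mult_left_mono) (auto simp: max_def)
        also have "\<dots> \<le> 2 powr q * ((1 + u powr p) + (1 + t powr p))"
          using that t q by (intro mult_left_mono add_mono powr_le_one_add_powr) auto
        also have "\<dots> = 2 powr q * (2 + u powr p + t powr p)"
          by simp
        finally have "ennreal ((u + t) powr q) \<le> ennreal (2 powr q * (2 + u powr p + t powr p))"
          by (rule ennreal_leI)
        also have "\<dots> = ennreal (2 powr q) * (2 + ennreal (u powr p) + ennreal (t powr p))"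
          by (simp add: ennreal_mult ennreal_plus)
        also have "ennreal (t powr p) \<le> epowr y p"
          using p by (auto simp: epowr_def t_def)
        finally show ?thesis
          by (simp add: t_def mult_left_mono)
      qed
      have "(\<integral>\<^sup>+\<omega>. ennreal ((cmod (V n \<omega> x\<^sub>0) + enn2real (msup (V n \<omega>))) powr q) \<partial>M)
          \<le> (\<integral>\<^sup>+\<omega>. ennreal (2 powr q) * (2 + ennreal (cmod (V n \<omega> x\<^sub>0) powr p) + epowr (msup (V n \<omega>)) p) \<partial>M)"
        by (intro nn_integral_mono pointwise) auto
      also have "\<dots> = ennreal (2 powr q) * (2 + D\<^sub>2 + D\<^sub>1)"
        by (simp add: nn_integral_cmult nn_integral_add D\<^sub>1[OF n] D\<^sub>2[OF n] emeasure_space_1)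
      also have "\<dots> = ennreal (enn2real (ennreal (2 powr q) * (2 + D\<^sub>2 + D\<^sub>1)))"
        using fin by (simp add: ennreal_enn2real_if ennreal_mult_eq_top_iff less_top)
      finally show ?thesis by simp
    qed
  qed (use q \<gamma> in auto)
  ultimately show ?thesis
    by eventually_elim (auto simp: msup_def)
qed

text \<open>
  The exponents leave a slack \<open>1/b - 1/q - \<theta> > 0\<close>, with \<open>q = min (2 * p) 2\<close>. One third of it, called
  \<open>\<delta>\<close>, is spent on the logarithm in the bounds for powers of the arrival times, one third on the
  union bound over \<open>N\<close>, and the last third makes the moment condition \<open>\<gamma> q / 2 > 1\<close> strict.
\<close>

lemma series_regularity_AE:
  fixes M :: "'w measure"
    and T :: "nat \<Rightarrow> 'w \<Rightarrow> real"
    and V :: "nat \<Rightarrow> 'w \<Rightarrow> real \<times> (real ^ 'd) \<Rightarrow> complex"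
    and g :: "nat \<Rightarrow> 'w \<Rightarrow> complex"
    and P :: "(real \<times> (real ^ 'd) \<Rightarrow> complex) measure"
    and \<rho> :: "real \<times> (real ^ 'd) \<Rightarrow> real \<times> (real ^ 'd) \<Rightarrow> real"
    and a b :: real and lo hi :: "real ^ 'd"
    and K :: "(real \<times> (real ^ 'd)) set"
    and H\<^sub>1 H\<^sub>2 c\<^sub>1 c\<^sub>2 r \<beta> \<eta> p \<theta> :: real
    and x\<^sub>0 :: "real \<times> (real ^ 'd)"
  assumes prob: "prob_space M"
    and K: "K = {a..b} \<times> cbox lo hi" "0 < a" "b < 2"
    and indep: "prob_space.indep_sets M
      (\<lambda>i. [seq_events M borel T, seq_events M P V, seq_events M borel g] ! i) {..<3}"
    and g: "prob_space.indep_vars M (\<lambda>_. borel) g {1..}"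
      "\<And>n. n \<ge> 1 \<Longrightarrow> sub_gaussian M 1 (g n)"
    and T: "poisson_arrival_times M 1 T"
    and P: "\<And>x. x \<in> K \<Longrightarrow> (\<lambda>v. v x) \<in> borel_measurable P"
      "modulus_sup \<rho> K r \<beta> \<eta> \<in> borel_measurable P"
    and V: "iid_sequence M P V"
    and \<rho>: "quasi_metric \<rho>"
    and H: "0 < H\<^sub>1" "H\<^sub>2 \<le> 1" "0 < c\<^sub>1" "0 < c\<^sub>2"
      "\<And>x y. norm (x - y) \<le> 1 \<Longrightarrow>
         c\<^sub>1 * norm (x - y) powr H\<^sub>2 \<le> \<rho> x y \<and> \<rho> x y \<le> c\<^sub>2 * norm (x - y) powr H\<^sub>1"
    and x\<^sub>0: "x\<^sub>0 \<in> K"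
    and params: "0 < r" "0 < \<beta>" "\<beta> \<le> 1"
    and moment: "integrable M (\<lambda>\<omega>. cmod (V 1 \<omega> x\<^sub>0) powr (2 * p))"
    and modulus: "(\<integral>\<^sup>+ \<omega>. epowr (modulus_sup \<rho> K r \<beta> \<eta> (V 1 \<omega>)) (2 * p) \<partial>M) < \<infinity>"
    and p: "0 < p" and \<theta>: "0 < \<theta>" "\<theta> < 1 / b - 1 / min (2 * p) 2"
  shows "AE \<omega> in M.
      uniform_limit K (\<lambda>N x. partial_series T V g N x \<omega>) (\<lambda>x. full_series T V g x \<omega>) sequentially
      \<and> (\<lambda>x. full_series T V g x \<omega>) \<in> holder_class \<rho> K \<beta> (max \<eta> 0 + 1 / 2)
      \<and> (\<exists>B\<ge>0. \<forall>N\<ge>1. \<forall>x\<in>K. cmod (full_series T V g x \<omega> - partial_series T V g N x \<omega>) \<le> B * real N powr (- \<theta>))"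
proof -
  interpret prob_space M by (rule prob)
  have ab: "a \<le> b" "0 < b"
    using x\<^sub>0 K by auto
  define q where "q = min (2 * p) 2"
  have q: "0 < q" "q \<le> 2" "q \<le> 2 * p"
    using p by (auto simp: q_def)
  define \<delta> where "\<delta> = (1 / b - 1 / q - \<theta>) / 3"
  define s where "s = \<theta> + \<delta>"
  define \<gamma> where "\<gamma> = 2 * (1 / b - \<delta> - s)"
  have \<delta>: "0 < \<delta>" "\<delta> < s" "\<delta> < 1 / b"
  proof -
    have inv: "0 < 1 / q" "0 < 1 / b"
      using q ab by auto
    show \<delta>0: "0 < \<delta>"
      using \<theta> by (simp add: \<delta>_def q_def)
    show "\<delta> < s"
      using \<theta> by (simp add: s_def)
    have "3 * \<delta> = 1 / b - 1 / q - \<theta>"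
      by (simp add: \<delta>_def)
    then show "\<delta> < 1 / b"
      using inv \<theta> \<delta>0 by linarith
  qed
  have \<gamma>: "1 < \<gamma> * q / 2"
  proof -
    have "1 / q < \<gamma> / 2"
      using \<delta> by (simp add: \<gamma>_def s_def \<delta>_def field_simps)
    then show ?thesis
      using q by (simp add: field_simps)
  qed
  define \<eta>' where "\<eta>' = max \<eta> 0"
  define \<mu> where "\<mu> = \<eta>' + 1 / 2"
  have \<mu>: "0 \<le> \<eta>'" "0 \<le> \<mu>" by (auto simp: \<eta>'_def \<mu>_def)
  define w where "w = level_weight \<beta> \<eta>'"
  have w_pos: "0 < w l" for l
    by (simp add: w_def level_weight_pos)
  have w\<mu>: "level_weight \<beta> \<mu> l = w l * sqrt (real l + 1)" for l
    unfolding \<mu>_def w_def by (rule level_weight_half)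

  have Kbox: "K = cbox (a, lo) (b, hi)"
    by (simp add: K cbox_Pair_eq)
  have Kc: "compact K" "convex K" "bounded K"
    unfolding Kbox by (auto intro: compact_cbox convex_box bounded_cbox)
  have cont: "continuous_on UNIV (\<lambda>(x, y). \<rho> x y)"
    and sym: "\<And>x y. \<rho> x y = \<rho> y x"
    using \<rho> unfolding quasi_metric_def by blast+
  have pos: "0 < \<rho> x y" if "x \<noteq> y" for x y
    using \<rho> that unfolding quasi_metric_def by (metis less_le)
  obtain \<kappa> where \<kappa>: "1 \<le> \<kappa>" and tri: "\<And>x y z. \<rho> x z \<le> \<kappa> * (\<rho> x y + \<rho> y z)"
    using \<rho> unfolding quasi_metric_def by blast
  obtain C\<^sub>v l\<^sub>1 where C\<^sub>v: "0 \<le> C\<^sub>v" "1 \<le> l\<^sub>1"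
    and v_sup: "\<And>v x. x \<in> K \<Longrightarrow> modulus_sup \<rho> K r \<beta> \<eta> v < \<top> \<Longrightarrow>
       cmod (v x) \<le> C\<^sub>v * (cmod (v x\<^sub>0) + enn2real (modulus_sup \<rho> K r \<beta> \<eta> v))"
    and v_inc: "\<And>v x y l. x \<in> K \<Longrightarrow> y \<in> K \<Longrightarrow> l\<^sub>1 \<le> l \<Longrightarrow> \<rho> x y \<le> 2 powr (- real l) \<Longrightarrow> modulus_sup \<rho> K r \<beta> \<eta> v < \<top> \<Longrightarrow>
       cmod (v x - v y) \<le> C\<^sub>v * enn2real (modulus_sup \<rho> K r \<beta> \<eta> v) * w l"
    and dist_inc: "\<And>x y l. x \<in> K \<Longrightarrow> y \<in> K \<Longrightarrow> l\<^sub>1 \<le> l \<Longrightarrow> \<rho> x y \<le> 2 powr (- real l) \<Longrightarrow> norm (x - y) \<le> C\<^sub>v * w l"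
    using H(5) unfolding w_def \<eta>'_def
    by (rule path_bounds_of_modulus[OF Kc(1,2) x\<^sub>0 \<rho> H(1-4) _ params(1-3), where \<eta> = \<eta>])
      (assumption, rule that[unfolded w_def \<eta>'_def], assumption, assumption, blast+)
  obtain j :: nat where "3 * \<kappa>\<^sup>2 < 2 ^ j"
    using real_arch_pow[of 2 "3 * \<kappa>\<^sup>2"] by auto
  then have j: "3 * \<kappa>\<^sup>2 \<le> 2 powr real j"
    by (simp add: powr_realpow)
  define l\<^sub>0 where "l\<^sub>0 = l\<^sub>1 + j"
  obtain h where h: "0 < h" "\<And>x y. norm (x - y) \<le> h \<Longrightarrow> \<rho> x y \<le> 2 powr (- real l\<^sub>0)"
    using distance_bound_imp_small[of H\<^sub>1 c\<^sub>2 \<rho> l\<^sub>0] H by metis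
  obtain D B\<^sub>0 where B\<^sub>0: "1 \<le> B\<^sub>0" and D: "\<And>l. finite (D l)" "\<And>l. D l \<subseteq> K"
      "\<And>l. real (card (D l)) \<le> B\<^sub>0 ^ Suc l"
      "\<And>l x. x \<in> K \<Longrightarrow> \<exists>y\<in>D l. \<rho> x y \<le> 2 powr (- real l)"
    using dyadic_nets[of x\<^sub>0 "(a, lo)" "(b, hi)" H\<^sub>1 c\<^sub>2 \<rho>] x\<^sub>0 H unfolding Kbox by metis

  \<comment> \<open>From level \<open>l\<^sub>0\<close> on, links of length \<open>3 \<kappa>\<^sup>2 2\<^sup>-\<^sup>l\<close> are short enough for the local bounds, at the
      price of a shift by \<open>j\<close> levels.\<close>
  define E where "E l = {(u, v). u \<in> D l \<and> v \<in> D l \<union> D (Suc l) \<and> \<rho> u v \<le> 3 * \<kappa>\<^sup>2 * 2 powr (- real l)}" for l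
  have E_sub: "E l \<subseteq> D l \<times> (D l \<union> D (Suc l))" for l
    by (auto simp: E_def)
  have E_fin: "finite (E l)" for l
    using D(1) by (intro finite_subset[OF E_sub]) auto
  have E_card: "real (card (E l)) \<le> (2 * B\<^sub>0 ^ 3) ^ Suc l" for l
  proof -
    have "card (E l) \<le> card (D l) * card (D l \<union> D (Suc l))"
      using D(1) card_mono[OF _ E_sub[of l]] by (simp add: card_cartesian_product)
    also have "\<dots> \<le> card (D l) * (card (D l) + card (D (Suc l)))"
      by (intro mult_left_mono card_Un_le) auto
    finally have "real (card (E l)) \<le> real (card (D l)) * (real (card (D l)) + real (card (D (Suc l))))"
      by (metis of_nat_add of_nat_le_iff of_nat_mult)
    also have "\<dots> \<le> B\<^sub>0 ^ Suc l * (B\<^sub>0 ^ Suc l + B\<^sub>0 ^ Suc (Suc l))"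
      using B\<^sub>0 by (intro mult_mono add_mono D(3)) auto
    also have "\<dots> \<le> B\<^sub>0 ^ Suc l * (B\<^sub>0 ^ (2 * Suc l) + B\<^sub>0 ^ (2 * Suc l))"
      using B\<^sub>0 by (intro mult_left_mono add_mono power_increasing) auto
    also have "\<dots> = 2 * (B\<^sub>0 ^ 3) ^ Suc l"
    proof -
      have "B\<^sub>0 ^ Suc l * B\<^sub>0 ^ (2 * Suc l) = (B\<^sub>0 ^ 3) ^ Suc l"
        unfolding power_add [symmetric] power_mult [symmetric] by (rule arg_cong[where f = "(^) B\<^sub>0"]) simp
      then show ?thesis
        by (simp only: distrib_left mult_2)
    qed
    also have "\<dots> \<le> 2 ^ Suc l * (B\<^sub>0 ^ 3) ^ Suc l"
      using B\<^sub>0 by (intro mult_right_mono) auto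
    finally show ?thesis
      by (simp only: power_mult_distrib)
  qed
  have E_close: "\<rho> u v \<le> 2 powr (- real (l - j))" "l\<^sub>1 \<le> l - j" "u \<in> K" "v \<in> K"
    if "(u, v) \<in> E l" "l\<^sub>0 \<le> l" for u v l
  proof -
    have "\<rho> u v \<le> 3 * \<kappa>\<^sup>2 * 2 powr (- real l)"
      using that(1) by (auto simp: E_def)
    also have "\<dots> \<le> 2 powr real j * 2 powr (- real l)"
      by (intro mult_right_mono j) auto
    also have "\<dots> = 2 powr (- real (l - j))"
      using that(2) by (simp add: powr_add [symmetric] l\<^sub>0_def of_nat_diff)
    finally show "\<rho> u v \<le> 2 powr (- real (l - j))" .
    show "l\<^sub>1 \<le> l - j" "u \<in> K" "v \<in> K"
      using that D(2) by (auto simp: E_def l\<^sub>0_def)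
  qed

  define TA where "TA = vimage_algebra (space M) (\<lambda>\<omega>. \<lambda>n\<in>{1..}. T n \<omega>) (\<Pi>\<^sub>M n\<in>{1::nat..}. borel :: real measure)"
  define VA where "VA = vimage_algebra (space M) (\<lambda>\<omega>. \<lambda>n\<in>{1..}. V n \<omega>) (\<Pi>\<^sub>M n\<in>{1::nat..}. P)"
  define GA where "GA = vimage_algebra (space M) (\<lambda>\<omega>. \<lambda>n\<in>{1..}. g n \<omega>) (\<Pi>\<^sub>M n\<in>{1::nat..}. borel :: complex measure)"
  define A where "A = sigma (space M) (sets TA \<union> sets VA)"
  have sp: "space TA = space M" "space VA = space M" "space GA = space M" "space A = space M"
  proof -
    show *: "space TA = space M" "space VA = space M" "space GA = space M"
      by (simp_all add: TA_def VA_def GA_def)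
    have "sets TA \<union> sets VA \<subseteq> Pow (space M)"
      using sets.sets_into_space[of _ TA] sets.sets_into_space[of _ VA] * by auto
    then show "space A = space M"
      by (simp add: A_def space_measure_of)
  qed
  have indep_AG: "indep_set (sets A) (sets GA)"
    unfolding A_def using indep sp(1-3)
    by (intro indep_set_sigma_Un) (simp_all add: seq_events_def TA_def VA_def GA_def)
  have V_meas: "V n \<in> measurable M P" if "1 \<le> n" for n
    using V that unfolding iid_sequence_def indep_vars_def by auto
  have T_A: "T n \<in> borel_measurable A" if "1 \<le> n" for n
  proof -
    have "T n \<in> borel_measurable TA"
      unfolding TA_def using that by (rule measurable_vimage_seq_component) simp
    then show ?thesis
      unfolding A_def by (intro measurable_sigma_Un disjI1 sp)
  qed
  have V_A: "V n \<in> measurable A P" if "1 \<le> n" for n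
  proof -
    have "V n \<in> measurable VA P"
      unfolding VA_def using that by (rule measurable_vimage_seq_component) (rule measurable_space[OF V_meas])
    then show ?thesis
      unfolding A_def by (intro measurable_sigma_Un disjI2 sp)
  qed
  have g_G: "g n \<in> borel_measurable GA" if "1 \<le> n" for n
    unfolding GA_def using that by (rule measurable_vimage_seq_component) simp
  define t where "t n x \<omega> = of_real (T n \<omega> powr (- 1 / fst x)) * V n \<omega> x" for n x \<omega>
  have t_A: "t n x \<in> borel_measurable A" if "1 \<le> n" "x \<in> K" for n x
  proof -
    have [measurable]: "T n \<in> borel_measurable A" "(\<lambda>\<omega>. V n \<omega> x) \<in> borel_measurable A"
      using T_A[OF that(1)] measurable_compose[OF V_A[OF that(1)] P(1)[OF that(2)]] by auto
    show ?thesis unfolding t_def by measurable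
  qed

  \<comment> \<open>Dividing the increments by the weight of the level makes the sums of squares bounded uniformly
      over all links.\<close>
  have link_bound: "AE \<omega> in M. \<exists>C\<ge>0. \<forall>N\<ge>1. \<forall>l. \<forall>e\<in>E l.
      cmod (\<Sum>n=1..N. of_real (real n powr s / w l) * (t n (fst e) \<omega> - t n (snd e) \<omega>) * g n \<omega>)
        \<le> C * sqrt (real l + 1) * real N powr \<delta> *
          (1 + (\<Sum>n=1..N. (cmod (of_real (real n powr s / w l) * (t n (fst e) \<omega> - t n (snd e) \<omega>)))\<^sup>2))"
  proof (rule sub_gaussian_partial_sums_bound[OF sp(4) sp(3) indep_AG g_G g(1) g(2) E_fin E_card _ _ \<delta>(1)])
    show "1 \<le> 2 * B\<^sub>0 ^ 3"
      using one_le_power[OF B\<^sub>0, of 3] by simp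
    fix l e and n :: nat assume e: "e \<in> E l" and n: "1 \<le> n"
    have "fst e \<in> K" "snd e \<in> K"
      using e D(2)[of l] D(2)[of "Suc l"] by (auto simp: E_def)
    with n have [measurable]: "t n (fst e) \<in> borel_measurable A" "t n (snd e) \<in> borel_measurable A"
      by (auto intro!: t_A)
    show "(\<lambda>\<omega>. of_real (real n powr s / w l) * (t n (fst e) \<omega> - t n (snd e) \<omega>)) \<in> borel_measurable A"
      by measurable
  qed auto
  have start_bound: "AE \<omega> in M. \<exists>C\<ge>0. \<forall>N\<ge>1. \<forall>l::nat. \<forall>e\<in>{x\<^sub>0}.
      cmod (\<Sum>n=1..N. of_real (real n powr s) * t n e \<omega> * g n \<omega>)
        \<le> C * sqrt (real l + 1) * real N powr \<delta> * (1 + (\<Sum>n=1..N. (cmod (of_real (real n powr s) * t n e \<omega>))\<^sup>2))"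
  proof (rule sub_gaussian_partial_sums_bound[OF sp(4) sp(3) indep_AG g_G g(1) g(2), where E = "\<lambda>_. {x\<^sub>0}" and D = 1])
    fix e and n :: nat assume "e \<in> {x\<^sub>0}" "1 \<le> n"
    then have [measurable]: "t n e \<in> borel_measurable A"
      using x\<^sub>0 by (auto intro!: t_A)
    show "(\<lambda>\<omega>. of_real (real n powr s) * t n e \<omega>) \<in> borel_measurable A"
      by measurable
  qed (use \<delta> in auto)
  show ?thesis
    using poisson_arrival_times_lower_bound[OF T]
      modulus_moments[OF P(1)[OF x\<^sub>0] P(2) V q moment modulus \<gamma>] link_bound start_bound
  proof eventually_elim
    case (elim \<omega>)
    obtain c where c: "0 < c" "c \<le> 1" "\<And>n. 1 \<le> n \<Longrightarrow> c * real n \<le> T n \<omega>"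
      using elim(1) by blast
    have fin: "modulus_sup \<rho> K r \<beta> \<eta> (V n \<omega>) < \<top>" if "1 \<le> n" for n
      using elim(2) that by blast
    define W where "W n = cmod (V n \<omega> x\<^sub>0) + enn2real (modulus_sup \<rho> K r \<beta> \<eta> (V n \<omega>))" for n
    have W_nn: "0 \<le> W n" for n by (simp add: W_def)
    obtain C\<^sub>p where C\<^sub>p: "0 \<le> C\<^sub>p"
      "\<And>n t \<alpha>. 1 \<le> n \<Longrightarrow> c * real n \<le> t \<Longrightarrow> \<alpha> \<in> {a..b} \<Longrightarrow> t powr (- 1 / \<alpha>) \<le> C\<^sub>p * real n powr (\<delta> - 1 / b)"
      "\<And>n t \<alpha> \<alpha>'. 1 \<le> n \<Longrightarrow> c * real n \<le> t \<Longrightarrow> \<alpha> \<in> {a..b} \<Longrightarrow> \<alpha>' \<in> {a..b} \<Longrightarrow>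
        \<bar>t powr (- 1 / \<alpha>) - t powr (- 1 / \<alpha>')\<bar> \<le> C\<^sub>p * real n powr (\<delta> - 1 / b) * \<bar>\<alpha> - \<alpha>'\<bar>"
      using negative_power_bounds[OF K(2) ab(2) c(1,2) \<delta>(1,3)] by metis
    define C\<^sub>a where "C\<^sub>a = C\<^sub>p * (C\<^sub>v * C\<^sub>v + C\<^sub>v)"
    have C\<^sub>a: "0 \<le> C\<^sub>a" using C\<^sub>p C\<^sub>v by (simp add: C\<^sub>a_def)
    define A' where "A' n = C\<^sub>a * real n powr (s + \<delta> - 1 / b) * W n" for n
    have A'_nn: "0 \<le> A' n" for n
      using C\<^sub>a W_nn by (simp add: A'_def)
    have fstK: "fst x \<in> {a..b}" if "x \<in> K" for x
      using that by (auto simp: K)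
    have t_sup: "cmod (of_real (real n powr s) * t n x \<omega>) \<le> C\<^sub>p * C\<^sub>v * real n powr (s + \<delta> - 1 / b) * W n"
      if n: "1 \<le> n" and x: "x \<in> K" for n x
    proof -
      have "cmod (of_real (real n powr s) * t n x \<omega>) = real n powr s * (T n \<omega> powr (- 1 / fst x) * cmod (V n \<omega> x))"
        by (simp add: t_def norm_mult)
      also have "\<dots> \<le> real n powr s * ((C\<^sub>p * real n powr (\<delta> - 1 / b)) * (C\<^sub>v * W n))"
        using v_sup[OF x fin[OF n]] C\<^sub>p(1) C\<^sub>p(2)[OF n c(3)[OF n] fstK[OF x]]
        by (intro mult_left_mono mult_mono) (auto simp: W_def)
      also have "\<dots> = C\<^sub>p * C\<^sub>v * real n powr (s + \<delta> - 1 / b) * W n"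
        by (simp add: powr_add [symmetric] algebra_simps)
      finally show ?thesis .
    qed
    have t_inc: "cmod (of_real (real n powr s) * (t n x \<omega> - t n y \<omega>)) \<le> A' n * w l"
      if n: "1 \<le> n" and xy: "x \<in> K" "y \<in> K" "l\<^sub>1 \<le> l" "\<rho> x y \<le> 2 powr (- real l)" for n x y l
    proof -
      let ?R = "real n powr (\<delta> - 1 / b)"
      have "cmod (t n x \<omega> - t n y \<omega>)
          \<le> \<bar>T n \<omega> powr (- 1 / fst x) - T n \<omega> powr (- 1 / fst y)\<bar> * cmod (V n \<omega> x)
            + T n \<omega> powr (- 1 / fst y) * cmod (V n \<omega> x - V n \<omega> y)"
      proof -
        have "t n x \<omega> - t n y \<omega> = of_real (T n \<omega> powr (- 1 / fst x) - T n \<omega> powr (- 1 / fst y)) * V n \<omega> x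
            + of_real (T n \<omega> powr (- 1 / fst y)) * (V n \<omega> x - V n \<omega> y)"
          by (simp add: t_def algebra_simps)
        also have "cmod \<dots> \<le> cmod (of_real (T n \<omega> powr (- 1 / fst x) - T n \<omega> powr (- 1 / fst y)) * V n \<omega> x)
            + cmod (of_real (T n \<omega> powr (- 1 / fst y)) * (V n \<omega> x - V n \<omega> y))"
          by (rule norm_triangle_ineq)
        finally show ?thesis
          unfolding norm_mult norm_of_real by simp
      qed
      also have "\<dots> \<le> (C\<^sub>p * ?R * (C\<^sub>v * w l)) * (C\<^sub>v * W n) + (C\<^sub>p * ?R) * (C\<^sub>v * W n * w l)"
      proof (intro add_mono mult_mono)
        have "\<bar>fst x - fst y\<bar> \<le> norm (x - y)"
          using dist_fst_le[of x y] by (simp add: dist_norm)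
        also have "\<dots> \<le> C\<^sub>v * w l"
          by (rule dist_inc[OF xy])
        finally have "C\<^sub>p * ?R * \<bar>fst x - fst y\<bar> \<le> C\<^sub>p * ?R * (C\<^sub>v * w l)"
          using C\<^sub>p by (intro mult_left_mono) auto
        then show "\<bar>T n \<omega> powr (- 1 / fst x) - T n \<omega> powr (- 1 / fst y)\<bar> \<le> C\<^sub>p * ?R * (C\<^sub>v * w l)"
          using C\<^sub>p(3)[OF n c(3)[OF n] fstK[OF xy(1)] fstK[OF xy(2)]] by linarith
        show "cmod (V n \<omega> x) \<le> C\<^sub>v * W n"
          using v_sup[OF xy(1) fin[OF n]] by (simp add: W_def)
        show "T n \<omega> powr (- 1 / fst y) \<le> C\<^sub>p * ?R"
          by (rule C\<^sub>p(2)[OF n c(3)[OF n] fstK[OF xy(2)]])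
        have "C\<^sub>v * enn2real (modulus_sup \<rho> K r \<beta> \<eta> (V n \<omega>)) * w l \<le> C\<^sub>v * W n * w l"
          using C\<^sub>v w_pos[of l] by (intro mult_right_mono mult_left_mono) (auto simp: W_def)
        then show "cmod (V n \<omega> x - V n \<omega> y) \<le> C\<^sub>v * W n * w l"
          using v_inc[OF xy fin[OF n]] by linarith
      qed (use C\<^sub>p C\<^sub>v w_pos[of l] in auto)
      also have "\<dots> = C\<^sub>a * ?R * W n * w l"
        by (simp add: C\<^sub>a_def algebra_simps)
      finally have "real n powr s * cmod (t n x \<omega> - t n y \<omega>) \<le> real n powr s * (C\<^sub>a * ?R * W n * w l)"
        by (intro mult_left_mono) auto
      also have "\<dots> = A' n * w l"
        by (simp add: A'_def powr_add [symmetric] algebra_simps)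
      finally show ?thesis
        by (simp add: norm_mult)
    qed
    have t_start: "cmod (of_real (real n powr s) * t n x\<^sub>0 \<omega>) \<le> A' n" if "1 \<le> n" for n
    proof -
      have "C\<^sub>p * C\<^sub>v * real n powr (s + \<delta> - 1 / b) * W n \<le> C\<^sub>p * C\<^sub>v * real n powr (s + \<delta> - 1 / b) * W n + C\<^sub>p * (C\<^sub>v * C\<^sub>v) * real n powr (s + \<delta> - 1 / b) * W n"
        using C\<^sub>p C\<^sub>v W_nn by simp
      then show ?thesis
        using t_sup[OF that x\<^sub>0] by (simp add: A'_def C\<^sub>a_def algebra_simps)
    qed

    have "summable (\<lambda>n. (A' (Suc n))\<^sup>2)"
    proof -
      have "(A' (Suc n))\<^sup>2 = C\<^sub>a\<^sup>2 * (real (Suc n) powr (- \<gamma>) * (W (Suc n))\<^sup>2)" for n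
      proof -
        have "(real (Suc n) powr (s + \<delta> - 1 / b))\<^sup>2 = real (Suc n) powr (- \<gamma>)"
          by (simp add: power2_eq_square powr_add [symmetric] \<gamma>_def algebra_simps)
        then show ?thesis
          by (simp add: A'_def power_mult_distrib)
      qed
      moreover have "summable (\<lambda>n. real (Suc n) powr (- \<gamma>) * (W (Suc n))\<^sup>2)"
        using elim(2) unfolding W_def by blast
      ultimately show ?thesis
        by (simp only: summable_mult)
    qed
    define Q where "Q = (\<Sum>n. (A' (Suc n))\<^sup>2)"
    have Q: "(\<Sum>n=1..N. (A' n)\<^sup>2) \<le> Q" "0 \<le> Q" for N
    proof -
      have "(\<Sum>n=1..N. (A' n)\<^sup>2) = (\<Sum>n<N. (A' (Suc n))\<^sup>2)"
        by (simp add: sum.atLeast1_atMost_eq)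
      also have "\<dots> \<le> Q"
        unfolding Q_def using \<open>summable (\<lambda>n. (A' (Suc n))\<^sup>2)\<close> by (intro sum_le_suminf) auto
      finally show "(\<Sum>n=1..N. (A' n)\<^sup>2) \<le> Q" .
      show "0 \<le> Q"
        unfolding Q_def using \<open>summable (\<lambda>n. (A' (Suc n))\<^sup>2)\<close> by (intro suminf_nonneg) auto
    qed

    define cf where "cf n x = of_real (real n powr s) * t n x \<omega> * g n \<omega>" for n x
    define J where "J = 2 powr (real j * \<beta>)"
    obtain C\<^sub>l where C\<^sub>l: "0 \<le> C\<^sub>l" "\<And>N l e. 1 \<le> N \<Longrightarrow> e \<in> E l \<Longrightarrow>
      cmod (\<Sum>n=1..N. of_real (real n powr s / w l) * (t n (fst e) \<omega> - t n (snd e) \<omega>) * g n \<omega>)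
        \<le> C\<^sub>l * sqrt (real l + 1) * real N powr \<delta> *
          (1 + (\<Sum>n=1..N. (cmod (of_real (real n powr s / w l) * (t n (fst e) \<omega> - t n (snd e) \<omega>)))\<^sup>2))"
      using elim(3) by blast
    obtain C\<^sub>s where C\<^sub>s: "0 \<le> C\<^sub>s" "\<And>N l::nat. 1 \<le> N \<Longrightarrow>
      cmod (\<Sum>n=1..N. of_real (real n powr s) * t n x\<^sub>0 \<omega> * g n \<omega>)
        \<le> C\<^sub>s * sqrt (real l + 1) * real N powr \<delta> * (1 + (\<Sum>n=1..N. (cmod (of_real (real n powr s) * t n x\<^sub>0 \<omega>))\<^sup>2))"
      using elim(4) by blast
    have links: "cmod (\<Sum>n=1..N. cf n u - cf n v) \<le> C\<^sub>l * (1 + J\<^sup>2 * Q) * real N powr \<delta> * level_weight \<beta> \<mu> l"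
      if N: "1 \<le> N" and l: "l\<^sub>0 \<le> l" and uv: "(u, v) \<in> E l" for N l u v
    proof -
      let ?z = "\<lambda>n. of_real (real n powr s / w l) * (t n u \<omega> - t n v \<omega>)"
      have z: "cmod (?z n) \<le> J * A' n" if n: "1 \<le> n" for n
      proof -
        have "cmod (?z n) = cmod (of_real (real n powr s) * (t n u \<omega> - t n v \<omega>)) / w l"
          using w_pos[of l] by (simp add: norm_mult norm_divide)
        also have "\<dots> \<le> A' n * w (l - j) / w l"
          using E_close[OF uv l] w_pos[of l] by (intro divide_right_mono t_inc n) auto
        also have "\<dots> \<le> A' n * (J * w l) / w l"
        proof -
          have "w (l - j) \<le> J * w l"
            unfolding w_def J_def using l \<mu> by (intro level_weight_shift_le) (auto simp: l\<^sub>0_def)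
          then show ?thesis
            using A'_nn w_pos[of l] by (intro divide_right_mono mult_left_mono) auto
        qed
        also have "\<dots> = J * A' n"
          using w_pos[of l] by simp
        finally show ?thesis .
      qed
      have "(\<Sum>n=1..N. (cmod (?z n))\<^sup>2) \<le> (\<Sum>n=1..N. J\<^sup>2 * (A' n)\<^sup>2)"
        using z by (intro sum_mono) (auto simp: power_mult_distrib [symmetric] intro!: power_mono)
      also have "\<dots> \<le> J\<^sup>2 * Q"
        unfolding sum_distrib_left [symmetric] by (intro mult_left_mono Q) auto
      finally have zQ: "(\<Sum>n=1..N. (cmod (?z n))\<^sup>2) \<le> J\<^sup>2 * Q" .
      have "cmod (\<Sum>n=1..N. ?z n * g n \<omega>) \<le> C\<^sub>l * sqrt (real l + 1) * real N powr \<delta> * (1 + (\<Sum>n=1..N. (cmod (?z n))\<^sup>2))"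
        using C\<^sub>l(2)[OF N uv] by (simp only: fst_conv snd_conv)
      also have "\<dots> \<le> C\<^sub>l * sqrt (real l + 1) * real N powr \<delta> * (1 + J\<^sup>2 * Q)"
        using C\<^sub>l zQ by (intro mult_left_mono) auto
      finally have main: "cmod (\<Sum>n=1..N. ?z n * g n \<omega>) \<le> C\<^sub>l * sqrt (real l + 1) * real N powr \<delta> * (1 + J\<^sup>2 * Q)" .
      have "(\<Sum>n=1..N. cf n u - cf n v) = of_real (w l) * (\<Sum>n=1..N. ?z n * g n \<omega>)"
        unfolding sum_distrib_left
      proof (rule sum.cong[OF refl])
        fix n
        have "complex_of_real (real n powr s) = of_real (w l) * of_real (real n powr s / w l)"
          using w_pos[of l] by (simp only: of_real_mult [symmetric]) simp
        then show "cf n u - cf n v = of_real (w l) * (?z n * g n \<omega>)"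
          by (simp only: cf_def) (simp only: left_diff_distrib right_diff_distrib mult.assoc)
      qed
      then have "cmod (\<Sum>n=1..N. cf n u - cf n v) = w l * cmod (\<Sum>n=1..N. ?z n * g n \<omega>)"
        using w_pos[of l] by (simp only: norm_mult norm_of_real abs_of_pos)
      also have "\<dots> \<le> w l * (C\<^sub>l * sqrt (real l + 1) * real N powr \<delta> * (1 + J\<^sup>2 * Q))"
        using w_pos[of l] main by (intro mult_left_mono) auto
      also have "\<dots> = C\<^sub>l * (1 + J\<^sup>2 * Q) * real N powr \<delta> * level_weight \<beta> \<mu> l"
        unfolding w\<mu> by (simp only: mult_ac)
      finally show ?thesis .
    qed
    have start: "cmod (\<Sum>n=1..N. cf n x\<^sub>0) \<le> C\<^sub>s * (1 + Q) * real N powr \<delta>" if N: "1 \<le> N" for N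
    proof -
      have "(\<Sum>n=1..N. (cmod (of_real (real n powr s) * t n x\<^sub>0 \<omega>))\<^sup>2) \<le> (\<Sum>n=1..N. (A' n)\<^sup>2)"
        using t_start by (intro sum_mono power_mono) auto
      also have "\<dots> \<le> Q" by (rule Q)
      finally have "C\<^sub>s * real N powr \<delta> * (1 + (\<Sum>n=1..N. (cmod (of_real (real n powr s) * t n x\<^sub>0 \<omega>))\<^sup>2)) \<le> C\<^sub>s * real N powr \<delta> * (1 + Q)"
        using C\<^sub>s by (intro mult_left_mono) auto
      then show ?thesis
        using C\<^sub>s(2)[OF N, of 0] by (simp add: cf_def mult_ac)
    qed
    have cont_cf: "cmod (cf n x - cf n y) \<le> (A' n * cmod (g n \<omega>)) * level_weight \<beta> \<mu> l"
      if "1 \<le> n" "x \<in> K" "y \<in> K" "l\<^sub>0 \<le> l" "\<rho> x y \<le> 2 powr (- real l)" for n x y l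
    proof -
      have "cmod (cf n x - cf n y) = cmod (of_real (real n powr s) * (t n x \<omega> - t n y \<omega>)) * cmod (g n \<omega>)"
        unfolding norm_mult [symmetric] cf_def by (simp add: algebra_simps)
      also have "\<dots> \<le> A' n * w l * cmod (g n \<omega>)"
        using that by (intro mult_right_mono t_inc) (auto simp: l\<^sub>0_def)
      also have "\<dots> \<le> A' n * level_weight \<beta> \<mu> l * cmod (g n \<omega>)"
        using A'_nn w_pos[of l] unfolding w\<mu> by (intro mult_right_mono mult_left_mono) auto
      finally show ?thesis by (simp only: mult_ac)
    qed
    have nn: "0 \<le> C\<^sub>l * (1 + J\<^sup>2 * Q)" "0 \<le> C\<^sub>s * (1 + Q)"
      using C\<^sub>l C\<^sub>s Q by auto
    obtain C where C: "0 \<le> C"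
      "\<And>N x. 1 \<le> N \<Longrightarrow> x \<in> K \<Longrightarrow> cmod (\<Sum>n=1..N. cf n x) \<le> C * real N powr \<delta>"
      "\<And>N x y k. 1 \<le> N \<Longrightarrow> x \<in> K \<Longrightarrow> y \<in> K \<Longrightarrow> l\<^sub>0 \<le> k \<Longrightarrow> \<rho> x y \<le> 2 powr (- real k) \<Longrightarrow>
         cmod (\<Sum>n=1..N. cf n x - cf n y) \<le> C * level_weight \<beta> \<mu> k * real N powr \<delta>"
    proof (rule partial_sums_modulus[where K = K and \<rho> = \<rho> and D = D and c = cf
          and A = "\<lambda>n. A' n * cmod (g n \<omega>)" and h = h and l\<^sub>0 = l\<^sub>0 and \<delta> = \<delta>, OF Kc(2,3) x\<^sub>0 sym \<kappa> tri h(1) h(2) D(2) D(4) params(2) \<mu>(2) nn cont_cf _ start])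
      show "cmod (\<Sum>n=1..N. cf n u - cf n v) \<le> C\<^sub>l * (1 + J\<^sup>2 * Q) * real N powr \<delta> * level_weight \<beta> \<mu> l"
        if "1 \<le> N" "l\<^sub>0 \<le> l" "u \<in> D l" "v \<in> D l \<union> D (Suc l)" "\<rho> u v \<le> 3 * \<kappa>\<^sup>2 * 2 powr (- real l)" for N l u v
        using that by (intro links) (auto simp: E_def)
    qed (assumption+, rule that, assumption, blast+)
    have term_eq: "of_real (real n powr (- s)) * cf n x = series_term T V g n x \<omega>" if "1 \<le> n" for n x
    proof -
      have "complex_of_real (real n powr (- s)) * of_real (real n powr s) = 1"
        using that by (simp add: of_real_mult [symmetric] powr_add [symmetric] del: of_real_mult)
      then have "of_real (real n powr (- s)) * cf n x = t n x \<omega> * g n \<omega>"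
        unfolding cf_def by (simp only: mult.assoc [symmetric] mult_1_left)
      then show ?thesis
        by (simp add: series_term_def t_def)
    qed
    have partial_eq: "(\<Sum>n=1..N. of_real (real n powr (- s)) * cf n x) = partial_series T V g N x \<omega>" for N x
      unfolding partial_series_def by (intro sum.cong refl term_eq) auto
    have full_eq: "(\<Sum>n. of_real (real (Suc n) powr (- s)) * cf (Suc n) x) = full_series T V g x \<omega>" for x
      unfolding full_series_def by (intro suminf_cong term_eq) auto
    have "1 \<le> l\<^sub>0" using C\<^sub>v by (simp add: l\<^sub>0_def)
    note reg = damped_series_regularity[OF Kc(1) cont pos params(2) \<mu>(2) this less_imp_le[OF \<delta>(1)] \<delta>(2) C,
        unfolded partial_eq full_eq]
    have "\<delta> - s = - \<theta>" by (simp add: s_def)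
    with reg show ?case
      unfolding \<mu>_def \<eta>'_def by simp
  qed
qed

theorem theorem4p2:
  fixes M :: "'w measure"
    and T :: "nat \<Rightarrow> 'w \<Rightarrow> real"
    and V :: "nat \<Rightarrow> 'w \<Rightarrow> real \<times> (real ^ 'd) \<Rightarrow> complex"
    and g :: "nat \<Rightarrow> 'w \<Rightarrow> complex"
    and P :: "(real \<times> (real ^ 'd) \<Rightarrow> complex) measure"
    and \<rho> :: "real \<times> (real ^ 'd) \<Rightarrow> real \<times> (real ^ 'd) \<Rightarrow> real"
    and a b :: real and lo hi :: "real ^ 'd"
    and K :: "(real \<times> (real ^ 'd)) set"
    and H\<^sub>1 H\<^sub>2 c\<^sub>1 c\<^sub>2 r \<beta> \<eta> p :: real
    and x\<^sub>0 :: "real \<times> (real ^ 'd)"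
  assumes prob: "prob_space M"
    and K: "K = {a..b} \<times> cbox lo hi" "0 < a" "b < 2"
    and indep: "prob_space.indep_sets M
      (\<lambda>i. [seq_events M borel T, seq_events M P V, seq_events M borel g] ! i) {..<3}"
    and g: "prob_space.indep_vars M (\<lambda>_. borel) g {1..}"
      "\<And>n. n \<ge> 1 \<Longrightarrow> symmetric_rv M (g n)"
      "\<And>n. n \<ge> 1 \<Longrightarrow> sub_gaussian M 1 (g n)"
    and T: "poisson_arrival_times M 1 T"
    \<comment> \<open>\<open>P\<close> is the space of paths in which the random fields \<open>V n\<close> take their values; its
        sigma-algebra makes the evaluations and the supremum of the increments measurable.\<close>
    and P: "\<And>x. x \<in> K \<Longrightarrow> (\<lambda>v. v x) \<in> borel_measurable P"
      "modulus_sup \<rho> K r \<beta> \<eta> \<in> borel_measurable P"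
    and V: "iid_sequence M P V"
      "\<And>n x. n \<ge> 1 \<Longrightarrow> x \<in> K \<Longrightarrow> integrable M (\<lambda>\<omega>. cmod (V n \<omega> x) powr fst x)"
    and \<rho>: "quasi_metric \<rho>"
    and H: "0 < H\<^sub>1" "H\<^sub>1 \<le> H\<^sub>2" "H\<^sub>2 \<le> 1" "0 < c\<^sub>1" "0 < c\<^sub>2"
      "\<And>x y. norm (x - y) \<le> 1 \<Longrightarrow>
         c\<^sub>1 * norm (x - y) powr H\<^sub>2 \<le> \<rho> x y \<and> \<rho> x y \<le> c\<^sub>2 * norm (x - y) powr H\<^sub>1"
    and x\<^sub>0: "x\<^sub>0 \<in> K"
    and params: "0 < r" "0 < \<beta>" "\<beta> \<le> 1" "b / 2 < p"
    and moment: "integrable M (\<lambda>\<omega>. cmod (V 1 \<omega> x\<^sub>0) powr (2 * p))"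
    and modulus: "(\<integral>\<^sup>+ \<omega>. epowr (modulus_sup \<rho> K r \<beta> \<eta> (V 1 \<omega>)) (2 * p) \<partial>M) < \<infinity>"
  shows "(AE \<omega> in M.
            uniform_limit K (\<lambda>N x. partial_series T V g N x \<omega>) (\<lambda>x. full_series T V g x \<omega>) sequentially
            \<and> (\<lambda>x. full_series T V g x \<omega>) \<in> holder_class \<rho> K \<beta> (max \<eta> 0 + 1 / 2))
       \<and> (\<forall>p'>0. 1 / p' \<in> {0<..<1 / b - 1 / min (2 * p) 2} \<longrightarrow>
            (AE \<omega> in M.
               (SUP N. ennreal (real N powr (1 / p')) *
                  (SUP x\<in>K. ennreal (cmod (full_series T V g x \<omega> - partial_series T V g N x \<omega>)))) < \<infinity>))"
proof -
  have b: "0 < b"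
    using x\<^sub>0 K by auto
  have p: "0 < p"
    using params b by linarith
  define \<Delta> where "\<Delta> = 1 / b - 1 / min (2 * p) 2"
  have "1 / min (2 * p) 2 < 1 / b"
    using params K b by (intro divide_strict_left_mono) auto
  then have \<Delta>: "0 < \<Delta>"
    by (simp add: \<Delta>_def)
  have regularity: "AE \<omega> in M.
      uniform_limit K (\<lambda>N x. partial_series T V g N x \<omega>) (\<lambda>x. full_series T V g x \<omega>) sequentially
      \<and> (\<lambda>x. full_series T V g x \<omega>) \<in> holder_class \<rho> K \<beta> (max \<eta> 0 + 1 / 2)
      \<and> (\<exists>B\<ge>0. \<forall>N\<ge>1. \<forall>x\<in>K. cmod (full_series T V g x \<omega> - partial_series T V g N x \<omega>) \<le> B * real N powr (- \<theta>))"
    if "0 < \<theta>" "\<theta> < \<Delta>" for \<theta>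
    using that unfolding \<Delta>_def
    by (intro series_regularity_AE[OF prob K indep g(1) g(3) T P V(1) \<rho> H(1,3,4,5) H(6) x\<^sub>0
          params(1-3) moment modulus p])
  have "AE \<omega> in M.
      uniform_limit K (\<lambda>N x. partial_series T V g N x \<omega>) (\<lambda>x. full_series T V g x \<omega>) sequentially
      \<and> (\<lambda>x. full_series T V g x \<omega>) \<in> holder_class \<rho> K \<beta> (max \<eta> 0 + 1 / 2)"
    using regularity[of "\<Delta> / 2"] \<Delta> by auto
  moreover have "AE \<omega> in M.
      (SUP N. ennreal (real N powr (1 / p')) *
        (SUP x\<in>K. ennreal (cmod (full_series T V g x \<omega> - partial_series T V g N x \<omega>)))) < \<infinity>"
    if p': "1 / p' \<in> {0<..<1 / b - 1 / min (2 * p) 2}" for p'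
  proof -
    have "0 < 1 / p'" "1 / p' < \<Delta>"
      using p' by (auto simp: \<Delta>_def)
    from regularity[OF this] show ?thesis
    proof eventually_elim
      case (elim \<omega>)
      then obtain B where B: "0 \<le> B" "\<And>N x. 1 \<le> N \<Longrightarrow> x \<in> K \<Longrightarrow>
          cmod (full_series T V g x \<omega> - partial_series T V g N x \<omega>) \<le> B * real N powr (- (1 / p'))"
        by blast
      have "ennreal (real N powr (1 / p')) *
          (SUP x\<in>K. ennreal (cmod (full_series T V g x \<omega> - partial_series T V g N x \<omega>))) \<le> ennreal B" for N
      \<comment> \<open>The term for \<open>N = 0\<close> vanishes, since \<open>0 powr a = 0\<close>.\<close>
      proof (cases "N = 0")
        case False
        have "(SUP x\<in>K. ennreal (cmod (full_series T V g x \<omega> - partial_series T V g N x \<omega>)))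
            \<le> ennreal (B * real N powr (- (1 / p')))"
          using B(2)[of N] False by (intro SUP_least ennreal_leI) auto
        then have "ennreal (real N powr (1 / p')) *
            (SUP x\<in>K. ennreal (cmod (full_series T V g x \<omega> - partial_series T V g N x \<omega>)))
            \<le> ennreal (real N powr (1 / p')) * ennreal (B * real N powr (- (1 / p')))"
          by (rule mult_left_mono) simp
        also have "\<dots> = ennreal (real N powr (1 / p') * (B * real N powr (- (1 / p'))))"
          by (rule ennreal_mult'[symmetric]) simp
        also have "real N powr (1 / p') * (B * real N powr (- (1 / p'))) = B"
          using False by (simp add: powr_minus)
        finally show ?thesis .
      qed simp
      then have "(SUP N. ennreal (real N powr (1 / p')) *
          (SUP x\<in>K. ennreal (cmod (full_series T V g x \<omega> - partial_series T V g N x \<omega>)))) \<le> ennreal B"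
        by (intro SUP_least)
      also have "\<dots> < \<infinity>"
        by simp
      finally show ?case .
    qed
  qed
  ultimately show ?thesis
    by blast
qed

end
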